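(* Let $\Omega\subset\mathbb{R}^3$ be a bounded domain, let $f:\mathbb{R}\to\mathbb{R}$ be an odd $\mathcal{C}^1$ function with $f\ge0$ on $[0,\infty)$, and set $F(t)=\int_0^tf(s)\,ds$. Let $M:[0,\infty)\to[0,\infty)$ be a $\mathcal{C}^1$ function. Assume: (1) $M$ is increasing and $M(0)=:m_0>0$. (2) $t\mapsto\frac{M(t)}{t}$ is decreasing on $(0,\infty)$. (3) $\lim_{t\to0}\frac{f(t)}{t}=0$. (4) $\lim_{t\to\infty}\frac{F(t)}{t^4}=\infty$. (5) $\lim_{t\to\infty}\frac{f(t)}{t^{\alpha-1}}=0$ for some $\alpha\in(4,6)$. (6) $t\mapsto\frac{f(t)}{t^3}$ is increasing on $(0,\infty)$. Then the problem $$-M\left(\int_\Omega|\nabla u|^2\right)\Delta u=f(u),\quad u\in H_0^1(\Omega),$$ has a nontrivial and non-negative ground state.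
   Context: Solutions are weak solutions, i.e. critical points of the functional $\Phi(u)=\frac12\hat M(\|u\|^2)-\int_\Omega F(u)$ on $H_0^1(\Omega)$, where $\|u\|=\left(\int_\Omega|\nabla u|^2\right)^{1/2}$ and $\hat M(t)=\int_0^tM(s)\,ds$. A nontrivial ground state is a $u_0\ne0$ with $\Phi'(u_0)=0$ and $\Phi(u_0)=\min\{\Phi(u):\ u\ne0,\ \Phi'(u)=0\}$. "Increasing" and "decreasing" are meant strictly. *)

theory Defs
  imports "HOL-Analysis.Analysis"
begin

section \<open>Test functions\<close>

definition partial_deriv :: "'n::finite \<Rightarrow> (real^'n \<Rightarrow> real) \<Rightarrow> real^'n \<Rightarrow> real" where
  "partial_deriv i \<phi> x = frechet_derivative \<phi> (at x) (axis i 1)"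

primrec Ck :: "nat \<Rightarrow> (real^'n::finite \<Rightarrow> real) \<Rightarrow> bool" where
  "Ck 0 \<phi> \<longleftrightarrow> continuous_on UNIV \<phi>"
| "Ck (Suc k) \<phi> \<longleftrightarrow> \<phi> differentiable_on UNIV \<and> (\<forall>i. Ck k (partial_deriv i \<phi>))"

text \<open>Elements of \<open>C_c^\<infinity>(\<Omega>)\<close> are represented by their extension by zero to the whole space.\<close>

definition test_functions :: "(real^'n::finite) set \<Rightarrow> (real^'n \<Rightarrow> real) set" where
  "test_functions \<Omega> =
    {\<phi>. (\<forall>k. Ck k \<phi>) \<and> compact (closure {x. \<phi> x \<noteq> 0}) \<and> closure {x. \<phi> x \<noteq> 0} \<subseteq> \<Omega>}"


section \<open>The Sobolev space \<open>H_0^1\<close>\<close>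

text \<open>
  Elements of Lebesgue and Sobolev spaces are represented by functions on the whole space of which
  only the restriction to \<open>\<Omega>\<close> matters; two functions represent the same element iff they agree
  almost everywhere on \<open>\<Omega>\<close>.
\<close>

definition L2 :: "(real^'n::finite) set \<Rightarrow> (real^'n \<Rightarrow> 'b::euclidean_space) set" where
  "L2 \<Omega> = {u. u \<in> borel_measurable (lebesgue_on \<Omega>) \<and> integrable (lebesgue_on \<Omega>) (\<lambda>x. (norm (u x))\<^sup>2)}"

definition is_weak_grad ::
    "(real^'n::finite) set \<Rightarrow> (real^'n \<Rightarrow> real) \<Rightarrow> (real^'n \<Rightarrow> real^'n) \<Rightarrow> bool" where
  "is_weak_grad \<Omega> u g \<longleftrightarrow> g \<in> L2 \<Omega> \<and>
    (\<forall>\<phi>\<in>test_functions \<Omega>. \<forall>i.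
      (LINT x|lebesgue_on \<Omega>. u x * partial_deriv i \<phi> x) = - (LINT x|lebesgue_on \<Omega>. g x $ i * \<phi> x))"

definition H1 :: "(real^'n::finite) set \<Rightarrow> (real^'n \<Rightarrow> real) set" where
  "H1 \<Omega> = {u \<in> L2 \<Omega>. \<exists>g. is_weak_grad \<Omega> u g}"

text \<open>On \<open>H1 \<Omega>\<close> with \<open>\<Omega>\<close> open, the weak gradient is unique up to null sets, so the choice is immaterial.\<close>

definition weak_grad :: "(real^'n::finite) set \<Rightarrow> (real^'n \<Rightarrow> real) \<Rightarrow> real^'n \<Rightarrow> real^'n" where
  "weak_grad \<Omega> u = (SOME g. is_weak_grad \<Omega> u g)"

definition H1_norm :: "(real^'n::finite) set \<Rightarrow> (real^'n \<Rightarrow> real) \<Rightarrow> real" where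
  "H1_norm \<Omega> u =
    sqrt ((LINT x|lebesgue_on \<Omega>. (u x)\<^sup>2) + (LINT x|lebesgue_on \<Omega>. (norm (weak_grad \<Omega> u x))\<^sup>2))"

text \<open>\<open>H_0^1(\<Omega>)\<close> is the closure of \<open>C_c^\<infinity>(\<Omega>)\<close> in \<open>H^1(\<Omega>)\<close>.\<close>

definition H01 :: "(real^'n::finite) set \<Rightarrow> (real^'n \<Rightarrow> real) set" where
  "H01 \<Omega> = {u \<in> H1 \<Omega>. \<forall>e>0. \<exists>\<phi>\<in>test_functions \<Omega>. H1_norm \<Omega> (\<lambda>x. u x - \<phi> x) < e}"

definition H01_norm :: "(real^'n::finite) set \<Rightarrow> (real^'n \<Rightarrow> real) \<Rightarrow> real" where
  "H01_norm \<Omega> u = sqrt (LINT x|lebesgue_on \<Omega>. (norm (weak_grad \<Omega> u x))\<^sup>2)"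


section \<open>Critical points and ground states\<close>

text \<open>
  Frechet differentiability of a functional \<open>J\<close> at \<open>u\<close> in the space \<open>H_0^1(\<Omega>)\<close> normed by
  \<open>H01_norm\<close>. The constant \<open>has_derivative\<close> is not applicable, since the space depends on the
  term \<open>\<Omega>\<close>. Only the values of \<open>D\<close> on \<open>H01 \<Omega>\<close> are constrained.
\<close>

definition has_H01_derivative ::
    "(real^'n::finite) set \<Rightarrow> ((real^'n \<Rightarrow> real) \<Rightarrow> real) \<Rightarrow> ((real^'n \<Rightarrow> real) \<Rightarrow> real)
      \<Rightarrow> (real^'n \<Rightarrow> real) \<Rightarrow> bool" where
  "has_H01_derivative \<Omega> J D u \<longleftrightarrow>
    (\<forall>v\<in>H01 \<Omega>. \<forall>w\<in>H01 \<Omega>. D (\<lambda>x. v x + w x) = D v + D w) \<and>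
    (\<forall>v\<in>H01 \<Omega>. \<forall>c. D (\<lambda>x. c * v x) = c * D v) \<and>
    (\<exists>C. \<forall>v\<in>H01 \<Omega>. \<bar>D v\<bar> \<le> C * H01_norm \<Omega> v) \<and>
    (\<forall>e>0. \<exists>d>0. \<forall>v\<in>H01 \<Omega>. H01_norm \<Omega> v < d \<longrightarrow>
      \<bar>J (\<lambda>x. u x + v x) - J u - D v\<bar> \<le> e * H01_norm \<Omega> v)"

definition critical_point ::
    "(real^'n::finite) set \<Rightarrow> ((real^'n \<Rightarrow> real) \<Rightarrow> real) \<Rightarrow> (real^'n \<Rightarrow> real) \<Rightarrow> bool" where
  "critical_point \<Omega> J u \<longleftrightarrow> u \<in> H01 \<Omega> \<and> has_H01_derivative \<Omega> J (\<lambda>_. 0) u"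

definition nontrivial_on :: "(real^'n::finite) set \<Rightarrow> (real^'n \<Rightarrow> real) \<Rightarrow> bool" where
  "nontrivial_on \<Omega> u \<longleftrightarrow> \<not> (AE x in lebesgue_on \<Omega>. u x = 0)"

definition nontrivial_ground_state ::
    "(real^'n::finite) set \<Rightarrow> ((real^'n \<Rightarrow> real) \<Rightarrow> real) \<Rightarrow> (real^'n \<Rightarrow> real) \<Rightarrow> bool" where
  "nontrivial_ground_state \<Omega> J u\<^sub>0 \<longleftrightarrow>
    critical_point \<Omega> J u\<^sub>0 \<and> nontrivial_on \<Omega> u\<^sub>0 \<and>
    (\<forall>u. critical_point \<Omega> J u \<and> nontrivial_on \<Omega> u \<longrightarrow> J u\<^sub>0 \<le> J u)"


section \<open>The energy functional\<close>

text \<open>The interval integral is oriented, so that \<open>primitive h t = - \<integral>\<^sub>t\<^sup>0 h\<close> for negative \<open>t\<close>.\<close>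

definition primitive :: "(real \<Rightarrow> real) \<Rightarrow> real \<Rightarrow> real" where
  "primitive h t = (LBINT s=ereal 0..ereal t. h s)"

definition kirchhoff_energy ::
    "(real^'n::finite) set \<Rightarrow> (real \<Rightarrow> real) \<Rightarrow> (real \<Rightarrow> real) \<Rightarrow> (real^'n \<Rightarrow> real) \<Rightarrow> real" where
  "kirchhoff_energy \<Omega> M f u =
    primitive M ((H01_norm \<Omega> u)\<^sup>2) / 2 - (LINT x|lebesgue_on \<Omega>. primitive f (u x))"

text \<open>
  Continuous differentiability on \<open>[0,\<infinity>)\<close>, with a one-sided derivative at \<open>0\<close>; this does not
  depend on the values at negative arguments (\<open>C1_differentiable_on\<close> would need a two-sided
  derivative at \<open>0\<close>).
\<close>

definition C1_on_nonneg :: "(real \<Rightarrow> real) \<Rightarrow> bool" where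
  "C1_on_nonneg h \<longleftrightarrow>
    (\<exists>h'. continuous_on {0..} h' \<and> (\<forall>t\<ge>0. (h has_real_derivative h' t) (at t within {0..})))"

end

theory Submission
  imports Defs "HOL-Complex_Analysis.Great_Picard"
begin

text \<open>
  Write \<open>J\<close> for the energy and \<open>\<parallel>u\<parallel>\<close> for the norm of \<open>H\<^sub>0\<^sup>1\<close>. For \<open>u \<noteq> 0\<close> the slope of \<open>t \<mapsto> J(t u)\<close>,
  divided by \<open>t\<^sup>3\<close>, is strictly decreasing, because \<open>M(s)/s\<close> decreases and \<open>f(s)/s\<^sup>3\<close> increases
  (\<open>ray_slope_decreasing\<close>). Together with the growth of \<open>f\<close> at \<open>0\<close> and of its primitive \<open>F\<close> at
  infinity, \<open>J\<close> increases along each ray up to one maximum and decreases afterwards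
  (\<open>ray_maximum\<close>). A nontrivial critical point is the maximiser of its own ray, so its energy is
  at least the level \<open>c\<close>, the infimum of \<open>sup {J(t v) | t \<ge> 0}\<close> over the unit vectors \<open>v\<close>
  (\<open>critical_point_energy_ge\<close>). A non-negative critical point of energy \<open>c\<close> is therefore enough.

  Take unit vectors \<open>v\<^sub>n\<close> whose rays have suprema tending to \<open>c\<close>. By compactness a subsequence
  converges in \<open>L\<^sup>2\<close> and \<open>L\<^sup>\<alpha>\<close> to some \<open>w\<close> with \<open>\<parallel>w\<parallel> \<le> 1\<close>, and with \<open>m(s)\<close> for the integral of \<open>M\<close> from
  \<open>0\<close> to \<open>s\<close> one gets \<open>m(t\<^sup>2)/2 - \<integral>F(t w) \<le> c\<close> for every \<open>t \<ge> 0\<close>. If \<open>w\<close> vanished, \<open>m(t\<^sup>2) \<le> 2 c\<close> for all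
  \<open>t\<close>, which is false. Hence \<open>w \<noteq> 0\<close>, and since \<open>m\<close> increases the whole ray of \<open>w\<close> stays below \<open>c\<close>
  (\<open>optimal_ray\<close>). Normalising the \<open>v\<^sub>n\<close> is what makes the minimising sequence bounded for free.
  Replacing \<open>w\<close> by \<open>\<bar>w\<bar>\<close> does not raise the energy. Let \<open>u\<close> be the maximiser of that ray. It is
  critical (\<open>minimax_critical\<close>): if the derivative at \<open>u\<close> were negative in direction \<open>v\<close>, then for
  small \<open>h > 0\<close> the ray of \<open>u + h v\<close> would have its maximum near \<open>u\<close>, and there \<open>J\<close> would be
  smaller than \<open>c\<close>. This argument uses one derivative of \<open>J\<close>, but in the strict sense, with a
  moving base point (\<open>J_strict_derivative\<close>).

  The analysis behind this rests on averages over balls of radius \<open>t\<close>. For a test function \<open>\<phi>\<close>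
  the average differs from \<open>\<phi>\<close> by at most \<open>t \<parallel>\<phi>\<parallel>\<close> in \<open>L\<^sup>2\<close> (\<open>avg_error\<close>), and in dimension three it
  is bounded by a constant times \<open>t\<^bsup>-1/2\<^esup> \<parallel>\<phi>\<parallel>\<close> (\<open>abs_avg_le\<close>). Optimising in \<open>t\<close> gives a weak \<open>L\<^sup>6\<close> bound
  (\<open>weak_sobolev\<close>), hence bounds in \<open>L\<^sup>q\<close> on bounded sets for all \<open>q < 6\<close> (\<open>sobolev\<close>). For fixed \<open>t\<close> the
  averages are equi-Lipschitz, which yields compactness in \<open>L\<^sup>2\<close> (\<open>rellich\<close>). Weak limits are
  replaced by the fact that balls of \<open>H\<^sub>0\<^sup>1\<close> are closed in \<open>L\<^sup>2\<close> (\<open>weak_closure\<close>).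
\<close>

section \<open>Calculus of the classes \<open>C\<^sup>k\<close>\<close>

definition grad :: "(real^'n::finite \<Rightarrow> real) \<Rightarrow> real^'n \<Rightarrow> real^'n" where
  "grad \<phi> x = (\<chi> i. partial_deriv i \<phi> x)"

lemma partial_deriv_eq:
  assumes "(\<phi> has_derivative D) (at x)"
  shows "partial_deriv i \<phi> x = D (axis i 1)"
  unfolding partial_deriv_def using frechet_derivative_at[OF assms] by simp

lemma has_derivative_grad:
  fixes \<phi> :: "real^'n::finite \<Rightarrow> real"
  assumes "\<phi> differentiable (at x)"
  shows "(\<phi> has_derivative (\<lambda>h. grad \<phi> x \<bullet> h)) (at x)"
proof -
  let ?D = "frechet_derivative \<phi> (at x)"
  have D: "(\<phi> has_derivative ?D) (at x)" using assms frechet_derivative_works by blast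
  then have lin: "linear ?D" using has_derivative_linear by blast
  have "?D h = grad \<phi> x \<bullet> h" for h
  proof -
    have "?D h = ?D (\<Sum>i\<in>UNIV. h $ i *\<^sub>R axis i 1)"
      by (simp add: basis_expansion scalar_mult_eq_scaleR[symmetric])
    also have "\<dots> = (\<Sum>i\<in>UNIV. h $ i * ?D (axis i 1))"
      using lin by (simp add: linear_sum linear_cmul)
    also have "\<dots> = grad \<phi> x \<bullet> h"
      by (simp add: grad_def inner_vec_def partial_deriv_def mult.commute)
    finally show ?thesis .
  qed
  then have "?D = (\<lambda>h. grad \<phi> x \<bullet> h)" by (simp add: fun_eq_iff)
  then show ?thesis using D by simp
qed

lemma grad_unique:
  fixes \<phi> :: "real^'n::finite \<Rightarrow> real"
  assumes "(\<phi> has_derivative (\<lambda>h. g \<bullet> h)) (at x)"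
  shows "grad \<phi> x = g"
  by (simp add: vec_eq_iff grad_def partial_deriv_eq[OF assms] inner_axis)

lemma Ck_imp_continuous: "Ck k \<phi> \<Longrightarrow> continuous_on UNIV \<phi>"
  by (cases k) (auto intro: differentiable_imp_continuous_on)

lemma Ck_Suc_imp_Ck: "Ck (Suc k) \<phi> \<Longrightarrow> Ck k \<phi>"
proof (induction k arbitrary: \<phi>)
  case 0
  then show ?case by (auto intro: differentiable_imp_continuous_on)
next
  case (Suc k)
  show ?case using Suc.prems Suc.IH by (metis Ck.simps(2))
qed

lemma Ck_SucI:
  assumes "\<And>x. (\<phi> has_derivative D x) (at x)" "\<And>i. Ck k (\<lambda>x. D x (axis i 1))"
  shows "Ck (Suc k) \<phi>"
proof -
  have "partial_deriv i \<phi> = (\<lambda>x. D x (axis i 1))" for i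
    using partial_deriv_eq[OF assms(1)] by auto
  moreover have "\<phi> differentiable_on UNIV"
    using assms(1) by (auto simp: differentiable_on_def differentiable_def)
  ultimately show ?thesis using assms(2) by simp
qed

lemma Ck_Suc_has_derivative:
  fixes \<phi> :: "real^'n::finite \<Rightarrow> real"
  assumes "Ck (Suc k) \<phi>"
  shows "(\<phi> has_derivative (\<lambda>h. grad \<phi> x \<bullet> h)) (at x)"
  using assms by (intro has_derivative_grad) (auto simp: differentiable_on_def)

lemma Ck_Suc_grad: "Ck (Suc k) \<phi> \<Longrightarrow> Ck k (\<lambda>x. grad \<phi> x \<bullet> axis i 1)"
  by (simp add: grad_def inner_axis)

lemma Ck_const: "Ck k (\<lambda>x. c)"
proof (induction k arbitrary: c)
  case (Suc k)
  show ?case by (rule Ck_SucI[where D="\<lambda>x h. 0"]) (auto simp: Suc)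
qed simp

lemma Ck_add:
  fixes \<phi> \<psi> :: "real^'n::finite \<Rightarrow> real"
  shows "Ck k \<phi> \<Longrightarrow> Ck k \<psi> \<Longrightarrow> Ck k (\<lambda>x. \<phi> x + \<psi> x)"
proof (induction k arbitrary: \<phi> \<psi>)
  case 0
  then show ?case by (auto intro: continuous_intros)
next
  case (Suc k)
  show ?case
    by (rule Ck_SucI[where D="\<lambda>x h. grad \<phi> x \<bullet> h + grad \<psi> x \<bullet> h"])
      (auto intro!: has_derivative_add Ck_Suc_has_derivative[OF Suc.prems(1)]
         Ck_Suc_has_derivative[OF Suc.prems(2)] Suc.IH Ck_Suc_grad[OF Suc.prems(1)] Ck_Suc_grad[OF Suc.prems(2)])
qed

lemma Ck_mult:
  fixes \<phi> \<psi> :: "real^'n::finite \<Rightarrow> real"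
  shows "Ck k \<phi> \<Longrightarrow> Ck k \<psi> \<Longrightarrow> Ck k (\<lambda>x. \<phi> x * \<psi> x)"
proof (induction k arbitrary: \<phi> \<psi>)
  case 0
  then show ?case by (auto intro: continuous_intros)
next
  case (Suc k)
  show ?case
    by (rule Ck_SucI[where D="\<lambda>x h. \<phi> x * (grad \<psi> x \<bullet> h) + (grad \<phi> x \<bullet> h) * \<psi> x"])
      (intro has_derivative_mult Ck_Suc_has_derivative[OF Suc.prems(1)]
         Ck_Suc_has_derivative[OF Suc.prems(2)] Ck_add Suc.IH Ck_Suc_grad[OF Suc.prems(1)]
         Ck_Suc_grad[OF Suc.prems(2)] Ck_Suc_imp_Ck[OF Suc.prems(1)] Ck_Suc_imp_Ck[OF Suc.prems(2)])+
qed

lemma Ck_cmult: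
  fixes \<phi> :: "real^'n::finite \<Rightarrow> real"
  shows "Ck k \<phi> \<Longrightarrow> Ck k (\<lambda>x. c * \<phi> x)"
  by (intro Ck_mult Ck_const)

lemma Ck_diff:
  fixes \<phi> \<psi> :: "real^'n::finite \<Rightarrow> real"
  shows "Ck k \<phi> \<Longrightarrow> Ck k \<psi> \<Longrightarrow> Ck k (\<lambda>x. \<phi> x - \<psi> x)"
  using Ck_add[of k \<phi> "\<lambda>x. -1 * \<psi> x"] Ck_cmult[of k \<psi> "-1"] by simp

lemma Ck_sum:
  fixes \<phi> :: "'i \<Rightarrow> real^'n::finite \<Rightarrow> real"
  shows "(\<And>i. i \<in> I \<Longrightarrow> Ck k (\<phi> i)) \<Longrightarrow> Ck k (\<lambda>x. \<Sum>i\<in>I. \<phi> i x)"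
  by (induction I rule: infinite_finite_induct) (auto intro: Ck_add Ck_const)

lemma Ck_component: "Ck k (\<lambda>x::real^'n::finite. x $ i)"
proof (cases k)
  case (Suc m)
  show ?thesis unfolding Suc
    by (rule Ck_SucI[where D="\<lambda>x h. h $ i"])
      (auto intro!: Ck_const bounded_linear_imp_has_derivative bounded_linear_vec_nth)
qed (auto intro: continuous_intros)

text \<open>The induction on \<open>k\<close> replaces the outer function by its derivative, so it is carried out for a
  whole family \<open>H\<close> that is closed under differentiation.\<close>

lemma Ck_compose_family:
  fixes \<phi> :: "real^'n::finite \<Rightarrow> real"
  assumes H: "\<And>h. h \<in> H \<Longrightarrow> \<exists>h'\<in>H. \<forall>t\<in>S. (h has_real_derivative h' t) (at t)"
    and \<phi>: "\<And>k. Ck k \<phi>" "\<And>x. \<phi> x \<in> S" and h: "h \<in> H"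
  shows "Ck k (\<lambda>x. h (\<phi> x))"
  using h
proof (induction k arbitrary: h)
  case 0
  obtain h' where "\<forall>t\<in>S. (h has_real_derivative h' t) (at t)" using H[OF 0] by blast
  then have "isCont h (\<phi> x)" for x using \<phi>(2)[of x] DERIV_isCont by blast
  then have "continuous (at x) (\<lambda>x. h (\<phi> x))" for x
    using \<phi>(1)[of 0] by (intro continuous_within_compose3[where g=h and f=\<phi>])
       (auto simp: continuous_on_eq_continuous_at)
  then show ?case by (simp add: continuous_on_eq_continuous_at)
next
  case (Suc k)
  obtain h' where h': "h' \<in> H" "\<forall>t\<in>S. (h has_real_derivative h' t) (at t)" using H[OF Suc.prems] by blast
  show ?case
  proof (rule Ck_SucI[where D="\<lambda>x d. h' (\<phi> x) * (grad \<phi> x \<bullet> d)"])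
    show "((\<lambda>x. h (\<phi> x)) has_derivative (\<lambda>d. h' (\<phi> x) * (grad \<phi> x \<bullet> d))) (at x)" for x
    proof -
      have "(h has_derivative (*) (h' (\<phi> x))) (at (\<phi> x))"
        using h'(2) \<phi>(2)[of x] by (simp add: has_field_derivative_def)
      from has_derivative_compose[OF Ck_Suc_has_derivative[OF \<phi>(1)] this]
      show ?thesis by simp
    qed
    show "Ck k (\<lambda>x. h' (\<phi> x) * (grad \<phi> x \<bullet> axis i 1))" for i
      by (intro Ck_mult Suc.IH h'(1) Ck_Suc_grad \<phi>(1))
  qed
qed

lemma Ck_powr:
  fixes \<phi> :: "real^'n::finite \<Rightarrow> real"
  assumes "\<And>k. Ck k \<phi>" "\<And>x. \<phi> x > 0"
  shows "Ck k (\<lambda>x. \<phi> x powr a)"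
proof (rule Ck_compose_family[where h="\<lambda>t. t powr a" and S="{0<..}" and H="{h. \<exists>c b. h = (\<lambda>t. c * t powr b)}"])
  fix h :: "real \<Rightarrow> real" assume "h \<in> {h. \<exists>c b. h = (\<lambda>t. c * t powr b)}"
  then obtain c b where h: "h = (\<lambda>t. c * t powr b)" by auto
  show "\<exists>h'\<in>{h. \<exists>c b. h = (\<lambda>t. c * t powr b)}. \<forall>t\<in>{0<..}. (h has_real_derivative h' t) (at t)"
    unfolding h
    by (rule bexI[where x="\<lambda>t. c * b * t powr (b - 1)"]) (auto intro!: derivative_eq_intros)
qed (use assms in \<open>auto intro!: exI[where x=1 and P="\<lambda>c. \<exists>b. (\<lambda>t. t powr a) = (\<lambda>t. c * t powr b)"]\<close>)

lemma Ck_exp: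
  fixes \<phi> :: "real^'n::finite \<Rightarrow> real"
  assumes "\<And>k. Ck k \<phi>"
  shows "Ck k (\<lambda>x. exp (\<phi> x))"
  by (rule Ck_compose_family[where h=exp and S=UNIV and H="{exp}"]) (auto intro!: assms derivative_eq_intros)

text \<open>For \<open>p = 1\<close> this is the standard flat function \<open>exp (-1/s)\<close>, extended by \<open>0\<close>. All its
  derivatives have the same shape with another polynomial \<open>p\<close>.\<close>

definition flat :: "real poly \<Rightarrow> real \<Rightarrow> real" where
  "flat p s = (if s > 0 then poly p (1/s) * exp (- (1/s)) else 0)"

lemma poly_exp_tendsto_0: "((\<lambda>z. poly p z * exp (- z)) \<longlongrightarrow> (0::real)) at_top"
proof (induction p)
  case (pCons a p)
  have "((\<lambda>z. poly q z * exp(-z)) \<longlongrightarrow> (0::real)) at_top" for q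
  proof -
    have "((\<lambda>z. \<Sum>i\<le>degree q. coeff q i * (z ^ i / exp z)) \<longlongrightarrow> (\<Sum>i\<le>degree q. coeff q i * 0)) at_top"
      by (intro tendsto_intros tendsto_power_div_exp_0)
    then show ?thesis
      by (simp add: poly_altdef sum_distrib_right exp_minus divide_inverse mult.assoc)
  qed
  then show ?case .
qed simp

lemma flat_has_derivative:
  "(flat p has_real_derivative flat (monom 1 2 * (p - pderiv p)) s) (at s)"
proof -
  consider "s > 0" | "s < 0" | "s = 0" by linarith
  then show ?thesis
  proof cases
    case 1
    have "((\<lambda>s. poly p (1/s) * exp (- (1/s))) has_real_derivative flat (monom 1 2 * (p - pderiv p)) s) (at s)"
      using 1 by (auto intro!: derivative_eq_intros simp: flat_def poly_monom field_simps power2_eq_square)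
    then show ?thesis
      by (rule has_field_derivative_transform_within_open[where S="{0<..}"])
         (use 1 in \<open>auto simp: flat_def\<close>)
  next
    case 2
    have "((\<lambda>s. 0) has_real_derivative flat (monom 1 2 * (p - pderiv p)) s) (at s)"
      using 2 by (simp add: flat_def)
    then show ?thesis
      by (rule has_field_derivative_transform_within_open[where S="{..<0}"])
         (use 2 in \<open>auto simp: flat_def\<close>)
  next
    case 3
    have "((\<lambda>h. poly (pCons 0 p) (1/h) * exp (- (1/h))) \<longlongrightarrow> 0) (at_right 0)"
      using filterlim_compose[OF poly_exp_tendsto_0 filterlim_inverse_at_top_right, of "pCons 0 p"]
      by (simp add: divide_inverse)
    then have "((\<lambda>h. flat p h / h) \<longlongrightarrow> 0) (at_right 0)"
      by (rule Lim_transform_eventually) (auto simp: flat_def eventually_at_right_less field_simps intro!: eventually_at_rightI[of 0 1])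
    moreover have "((\<lambda>h. flat p h / h) \<longlongrightarrow> 0) (at_left 0)"
      by (rule Lim_transform_eventually[OF tendsto_const])
         (auto simp: flat_def intro!: eventually_at_leftI[of "-1" 0])
    ultimately have "((\<lambda>h. flat p h / h) \<longlongrightarrow> 0) (at 0)"
      by (simp add: filterlim_split_at)
    then show ?thesis
      using 3 by (simp add: DERIV_def flat_def)
  qed
qed

lemma Ck_flat:
  fixes \<phi> :: "real^'n::finite \<Rightarrow> real"
  assumes "\<And>k. Ck k \<phi>"
  shows "Ck k (\<lambda>x. flat p (\<phi> x))"
  by (rule Ck_compose_family[where h="flat p" and S=UNIV and H="range flat"])
     (auto intro!: assms flat_has_derivative)

section \<open>Test functions\<close>

lemma test_functionsD:
  assumes "\<phi> \<in> test_functions \<Omega>"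
  shows "Ck k \<phi>" "compact (closure {x. \<phi> x \<noteq> 0})" "closure {x. \<phi> x \<noteq> 0} \<subseteq> \<Omega>"
  using assms by (auto simp: test_functions_def)

lemma test_functionsI:
  assumes "\<And>k. Ck k \<phi>" "compact K" "K \<subseteq> \<Omega>" "\<And>x. x \<notin> K \<Longrightarrow> \<phi> x = 0"
  shows "\<phi> \<in> test_functions \<Omega>"
proof -
  have "closure {x. \<phi> x \<noteq> 0} \<subseteq> K"
    using assms by (intro closure_minimal) (auto intro: compact_imp_closed)
  then have "compact (closure {x. \<phi> x \<noteq> 0})"
    using assms(2) by (metis bounded_subset closed_closure compact_eq_bounded_closed)
  with \<open>_ \<subseteq> K\<close> show ?thesis unfolding test_functions_def using assms by auto
qed

lemma test_functionsE:
  assumes "\<phi> \<in> test_functions \<Omega>"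
  obtains K where "compact K" "K \<subseteq> \<Omega>" "\<And>x. x \<notin> K \<Longrightarrow> \<phi> x = 0"
    "\<And>x. x \<notin> K \<Longrightarrow> grad \<phi> x = 0"
proof
  let ?K = "closure {x. \<phi> x \<noteq> 0}"
  show "compact ?K" "?K \<subseteq> \<Omega>" using test_functionsD[OF assms] by auto
  show 0: "\<phi> x = 0" if "x \<notin> ?K" for x
    using that closure_subset[of "{x. \<phi> x \<noteq> 0}"] by blast
  show "grad \<phi> x = 0" if "x \<notin> ?K" for x
  proof (rule grad_unique)
    show "(\<phi> has_derivative (\<lambda>h. 0 \<bullet> h)) (at x)"
    proof (rule has_derivative_transform_within_open[where s="- ?K" and f="\<lambda>x. 0"])
      show "0 = \<phi> y" if "y \<in> - ?K" for y using 0[of y] that by simp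
    qed (use that in auto)
  qed
qed

lemma test_functions_derivative:
  "\<phi> \<in> test_functions \<Omega> \<Longrightarrow> (\<phi> has_derivative (\<lambda>h. grad \<phi> x \<bullet> h)) (at x)"
  by (rule Ck_Suc_has_derivative[where k=0]) (rule test_functionsD)

lemma test_functions_continuous: "\<phi> \<in> test_functions \<Omega> \<Longrightarrow> continuous_on S \<phi>"
  using Ck_imp_continuous[OF test_functionsD(1)] continuous_on_subset by blast

lemma test_functions_continuous_grad:
  assumes "\<phi> \<in> test_functions \<Omega>"
  shows "continuous_on S (grad \<phi>)"
proof -
  have "continuous_on UNIV (\<lambda>x. grad \<phi> x $ i)" for i
    using test_functionsD(1)[OF assms, of "Suc 0"] by (simp add: grad_def)
  then have "continuous_on UNIV (grad \<phi>)"
    using continuous_on_vec_lambda[of UNIV "\<lambda>i x. grad \<phi> x $ i"] by simp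
  then show ?thesis using continuous_on_subset by blast
qed

lemma test_functions_0: "(\<lambda>x. 0) \<in> test_functions \<Omega>"
  by (rule test_functionsI[of _ "{}"]) (auto intro: Ck_const)

lemma test_functions_add:
  assumes "\<phi> \<in> test_functions \<Omega>" "\<psi> \<in> test_functions \<Omega>"
  shows "(\<lambda>x. \<phi> x + \<psi> x) \<in> test_functions \<Omega>" "grad (\<lambda>x. \<phi> x + \<psi> x) x = grad \<phi> x + grad \<psi> x"
proof -
  obtain K L where "compact K" "K \<subseteq> \<Omega>" "\<And>x. x \<notin> K \<Longrightarrow> \<phi> x = 0" "compact L" "L \<subseteq> \<Omega>" "\<And>x. x \<notin> L \<Longrightarrow> \<psi> x = 0"
    using assms by (metis test_functionsE)
  then show "(\<lambda>x. \<phi> x + \<psi> x) \<in> test_functions \<Omega>"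
    by (intro test_functionsI[of _ "K \<union> L"] compact_Un Ck_add test_functionsD(1)[OF assms(1)]
        test_functionsD(1)[OF assms(2)]) auto
  show "grad (\<lambda>x. \<phi> x + \<psi> x) x = grad \<phi> x + grad \<psi> x"
    by (rule grad_unique) (auto simp: inner_add_left intro!: has_derivative_add test_functions_derivative assms)
qed

lemma test_functions_mult:
  assumes "\<phi> \<in> test_functions \<Omega>" "\<psi> \<in> test_functions \<Omega>"
  shows "(\<lambda>x. \<phi> x * \<psi> x) \<in> test_functions \<Omega>"
    "grad (\<lambda>x. \<phi> x * \<psi> x) x = \<phi> x *\<^sub>R grad \<psi> x + \<psi> x *\<^sub>R grad \<phi> x"
proof -
  obtain K where "compact K" "K \<subseteq> \<Omega>" "\<And>x. x \<notin> K \<Longrightarrow> \<phi> x = 0"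
    using assms by (metis test_functionsE)
  then show "(\<lambda>x. \<phi> x * \<psi> x) \<in> test_functions \<Omega>"
    by (intro test_functionsI[of _ K] Ck_mult test_functionsD(1)[OF assms(1)] test_functionsD(1)[OF assms(2)]) auto
  have "((\<lambda>x. \<phi> x * \<psi> x) has_derivative (\<lambda>h. \<phi> x * (grad \<psi> x \<bullet> h) + (grad \<phi> x \<bullet> h) * \<psi> x)) (at x)"
    by (intro has_derivative_mult test_functions_derivative[OF assms(1)] test_functions_derivative[OF assms(2)])
  then show "grad (\<lambda>x. \<phi> x * \<psi> x) x = \<phi> x *\<^sub>R grad \<psi> x + \<psi> x *\<^sub>R grad \<phi> x"
    by (intro grad_unique) (simp add: inner_add_left algebra_simps)
qed

lemma test_functions_cmult:
  assumes "\<phi> \<in> test_functions \<Omega>"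
  shows "(\<lambda>x. c * \<phi> x) \<in> test_functions \<Omega>" "grad (\<lambda>x. c * \<phi> x) x = c *\<^sub>R grad \<phi> x"
proof -
  obtain K where "compact K" "K \<subseteq> \<Omega>" "\<And>x. x \<notin> K \<Longrightarrow> \<phi> x = 0"
    using assms by (metis test_functionsE)
  then show "(\<lambda>x. c * \<phi> x) \<in> test_functions \<Omega>"
    by (intro test_functionsI[of _ K] Ck_cmult test_functionsD(1)[OF assms]) auto
  show "grad (\<lambda>x. c * \<phi> x) x = c *\<^sub>R grad \<phi> x"
    by (rule grad_unique) (auto intro!: derivative_eq_intros test_functions_derivative assms)
qed

lemma test_functions_sum:
  "finite I \<Longrightarrow> (\<And>i. i \<in> I \<Longrightarrow> \<phi> i \<in> test_functions \<Omega>) \<Longrightarrow> (\<lambda>x. \<Sum>i\<in>I. \<phi> i x) \<in> test_functions \<Omega>"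
  by (induction I rule: finite_induct) (auto intro: test_functions_0 test_functions_add)

text \<open>Applied to multiples of a non-negative \<open>\<phi>\<close>, this gives bounded test functions that converge
  to the indicator function of the set where \<open>\<phi>\<close> is positive.\<close>

lemma test_functions_one_minus_exp:
  assumes "\<phi> \<in> test_functions \<Omega>"
  shows "(\<lambda>x. 1 - exp (- \<phi> x)) \<in> test_functions \<Omega>"
proof -
  obtain K where "compact K" "K \<subseteq> \<Omega>" "\<And>x. x \<notin> K \<Longrightarrow> \<phi> x = 0"
    using assms by (metis test_functionsE)
  moreover have "Ck k (\<lambda>x. 1 - exp (- \<phi> x))" for k
    using Ck_diff[OF Ck_const Ck_exp[OF Ck_cmult[OF test_functionsD(1)[OF assms], where c="-1"]]] by simp
  ultimately show ?thesis
    by (intro test_functionsI[of _ K]) auto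
qed

text \<open>As a function of \<open>\<phi>\<close>, \<open>\<psi>\<close> is smooth, vanishes at \<open>0\<close> and has slope at most \<open>1\<close>. This is how \<open>\<bar>u\<bar>\<close>
  is approximated by test functions without increasing the norm.\<close>

lemma test_functions_smooth_abs:
  fixes \<phi> :: "real^'n::finite \<Rightarrow> real"
  assumes "\<phi> \<in> test_functions \<Omega>" and e: "e > 0"
  defines "\<psi> \<equiv> \<lambda>x. sqrt ((\<phi> x)\<^sup>2 + e\<^sup>2) - e"
  shows "\<psi> \<in> test_functions \<Omega>" "norm (grad \<psi> x) \<le> norm (grad \<phi> x)" "\<bar>\<psi> x - \<bar>\<phi> x\<bar>\<bar> \<le> e"
proof -
  obtain K where K: "compact K" "K \<subseteq> \<Omega>" "\<And>x. x \<notin> K \<Longrightarrow> \<phi> x = 0"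
    using assms by (metis test_functionsE)
  have pos: "(\<phi> x)\<^sup>2 + e\<^sup>2 > 0" for x using e by (simp add: add_nonneg_pos)
  have Ck: "Ck k \<psi>" for k
  proof -
    have "Ck k (\<lambda>x. ((\<phi> x)\<^sup>2 + e\<^sup>2) powr (1/2) - e)"
      using test_functionsD(1)[OF assms(1)] pos
      by (intro Ck_diff Ck_const Ck_powr) (auto simp: power2_eq_square intro!: Ck_add Ck_mult Ck_const)
    then show ?thesis using pos by (simp add: \<psi>_def powr_half_sqrt less_imp_le)
  qed
  show "\<psi> \<in> test_functions \<Omega>"
    using Ck K e by (intro test_functionsI[of _ K]) (auto simp: \<psi>_def)
  have "(\<psi> has_derivative (\<lambda>h. (\<phi> x / sqrt ((\<phi> x)\<^sup>2 + e\<^sup>2)) *\<^sub>R grad \<phi> x \<bullet> h)) (at x)"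
    unfolding \<psi>_def using pos[of x]
    by (auto intro!: derivative_eq_intros test_functions_derivative[OF assms(1)] simp: field_simps)
  then have "grad \<psi> x = (\<phi> x / sqrt ((\<phi> x)\<^sup>2 + e\<^sup>2)) *\<^sub>R grad \<phi> x" by (rule grad_unique)
  moreover have le: "\<bar>\<phi> x\<bar> \<le> sqrt ((\<phi> x)\<^sup>2 + e\<^sup>2)" by (rule real_le_rsqrt) simp
  ultimately show "norm (grad \<psi> x) \<le> norm (grad \<phi> x)"
    using pos[of x] mult_right_mono[OF le norm_ge_zero[of "grad \<phi> x"]]
    by (simp add: pos_divide_le_eq mult.commute)
  have "sqrt ((\<phi> x)\<^sup>2 + e\<^sup>2) \<le> \<bar>\<phi> x\<bar> + e"
    using e by (intro real_le_lsqrt) (auto simp: power2_sum)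
  then show "\<bar>\<psi> x - \<bar>\<phi> x\<bar>\<bar> \<le> e" using le unfolding \<psi>_def by auto
qed

text \<open>The bump is \<open>exp (-1/w)\<close> with \<open>w = r\<^sup>2 - \<bar>x - c\<bar>\<^sup>2\<close>, which is positive exactly in the ball.\<close>

lemma bump_exists:
  fixes c :: "real^'n::finite"
  assumes "r > 0" "cball c r \<subseteq> \<Omega>"
  obtains \<phi> where "\<phi> \<in> test_functions \<Omega>" "\<And>x. \<phi> x \<ge> 0" "\<And>x. \<phi> x > 0 \<longleftrightarrow> x \<in> ball c r"
proof
  define w where "w = (\<lambda>x. r\<^sup>2 - (\<Sum>i\<in>UNIV. (x $ i - c $ i) * (x $ i - c $ i)))"
  have w: "w x = r\<^sup>2 - (dist c x)\<^sup>2" for x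
    by (simp add: w_def dist_norm norm_vec_def L2_set_def sum_nonneg power2_eq_square power2_commute)
       (simp add: algebra_simps)
  have w_pos: "w x > 0 \<longleftrightarrow> x \<in> ball c r" for x
    using assms(1) abs_le_square_iff[of r "dist c x"] by (auto simp: w not_le[symmetric])
  have Ckw: "Ck k w" for k unfolding w_def
    by (intro Ck_diff Ck_const Ck_sum Ck_mult Ck_component)
  show "(\<lambda>x. flat 1 (w x)) \<in> test_functions \<Omega>"
  proof (rule test_functionsI[of _ "cball c r"])
    show "flat 1 (w x) = 0" if "x \<notin> cball c r" for x
      using that w_pos[of x] by (auto simp: flat_def)
  qed (use Ck_flat Ckw assms in auto)
  show "flat 1 (w x) \<ge> 0" "flat 1 (w x) > 0 \<longleftrightarrow> x \<in> ball c r" for x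
    using w_pos[of x] by (auto simp: flat_def)
qed

section \<open>Differentiable functions with compact support\<close>

text \<open>The Cauchy--Schwarz inequality against an indicator function. If the function on the left is
  not integrable, its integral is \<open>0\<close> by convention and the bound is trivial.\<close>

lemma square_integral_le:
  fixes f :: "'a \<Rightarrow> real"
  assumes [measurable]: "f \<in> borel_measurable M" "A \<in> sets M"
  shows "ennreal ((LINT x|M. indicator A x * f x)\<^sup>2) \<le> emeasure M A * (\<integral>\<^sup>+x. indicator A x * ennreal ((f x)\<^sup>2) \<partial>M)"
proof (cases "integrable M (\<lambda>x. indicator A x * f x)")
  case True
  have "ennreal \<bar>LINT x|M. indicator A x * f x\<bar> \<le> (\<integral>\<^sup>+x. ennreal \<bar>indicator A x * f x\<bar> \<partial>M)"
    using integral_norm_bound_ennreal[OF True] by simp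
  also have "\<dots> = (\<integral>\<^sup>+x. (indicator A x * ennreal \<bar>f x\<bar>) * indicator A x \<partial>M)"
    by (intro nn_integral_cong) (auto split: split_indicator)
  finally have "(ennreal \<bar>LINT x|M. indicator A x * f x\<bar>)\<^sup>2 \<le> (\<integral>\<^sup>+x. (indicator A x * ennreal \<bar>f x\<bar>) * indicator A x \<partial>M)\<^sup>2"
    by (rule power_mono) simp
  also have "\<dots> \<le> (\<integral>\<^sup>+x. (indicator A x * ennreal \<bar>f x\<bar>)\<^sup>2 \<partial>M) * (\<integral>\<^sup>+x. (indicator A x)\<^sup>2 \<partial>M)"
    by (rule Cauchy_Schwarz_nn_integral) auto
  also have "(\<integral>\<^sup>+x. (indicator A x)\<^sup>2 \<partial>M) = emeasure M A"
  proof -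
    have "(\<integral>\<^sup>+x. (indicator A x)\<^sup>2 \<partial>M) = (\<integral>\<^sup>+x. indicator A x \<partial>M)"
      by (intro nn_integral_cong) (auto split: split_indicator)
    then show ?thesis by simp
  qed
  also have "(\<integral>\<^sup>+x. (indicator A x * ennreal \<bar>f x\<bar>)\<^sup>2 \<partial>M) = (\<integral>\<^sup>+x. indicator A x * ennreal ((f x)\<^sup>2) \<partial>M)"
    by (intro nn_integral_cong) (auto simp: ennreal_power split: split_indicator)
  finally show ?thesis by (simp add: ennreal_power mult.commute)
qed (simp add: not_integrable_integral_eq)

lemma nn_integral_affine:
  fixes f :: "'a::euclidean_space \<Rightarrow> ennreal"
  assumes [measurable]: "f \<in> borel_measurable borel" and c: "c > 0"
  shows "(\<integral>\<^sup>+y. f (x + c *\<^sub>R y) \<partial>lborel) = ennreal (1 / c ^ DIM('a)) * (\<integral>\<^sup>+y. f y \<partial>lborel)"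
proof -
  have "(\<integral>\<^sup>+y. f y \<partial>lborel) = ennreal (c ^ DIM('a)) * (\<integral>\<^sup>+y. f (x + c *\<^sub>R y) \<partial>lborel)"
    using c by (subst lborel_affine[of c x])
      (auto simp: nn_integral_density nn_integral_distr nn_integral_cmult)
  then have "ennreal (1 / c ^ DIM('a)) * (\<integral>\<^sup>+y. f y \<partial>lborel) =
    ennreal (1 / c ^ DIM('a) * c ^ DIM('a)) * (\<integral>\<^sup>+y. f (x + c *\<^sub>R y) \<partial>lborel)"
    using c by (simp only: ennreal_mult'' mult.assoc zero_le_power less_imp_le)
  then show ?thesis using c by simp
qed

lemma nn_integral_translate:
  fixes f :: "'a::euclidean_space \<Rightarrow> ennreal"
  assumes [measurable]: "f \<in> borel_measurable borel"
  shows "(\<integral>\<^sup>+y. f (y + x) \<partial>lborel) = (\<integral>\<^sup>+y. f y \<partial>lborel)"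
  using nn_integral_affine[OF assms, of 1 x] by (simp add: add.commute)

lemma measurable_cball [measurable]: "cball (c::'a::metric_space) r \<in> sets borel"
  by simp

abbreviation unit_vol :: "'a::euclidean_space itself \<Rightarrow> real" where
  "unit_vol _ \<equiv> measure lborel (cball (0::'a) 1)"

text \<open>Test functions enter the estimates below only through this interface; \<open>R\<close> is a radius that can
  be shared by a whole sequence.\<close>

locale C1_compact_support =
  fixes \<phi> :: "'a::euclidean_space \<Rightarrow> real" and g :: "'a \<Rightarrow> 'a" and R :: real
  assumes deriv: "(\<phi> has_derivative (\<lambda>h. g x \<bullet> h)) (at x)"
    and cont_g: "continuous_on UNIV g"
    and supp: "norm x > R \<Longrightarrow> \<phi> x = 0" "norm x > R \<Longrightarrow> g x = 0"
begin

lemma cont_phi: "continuous_on UNIV \<phi>"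
  using has_derivative_continuous[OF deriv] by (simp add: continuous_on_eq_continuous_at)

lemma measurable_phi [measurable]: "\<phi> \<in> borel_measurable borel"
  by (rule borel_measurable_continuous_onI[OF cont_phi])

lemma measurable_g [measurable]: "g \<in> borel_measurable borel"
  by (rule borel_measurable_continuous_onI[OF cont_g])

lemma integrable_compact_support:
  fixes u :: "'a \<Rightarrow> 'b::{banach, second_countable_topology}"
  assumes "continuous_on UNIV u" "\<And>x. norm x > R \<Longrightarrow> u x = 0"
  shows "integrable lborel u"
proof -
  have "integrable lborel (\<lambda>x. indicator (cball 0 R) x *\<^sub>R u x)"
    by (rule borel_integrable_compact) (auto intro: continuous_on_subset[OF assms(1)])
  also have "(\<lambda>x. indicator (cball 0 R) x *\<^sub>R u x) = u"
    using assms(2) by (auto simp: fun_eq_iff not_le split: split_indicator)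
  finally show ?thesis .
qed

definition energy :: real where "energy = (LINT x|lborel. (norm (g x))\<^sup>2)"

lemma energy_nonneg: "energy \<ge> 0"
  unfolding energy_def by simp

lemma integrable_g: "integrable lborel (\<lambda>x. (norm (g x))\<^sup>2)"
  using cont_g supp(2) by (intro integrable_compact_support continuous_intros) auto

lemma nn_energy: "(\<integral>\<^sup>+x. ennreal ((norm (g x))\<^sup>2) \<partial>lborel) = ennreal energy"
  unfolding energy_def by (rule nn_integral_eq_integral[OF integrable_g]) auto

text \<open>The fundamental theorem of calculus along the segment from \<open>x\<close> to \<open>y\<close>, followed by the
  Cauchy--Schwarz inequality on the unit interval.\<close>

lemma difference_square_le:
  "ennreal ((\<phi> y - \<phi> x)\<^sup>2) \<le> ennreal ((norm (y - x))\<^sup>2) *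
     (\<integral>\<^sup>+s. indicator {0..1} s * ennreal ((norm (g (x + s *\<^sub>R (y - x))))\<^sup>2) \<partial>lborel)"
proof -
  define a where "a s = g (x + s *\<^sub>R (y - x)) \<bullet> (y - x)" for s :: real
  have a_meas [measurable]: "a \<in> borel_measurable borel" unfolding a_def by measurable
  have d: "((\<lambda>s. \<phi> (x + s *\<^sub>R (y - x))) has_real_derivative a s) (at s)" for s
  proof -
    have "((\<lambda>s. x + s *\<^sub>R (y - x)) has_derivative (\<lambda>h. h *\<^sub>R (y - x))) (at s)"
      by (auto intro!: derivative_eq_intros)
    from has_derivative_compose[OF this deriv]
    show ?thesis unfolding has_field_derivative_def
      by (rule has_derivative_eq_rhs) (simp add: fun_eq_iff a_def)
  qed
  have "continuous_on UNIV a"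
    unfolding a_def by (intro continuous_intros continuous_on_compose2[OF cont_g]) auto
  then have "isCont a s" for s by (simp add: continuous_on_eq_continuous_at)
  then have "(LINT s|lborel. a s * indicator {0..1} s) = \<phi> y - \<phi> x"
    using d by (subst integral_FTC_Icc_real[where F="\<lambda>s. \<phi> (x + s *\<^sub>R (y - x))"]) auto
  then have "ennreal ((\<phi> y - \<phi> x)\<^sup>2) \<le> emeasure lborel {0..1::real} * (\<integral>\<^sup>+s. indicator {0..1} s * ennreal ((a s)\<^sup>2) \<partial>lborel)"
    using square_integral_le[of a lborel "{0..1}"] by (simp add: mult.commute)
  also have "\<dots> \<le> (\<integral>\<^sup>+s. ennreal ((norm (y - x))\<^sup>2) * (indicator {0..1} s * ennreal ((norm (g (x + s *\<^sub>R (y - x))))\<^sup>2)) \<partial>lborel)"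
  proof -
    have "(a s)\<^sup>2 \<le> (norm (y - x))\<^sup>2 * (norm (g (x + s *\<^sub>R (y - x))))\<^sup>2" for s
      unfolding a_def using Cauchy_Schwarz_ineq by (metis mult.commute power2_norm_eq_inner)
    then show ?thesis
      by (auto intro!: nn_integral_mono ennreal_leI simp: ennreal_mult[symmetric] split: split_indicator)
  qed
  also have "\<dots> = ennreal ((norm (y - x))\<^sup>2) *
     (\<integral>\<^sup>+s. indicator {0..1} s * ennreal ((norm (g (x + s *\<^sub>R (y - x))))\<^sup>2) \<partial>lborel)"
    by (rule nn_integral_cmult) measurable
  finally show ?thesis .
qed

text \<open>Integrate \<open>difference_square_le\<close> in \<open>x\<close>; by Tonelli and translation invariance every point of
  the segment contributes the same energy.\<close>

lemma translation_estimate: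
  "(\<integral>\<^sup>+x. ennreal ((\<phi> (x + h) - \<phi> x)\<^sup>2) \<partial>lborel) \<le> ennreal ((norm h)\<^sup>2 * energy)"
proof -
  have "(\<integral>\<^sup>+x. ennreal ((\<phi> (x + h) - \<phi> x)\<^sup>2) \<partial>lborel)
     \<le> (\<integral>\<^sup>+x. ennreal ((norm h)\<^sup>2) * (\<integral>\<^sup>+s. indicator {0..1::real} s * ennreal ((norm (g (x + s *\<^sub>R h)))\<^sup>2) \<partial>lborel) \<partial>lborel)"
  proof (intro nn_integral_mono)
    fix x show "ennreal ((\<phi> (x + h) - \<phi> x)\<^sup>2) \<le> ennreal ((norm h)\<^sup>2) * (\<integral>\<^sup>+s. indicator {0..1::real} s * ennreal ((norm (g (x + s *\<^sub>R h)))\<^sup>2) \<partial>lborel)"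
      using difference_square_le[of "x + h" x] by simp
  qed
  also have "\<dots> = ennreal ((norm h)\<^sup>2) * (\<integral>\<^sup>+x. (\<integral>\<^sup>+s. indicator {0..1::real} s * ennreal ((norm (g (x + s *\<^sub>R h)))\<^sup>2) \<partial>lborel) \<partial>lborel)"
    by (intro nn_integral_cmult) measurable
  also have "(\<integral>\<^sup>+x. (\<integral>\<^sup>+s. indicator {0..1::real} s * ennreal ((norm (g (x + s *\<^sub>R h)))\<^sup>2) \<partial>lborel) \<partial>lborel)
    = (\<integral>\<^sup>+s. (\<integral>\<^sup>+x. indicator {0..1::real} s * ennreal ((norm (g (x + s *\<^sub>R h)))\<^sup>2) \<partial>lborel) \<partial>lborel)"
    by (rule lborel_pair.Fubini') measurable
  also have "\<dots> = (\<integral>\<^sup>+s. indicator {0..1::real} s * (\<integral>\<^sup>+x. ennreal ((norm (g (x + s *\<^sub>R h)))\<^sup>2) \<partial>lborel) \<partial>lborel)"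
    by (intro nn_integral_cong nn_integral_cmult) measurable
  also have "\<dots> = (\<integral>\<^sup>+s. indicator {0..1::real} s * ennreal energy \<partial>lborel)"
    by (subst nn_integral_translate) (auto simp: nn_energy)
  also have "\<dots> = ennreal energy"
    by (simp add: nn_integral_multc)
  finally show ?thesis by (simp add: ennreal_mult energy_nonneg)
qed

text \<open>If \<open>h\<close> is longer than the diameter of the support, then \<open>\<phi>\<close> and its translate by \<open>h\<close> are nowhere
  both nonzero, so that their difference dominates \<open>\<phi>\<close>.\<close>

lemma poincare:
  assumes "R \<ge> 0"
  shows "(\<integral>\<^sup>+x. ennreal ((\<phi> x)\<^sup>2) \<partial>lborel) \<le> ennreal ((2 * R + 1)\<^sup>2 * energy)"
proof -
  obtain e :: 'a where e: "norm e = 1" using vector_choose_size[of 1] by auto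
  define h where "h = (2 * R + 1) *\<^sub>R e"
  have nh: "norm h = 2 * R + 1" using e assms by (simp add: h_def)
  have "(\<phi> x)\<^sup>2 \<le> (\<phi> (x + h) - \<phi> x)\<^sup>2" for x
  proof (cases "\<phi> x = 0")
    case False
    then have "norm x \<le> R" using supp(1)[of x] by force
    then have "norm (x + h) > R"
      using norm_triangle_ineq2[of h "-x"] nh by (simp add: add.commute)
    then show ?thesis using supp(1) by simp
  qed auto
  then have "(\<integral>\<^sup>+x. ennreal ((\<phi> x)\<^sup>2) \<partial>lborel) \<le> (\<integral>\<^sup>+x. ennreal ((\<phi> (x + h) - \<phi> x)\<^sup>2) \<partial>lborel)"
    by (intro nn_integral_mono ennreal_leI)
  also have "\<dots> \<le> ennreal ((2 * R + 1)\<^sup>2 * energy)"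
    using translation_estimate[of h] nh by simp
  finally show ?thesis .
qed

text \<open>The difference quotients of \<open>\<phi>\<close> in direction \<open>h\<close> have integral \<open>0\<close> by translation invariance;
  they converge to \<open>g \<bullet> h\<close> and are dominated because \<open>\<phi>\<close> is Lipschitz with compact support.\<close>

lemma integral_gradient_zero: "(LINT x|lborel. g x \<bullet> h) = 0"
proof -
  obtain K where K: "\<And>x. norm (g x) \<le> K"
  proof -
    have "compact (g ` cball 0 R)"
      by (rule compact_continuous_image[OF continuous_on_subset[OF cont_g]]) auto
    then obtain K where K: "\<forall>x\<in>g ` cball 0 R. norm x \<le> K" "K > 0"
      by (auto dest!: compact_imp_bounded simp: bounded_pos)
    then have "norm (g x) \<le> K" for x using supp(2)[of x] by (cases "norm x \<le> R") auto
    then show ?thesis using that by blast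
  qed
  have lip: "norm (\<phi> y - \<phi> x) \<le> K * norm (y - x)" for x y
  proof (rule differentiable_bound[of UNIV])
    show "onorm (\<lambda>h. g x \<bullet> h) \<le> K" for x
    proof (rule onorm_le)
      show "norm (g x \<bullet> h) \<le> K * norm h" for h
        using Cauchy_Schwarz_ineq2[of "g x" h] mult_right_mono[OF K[of x] norm_ge_zero[of h]] by simp
    qed
  qed (use deriv in auto)
  define q where "q n x = real (Suc n) * (\<phi> (x + (1 / real (Suc n)) *\<^sub>R h) - \<phi> x)" for n x
  have int_phi: "integrable lborel \<phi>" by (rule integrable_compact_support[OF cont_phi supp(1)])
  have "(LINT x|lborel. q n x) = 0" for n
  proof -
    let ?T = "\<lambda>x. x + (1 / real (Suc n)) *\<^sub>R h"
    have "?T = (+) ((1 / real (Suc n)) *\<^sub>R h)" by (simp add: fun_eq_iff add.commute)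
    then have D: "distr lborel borel ?T = lborel" by (simp only: lborel_distr_plus)
    have T: "?T \<in> lborel \<rightarrow>\<^sub>M borel" by simp
    have "integrable lborel (\<lambda>x. \<phi> (?T x))"
      using int_phi integrable_distr_eq[OF T measurable_phi] unfolding D by blast
    moreover have "(LINT x|lborel. \<phi> (?T x)) = (LINT x|lborel. \<phi> x)"
      using integral_distr[OF T measurable_phi] unfolding D by simp
    ultimately show ?thesis unfolding q_def using int_phi by simp
  qed
  moreover have "(\<lambda>n. LINT x|lborel. q n x) \<longlonglongrightarrow> (LINT x|lborel. g x \<bullet> h)"
  proof (rule integral_dominated_convergence[where w="\<lambda>x. indicator (cball 0 (R + norm h)) x *\<^sub>R (K * norm h)"])
    show "integrable lborel (\<lambda>x. indicator (cball 0 (R + norm h)) x *\<^sub>R (K * norm h))"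
      by (rule borel_integrable_compact) auto
    show "AE x in lborel. norm (q n x) \<le> indicator (cball 0 (R + norm h)) x *\<^sub>R (K * norm h)" for n
    proof (intro AE_I2)
      fix x
      show "norm (q n x) \<le> indicator (cball 0 (R + norm h)) x *\<^sub>R (K * norm h)"
      proof (cases "norm x \<le> R + norm h")
        case True
        have "norm (q n x) = real (Suc n) * norm (\<phi> (x + (1 / real (Suc n)) *\<^sub>R h) - \<phi> x)"
          by (simp add: q_def abs_mult)
        also have "\<dots> \<le> real (Suc n) * (K * norm ((1 / real (Suc n)) *\<^sub>R h))"
          using lip[of "x + (1 / real (Suc n)) *\<^sub>R h" x] by (intro mult_left_mono) auto
        also have "\<dots> = K * norm h" by simp
        finally show ?thesis using True by simp
      next
        case False
        then have "norm x > R" using norm_ge_zero[of h] by linarith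
        moreover have "norm (x + (1 / real (Suc n)) *\<^sub>R h) > R"
        proof -
          have "norm ((1 / real (Suc n)) *\<^sub>R h) \<le> norm h" by (simp add: divide_le_eq mult_le_cancel_left1)
          then show ?thesis using False norm_diff_ineq[of x "(1 / real (Suc n)) *\<^sub>R h"] by linarith
        qed
        ultimately show ?thesis using supp(1) False by (simp add: q_def)
      qed
    qed
    show "AE x in lborel. (\<lambda>n. q n x) \<longlonglongrightarrow> g x \<bullet> h"
    proof (intro AE_I2)
      fix x
      have "((\<lambda>s. x + s *\<^sub>R h) has_derivative (\<lambda>s. s *\<^sub>R h)) (at 0)"
        by (auto intro!: derivative_eq_intros)
      moreover have "(\<phi> has_derivative (\<lambda>h. g x \<bullet> h)) (at (x + 0 *\<^sub>R h))" using deriv by simp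
      ultimately have "((\<lambda>s. \<phi> (x + s *\<^sub>R h)) has_derivative (\<lambda>s. g x \<bullet> (s *\<^sub>R h))) (at 0)"
        by (rule has_derivative_compose)
      then have "((\<lambda>s. \<phi> (x + s *\<^sub>R h)) has_real_derivative (g x \<bullet> h)) (at 0)"
        unfolding has_field_derivative_def by (rule has_derivative_eq_rhs) (simp add: fun_eq_iff)
      then have "((\<lambda>s. (\<phi> (x + s *\<^sub>R h) - \<phi> x) / s) \<longlongrightarrow> g x \<bullet> h) (at 0)"
        by (simp add: DERIV_def)
      moreover have "filterlim (\<lambda>n. 1 / real (Suc n)) (at 0) sequentially"
        using LIMSEQ_Suc[OF lim_1_over_n] by (auto simp: filterlim_at)
      ultimately have "(\<lambda>n. (\<phi> (x + (1 / real (Suc n)) *\<^sub>R h) - \<phi> x) / (1 / real (Suc n))) \<longlonglongrightarrow> g x \<bullet> h"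
        by (rule filterlim_compose)
      then show "(\<lambda>n. q n x) \<longlonglongrightarrow> g x \<bullet> h" by (simp add: q_def mult.commute)
    qed
  qed (auto simp: q_def)
  ultimately have "(\<lambda>n. 0::real) \<longlonglongrightarrow> (LINT x|lborel. g x \<bullet> h)" by simp
  then show ?thesis by (simp add: LIMSEQ_const_iff)
qed

subsection \<open>Averages over balls\<close>

text \<open>The mean value of \<open>\<phi>\<close> over the ball of radius \<open>t\<close> about \<open>x\<close>, multiplied by the volume of the unit
  ball.\<close>

definition avg :: "real \<Rightarrow> 'a \<Rightarrow> real" where
  "avg t x = (LINT y|lborel. indicator (cball 0 1) y * \<phi> (x + t *\<^sub>R y))"

lemma unit_vol_pos: "unit_vol TYPE('a) > 0" by (rule content_cball_pos) simp

lemma emeasure_unit_ball: "emeasure lborel (cball 0 1 :: 'a set) = ennreal (unit_vol TYPE('a))"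
  by (rule emeasure_eq_ennreal_measure) (use emeasure_lborel_cball_finite[of "0::'a" 1] in auto)



lemma integrable_avg: "integrable lborel (\<lambda>y. indicator (cball 0 1) y * \<phi> (x + t *\<^sub>R y))"
proof -
  have "continuous_on (cball 0 1) (\<lambda>y. \<phi> (x + t *\<^sub>R y))"
    by (intro continuous_on_compose2[OF cont_phi] continuous_intros) auto
  from borel_integrable_compact[OF compact_cball this] show ?thesis by simp
qed

text \<open>The points \<open>x + t y\<close> and \<open>x + 2 t y\<close> are at distance at most \<open>t\<close>, which contributes \<open>t\<^sup>2\<close>; the change
  of variables \<open>y \<mapsto> x + t (1 + s) y\<close> contributes at most \<open>t\<^bsup>-3\<^esup>\<close>. The exponent \<open>-1\<close> that results is
  where the dimension enters, and it leads to the critical exponent \<open>6\<close>.\<close>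

lemma avg_dyadic_step:
  assumes t: "t > 0" and dim: "DIM('a) = 3"
  shows "(avg t x - avg (2 * t) x)\<^sup>2 \<le> unit_vol TYPE('a) / t * energy"
proof -
  let ?B = "cball 0 1 :: 'a set"
  have "avg t x - avg (2 * t) x = (LINT y|lborel. indicator ?B y * (\<phi> (x + t *\<^sub>R y) - \<phi> (x + (2 * t) *\<^sub>R y)))"
    unfolding avg_def by (subst Bochner_Integration.integral_diff[symmetric, OF integrable_avg integrable_avg]) (simp add: algebra_simps)
  then have "ennreal ((avg t x - avg (2 * t) x)\<^sup>2) \<le> ennreal (unit_vol TYPE('a)) *
     (\<integral>\<^sup>+y. indicator ?B y * ennreal ((\<phi> (x + t *\<^sub>R y) - \<phi> (x + (2 * t) *\<^sub>R y))\<^sup>2) \<partial>lborel)"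
    using square_integral_le[of "\<lambda>y. \<phi> (x + t *\<^sub>R y) - \<phi> (x + (2 * t) *\<^sub>R y)" lborel ?B] by (simp add: emeasure_unit_ball)
  also have "(\<integral>\<^sup>+y. indicator ?B y * ennreal ((\<phi> (x + t *\<^sub>R y) - \<phi> (x + (2 * t) *\<^sub>R y))\<^sup>2) \<partial>lborel)
    \<le> (\<integral>\<^sup>+y. ennreal (t\<^sup>2) * (\<integral>\<^sup>+s. indicator {0..1::real} s * ennreal ((norm (g (x + (t * (1 + s)) *\<^sub>R y)))\<^sup>2) \<partial>lborel) \<partial>lborel)"
  proof (intro nn_integral_mono)
    fix y :: 'a
    show "indicator ?B y * ennreal ((\<phi> (x + t *\<^sub>R y) - \<phi> (x + (2 * t) *\<^sub>R y))\<^sup>2)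
      \<le> ennreal (t\<^sup>2) * (\<integral>\<^sup>+s. indicator {0..1::real} s * ennreal ((norm (g (x + (t * (1 + s)) *\<^sub>R y)))\<^sup>2) \<partial>lborel)"
    proof (cases "y \<in> ?B")
      case True
      have d: "x + (2 * t) *\<^sub>R y - (x + t *\<^sub>R y) = t *\<^sub>R y"
        by (simp add: algebra_simps scaleR_2 flip: scaleR_scaleR)
      have e: "x + t *\<^sub>R y + s *\<^sub>R t *\<^sub>R y = x + (t * (1 + s)) *\<^sub>R y" for s
        by (simp add: algebra_simps)
      have "(norm (t *\<^sub>R y))\<^sup>2 \<le> t\<^sup>2"
        using True t by (simp add: power_mult_distrib power_le_one mult_left_le)
      then show ?thesis
        using True order_trans[OF difference_square_le[of "x + (2 * t) *\<^sub>R y" "x + t *\<^sub>R y", unfolded d e]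
            mult_right_mono[OF ennreal_leI]]
        by (simp add: power2_commute[of "\<phi> (x + t *\<^sub>R y)"])
    qed simp
  qed
  also have "\<dots> = ennreal (t\<^sup>2) * (\<integral>\<^sup>+y. (\<integral>\<^sup>+s. indicator {0..1::real} s * ennreal ((norm (g (x + (t * (1 + s)) *\<^sub>R y)))\<^sup>2) \<partial>lborel) \<partial>lborel)"
    by (intro nn_integral_cmult) measurable
  also have "(\<integral>\<^sup>+y. (\<integral>\<^sup>+s. indicator {0..1::real} s * ennreal ((norm (g (x + (t * (1 + s)) *\<^sub>R y)))\<^sup>2) \<partial>lborel) \<partial>lborel)
     = (\<integral>\<^sup>+s. (\<integral>\<^sup>+y. indicator {0..1::real} s * ennreal ((norm (g (x + (t * (1 + s)) *\<^sub>R y)))\<^sup>2) \<partial>lborel) \<partial>lborel)"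
    by (rule lborel_pair.Fubini') measurable
  also have "\<dots> \<le> (\<integral>\<^sup>+s. indicator {0..1::real} s * ennreal (1 / t ^ 3 * energy) \<partial>lborel)"
  proof (intro nn_integral_mono)
    fix s :: real
    have "(\<integral>\<^sup>+y. ennreal ((norm (g (x + (t * (1 + s)) *\<^sub>R y)))\<^sup>2) \<partial>lborel) \<le> ennreal (1 / t ^ 3 * energy)" if "0 \<le> s"
    proof -
      have "(\<integral>\<^sup>+y. ennreal ((norm (g (x + (t * (1 + s)) *\<^sub>R y)))\<^sup>2) \<partial>lborel) = ennreal (1 / (t * (1 + s)) ^ 3 * energy)"
        using nn_integral_affine[of "\<lambda>z. ennreal ((norm (g z))\<^sup>2)" "t * (1 + s)" x] t that
        by (simp add: nn_energy dim energy_nonneg flip: ennreal_mult)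
      also have "\<dots> \<le> ennreal (1 / t ^ 3 * energy)"
        using t that by (intro ennreal_leI mult_right_mono energy_nonneg divide_left_mono power_mono) auto
      finally show ?thesis .
    qed
    then show "(\<integral>\<^sup>+y. indicator {0..1::real} s * ennreal ((norm (g (x + (t * (1 + s)) *\<^sub>R y)))\<^sup>2) \<partial>lborel)
       \<le> indicator {0..1::real} s * ennreal (1 / t ^ 3 * energy)"
      by (auto split: split_indicator)
  qed
  also have "\<dots> = ennreal (1 / t ^ 3 * energy)" by (simp add: nn_integral_multc)
  finally have "ennreal ((avg t x - avg (2 * t) x)\<^sup>2) \<le> ennreal (unit_vol TYPE('a)) * (ennreal (t\<^sup>2) * ennreal (1 / t ^ 3 * energy))"
    by (meson mult_left_mono zero_le order_trans)
  also have "\<dots> = ennreal (unit_vol TYPE('a) / t * energy)"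
    using t energy_nonneg by (simp add: power2_eq_square power3_eq_cube field_simps flip: ennreal_mult)
  finally show ?thesis
    using t energy_nonneg unit_vol_pos by (simp add: ennreal_le_iff)
qed

lemma avg_tendsto_0: "((\<lambda>t. avg t x) \<longlongrightarrow> 0) at_top"
proof -
  have int: "integrable lborel \<phi>" by (rule integrable_compact_support[OF cont_phi supp(1)])
  define I where "I = (LINT y|lborel. \<bar>\<phi> y\<bar>)"
  have "\<bar>avg t x\<bar> \<le> I / t ^ DIM('a)" if t: "t > 0" for t
  proof -
    have "ennreal \<bar>avg t x\<bar> \<le> (\<integral>\<^sup>+y. ennreal \<bar>indicator (cball 0 1) y * \<phi> (x + t *\<^sub>R y)\<bar> \<partial>lborel)"
      unfolding avg_def using integral_norm_bound_ennreal[OF integrable_avg] by simp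
    also have "\<dots> \<le> (\<integral>\<^sup>+y. ennreal \<bar>\<phi> (x + t *\<^sub>R y)\<bar> \<partial>lborel)"
      by (intro nn_integral_mono ennreal_leI) (auto split: split_indicator)
    also have "\<dots> = ennreal (1 / t ^ DIM('a)) * (\<integral>\<^sup>+y. ennreal \<bar>\<phi> y\<bar> \<partial>lborel)"
      by (rule nn_integral_affine[OF _ t]) measurable
    also have "(\<integral>\<^sup>+y. ennreal \<bar>\<phi> y\<bar> \<partial>lborel) = ennreal I"
      unfolding I_def using int by (intro nn_integral_eq_integral) auto
    finally show ?thesis
      using t by (simp add: I_def flip: ennreal_mult)
  qed
  then have "\<forall>\<^sub>F t in at_top. norm (avg t x) \<le> I / t ^ DIM('a)"
    by (intro eventually_mono[OF eventually_gt_at_top[of 0]]) auto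
  moreover have "((\<lambda>t. I / t ^ DIM('a)) \<longlongrightarrow> 0) at_top"
    by (intro tendsto_divide_0[OF tendsto_const] filterlim_at_top_imp_at_infinity filterlim_pow_at_top filterlim_ident) auto
  ultimately show ?thesis by (rule Lim_null_comparison)
qed

text \<open>The averages vanish as the radius tends to infinity, so the average at \<open>t\<close> is the sum of the
  steps between the radii \<open>t, 2 t, 4 t, \<dots>\<close>. These form a geometric series with ratio \<open>1 / sqrt 2\<close>,
  which is bounded by \<open>3/4\<close> to get the constant \<open>4\<close>.\<close>

lemma abs_avg_le:
  assumes t: "t > 0" and dim: "DIM('a) = 3"
  shows "\<bar>avg t x\<bar> \<le> 4 * sqrt (unit_vol TYPE('a) * energy / t)"
proof -
  define q :: real where "q = 3/4"
  have "4 / 3 \<le> sqrt 2" by (rule real_le_rsqrt) (simp add: power2_eq_square)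
  then have q2: "1 / sqrt 2 \<le> q" by (simp add: q_def field_simps)
  have step: "\<bar>avg (2 ^ k * t) x - avg (2 ^ Suc k * t) x\<bar> \<le> q ^ k * sqrt (unit_vol TYPE('a) * energy / t)" for k
  proof -
    have "\<bar>avg (2 ^ k * t) x - avg (2 ^ Suc k * t) x\<bar> \<le> sqrt (unit_vol TYPE('a) / (2 ^ k * t) * energy)"
      using avg_dyadic_step[of "2 ^ k * t" x] t dim by (intro real_le_rsqrt) (simp add: mult.assoc)
    also have "\<dots> = (1 / sqrt 2) ^ k * sqrt (unit_vol TYPE('a) * energy / t)"
      using t by (simp add: real_sqrt_divide real_sqrt_mult real_sqrt_power power_divide)
    also have "\<dots> \<le> q ^ k * sqrt (unit_vol TYPE('a) * energy / t)"
      using q2 t energy_nonneg unit_vol_pos by (intro mult_right_mono power_mono) auto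
    finally show ?thesis .
  qed
  have tel: "\<bar>avg t x\<bar> \<le> \<bar>avg (2 ^ n * t) x\<bar> + (\<Sum>k<n. q ^ k) * sqrt (unit_vol TYPE('a) * energy / t)" for n
  proof (induction n)
    case (Suc n)
    then show ?case using step[of n] by (simp add: distrib_right)
  qed simp
  have geo: "(\<Sum>k<n. q ^ k) \<le> 4" for n
  proof -
    have "(\<Sum>k<n. q ^ k) = (q ^ n - 1) / (q - 1)" by (rule geometric_sum) (simp add: q_def)
    moreover have "q - 1 = - (1 / 4)" "q ^ n \<ge> 0" by (simp_all add: q_def)
    ultimately show ?thesis by simp
  qed
  have "\<bar>avg t x\<bar> \<le> \<bar>avg (2 ^ n * t) x\<bar> + 4 * sqrt (unit_vol TYPE('a) * energy / t)" for n
    using tel[of n] mult_right_mono[OF geo[of n], of "sqrt (unit_vol TYPE('a) * energy / t)"] t energy_nonneg unit_vol_pos by simp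
  moreover have "(\<lambda>n. \<bar>avg (2 ^ n * t) x\<bar> + 4 * sqrt (unit_vol TYPE('a) * energy / t)) \<longlonglongrightarrow> 0 + 4 * sqrt (unit_vol TYPE('a) * energy / t)"
  proof (intro tendsto_add tendsto_const tendsto_rabs_zero filterlim_compose[OF avg_tendsto_0])
    show "filterlim (\<lambda>n. 2 ^ n * t) at_top sequentially"
      using t by (intro filterlim_at_top_mult_tendsto_pos[OF tendsto_const]
          filterlim_at_top_mono[OF filterlim_real_sequentially])
        (auto intro!: always_eventually less_imp_le of_nat_less_two_power)
  qed
  ultimately show ?thesis using LIMSEQ_le_const[of _ "0 + 4 * sqrt (unit_vol TYPE('a) * energy / t)"] by simp
qed

text \<open>For each \<open>y\<close> in the unit ball this is the translation estimate for the vector \<open>t y\<close>.\<close>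

lemma avg_error:
  assumes t: "t > 0"
  shows "(\<integral>\<^sup>+x. ennreal ((unit_vol TYPE('a) * \<phi> x - avg t x)\<^sup>2) \<partial>lborel) \<le> ennreal ((unit_vol TYPE('a))\<^sup>2 * t\<^sup>2 * energy)"
proof -
  let ?B = "cball 0 1 :: 'a set"
  have eq: "unit_vol TYPE('a) * \<phi> x - avg t x = (LINT y|lborel. indicator ?B y * (\<phi> x - \<phi> (x + t *\<^sub>R y)))" for x
  proof -
    have i: "integrable lborel (\<lambda>y. indicator ?B y * \<phi> x)"
      using borel_integrable_compact[OF compact_cball, of 0 1 "\<lambda>_. \<phi> x"] by simp
    have "unit_vol TYPE('a) * \<phi> x = (LINT y|lborel. indicator ?B y * \<phi> x)" by simp
    then show ?thesis unfolding avg_def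
      by (simp only: Bochner_Integration.integral_diff[symmetric, OF i integrable_avg] right_diff_distrib)
  qed
  have "(\<integral>\<^sup>+x. ennreal ((unit_vol TYPE('a) * \<phi> x - avg t x)\<^sup>2) \<partial>lborel)
     \<le> (\<integral>\<^sup>+x. ennreal (unit_vol TYPE('a)) * (\<integral>\<^sup>+y. indicator ?B y * ennreal ((\<phi> x - \<phi> (x + t *\<^sub>R y))\<^sup>2) \<partial>lborel) \<partial>lborel)"
    unfolding eq
    by (intro nn_integral_mono order_trans[OF square_integral_le]) (auto simp: emeasure_unit_ball)
  also have "\<dots> = ennreal (unit_vol TYPE('a)) * (\<integral>\<^sup>+x. (\<integral>\<^sup>+y. indicator ?B y * ennreal ((\<phi> x - \<phi> (x + t *\<^sub>R y))\<^sup>2) \<partial>lborel) \<partial>lborel)"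
    by (intro nn_integral_cmult) measurable
  also have "(\<integral>\<^sup>+x. (\<integral>\<^sup>+y. indicator ?B y * ennreal ((\<phi> x - \<phi> (x + t *\<^sub>R y))\<^sup>2) \<partial>lborel) \<partial>lborel)
     = (\<integral>\<^sup>+y. (\<integral>\<^sup>+x. indicator ?B y * ennreal ((\<phi> x - \<phi> (x + t *\<^sub>R y))\<^sup>2) \<partial>lborel) \<partial>lborel)"
    by (rule lborel_pair.Fubini') measurable
  also have "\<dots> \<le> (\<integral>\<^sup>+y. indicator ?B y * ennreal (t\<^sup>2 * energy) \<partial>lborel)"
  proof (intro nn_integral_mono)
    fix y :: 'a
    have "(\<integral>\<^sup>+x. ennreal ((\<phi> x - \<phi> (x + t *\<^sub>R y))\<^sup>2) \<partial>lborel) \<le> ennreal (t\<^sup>2 * energy)" if "norm y \<le> 1"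
    proof -
      have "(norm (t *\<^sub>R y))\<^sup>2 \<le> t\<^sup>2"
        using that t by (simp add: power_mult_distrib power_le_one mult_left_le)
      then have "ennreal ((norm (t *\<^sub>R y))\<^sup>2 * energy) \<le> ennreal (t\<^sup>2 * energy)"
        by (intro ennreal_leI mult_right_mono energy_nonneg)
      moreover have "(\<phi> x - \<phi> (x + t *\<^sub>R y))\<^sup>2 = (\<phi> (x + t *\<^sub>R y) - \<phi> x)\<^sup>2" for x
        by (rule power2_commute)
      ultimately show ?thesis using order_trans[OF translation_estimate[of "t *\<^sub>R y"]] by presburger
    qed
    then show "(\<integral>\<^sup>+x. indicator ?B y * ennreal ((\<phi> x - \<phi> (x + t *\<^sub>R y))\<^sup>2) \<partial>lborel) \<le> indicator ?B y * ennreal (t\<^sup>2 * energy)"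
      by (auto split: split_indicator)
  qed
  also have "\<dots> = ennreal (unit_vol TYPE('a)) * ennreal (t\<^sup>2 * energy)"
    by (simp add: nn_integral_multc emeasure_unit_ball)
  finally have "(\<integral>\<^sup>+x. ennreal ((unit_vol TYPE('a) * \<phi> x - avg t x)\<^sup>2) \<partial>lborel) \<le> ennreal (unit_vol TYPE('a)) * (ennreal (unit_vol TYPE('a)) * ennreal (t\<^sup>2 * energy))"
    by (meson mult_left_mono zero_le order_trans)
  also have "\<dots> = ennreal ((unit_vol TYPE('a))\<^sup>2 * t\<^sup>2 * energy)"
    using energy_nonneg t by (simp add: power2_eq_square mult.assoc flip: ennreal_mult)
  finally show ?thesis .
qed

text \<open>The difference of two averages is an average of differences over the same vector, to which the
  translation estimate applies. The constant depends on \<open>\<phi>\<close> through the energy alone.\<close>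

lemma avg_lipschitz:
  assumes t: "t > 0"
  shows "(avg t x - avg t x')\<^sup>2 \<le> unit_vol TYPE('a) / t ^ DIM('a) * (dist x x')\<^sup>2 * energy"
proof -
  let ?B = "cball 0 1 :: 'a set"
  have "avg t x - avg t x' = (LINT y|lborel. indicator ?B y * (\<phi> (x + t *\<^sub>R y) - \<phi> (x' + t *\<^sub>R y)))"
    unfolding avg_def by (subst Bochner_Integration.integral_diff[symmetric, OF integrable_avg integrable_avg]) (simp add: algebra_simps)
  then have "ennreal ((avg t x - avg t x')\<^sup>2) \<le> ennreal (unit_vol TYPE('a)) *
     (\<integral>\<^sup>+y. indicator ?B y * ennreal ((\<phi> (x + t *\<^sub>R y) - \<phi> (x' + t *\<^sub>R y))\<^sup>2) \<partial>lborel)"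
    using square_integral_le[of "\<lambda>y. \<phi> (x + t *\<^sub>R y) - \<phi> (x' + t *\<^sub>R y)" lborel ?B] by (simp add: emeasure_unit_ball)
  also have "\<dots> \<le> ennreal (unit_vol TYPE('a)) * (\<integral>\<^sup>+y. ennreal ((\<phi> ((x' + t *\<^sub>R y) + (x - x')) - \<phi> (x' + t *\<^sub>R y))\<^sup>2) \<partial>lborel)"
    by (intro mult_left_mono nn_integral_mono) (auto simp: algebra_simps split: split_indicator)
  also have "(\<integral>\<^sup>+y. ennreal ((\<phi> ((x' + t *\<^sub>R y) + (x - x')) - \<phi> (x' + t *\<^sub>R y))\<^sup>2) \<partial>lborel)
      = ennreal (1 / t ^ DIM('a)) * (\<integral>\<^sup>+y. ennreal ((\<phi> (y + (x - x')) - \<phi> y)\<^sup>2) \<partial>lborel)"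
    by (rule nn_integral_affine[OF _ t, where f="\<lambda>z. ennreal ((\<phi> (z + (x - x')) - \<phi> z)\<^sup>2)"]) measurable
  also have "ennreal (unit_vol TYPE('a)) * \<dots> \<le> ennreal (unit_vol TYPE('a)) * (ennreal (1 / t ^ DIM('a)) * ennreal ((norm (x - x'))\<^sup>2 * energy))"
    by (intro mult_left_mono translation_estimate) auto
  also have "\<dots> = ennreal (unit_vol TYPE('a) / t ^ DIM('a) * (dist x x')\<^sup>2 * energy)"
    using t energy_nonneg by (simp add: dist_norm mult.assoc flip: ennreal_mult)
  finally show ?thesis
    using t energy_nonneg unit_vol_pos by (subst (asm) ennreal_le_iff) auto
qed

lemma measurable_avg [measurable]: "avg t \<in> borel_measurable borel"
  unfolding avg_def by measurable

end

section \<open>Subcritical Sobolev inequality and Rellich compactness\<close>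

lemma square_add_le: "(x + y)\<^sup>2 \<le> 2 * x\<^sup>2 + 2 * (y::real)\<^sup>2"
  using sum_squares_bound[of x y] by (simp add: power2_sum)

context C1_compact_support begin

text \<open>If the radius \<open>t\<close> is so large that the mean values over balls are at most \<open>l/2\<close>, then they differ
  from \<open>\<phi>\<close> by at least \<open>l/2\<close> wherever \<open>\<bar>\<phi>\<bar> > l\<close>. By \<open>avg_error\<close> and Markov's inequality this happens
  on a set of measure at most a constant times \<open>t\<^sup>2 / l\<^sup>2\<close>, and \<open>t\<close> is of order \<open>l\<^bsup>-2\<^esup>\<close>.\<close>

lemma weak_sobolev:
  assumes dim: "DIM('a) = 3" and E: "energy \<le> 1" and l: "l > 0"
  shows "emeasure lborel {x. l < \<bar>\<phi> x\<bar>} \<le> ennreal (16384 / ((unit_vol TYPE('a))\<^sup>2 * l ^ 6))"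
proof -
  define V where "V = unit_vol TYPE('a)"
  have V: "V > 0" using unit_vol_pos by (simp add: V_def)
  \<comment> \<open>With this radius the bound \<open>4 sqrt (V / t)\<close> for the averages equals half of \<open>V l\<close>.\<close>
  define t where "t = 64 / (V * l\<^sup>2)"
  have t: "t > 0" using V l by (simp add: t_def)
  have avg_le: "\<bar>avg t x\<bar> \<le> V * l / 2" for x
  proof -
    have "V * energy / t \<le> V * 1 / t" using V E t by (intro divide_right_mono mult_left_mono) auto
    also have "\<dots> = (V * l / 8)\<^sup>2" using V l by (simp add: t_def power2_eq_square field_simps)
    finally have "sqrt (V * energy / t) \<le> V * l / 8" using V l by (intro real_le_lsqrt) auto
    then show ?thesis using abs_avg_le[OF t dim, of x] by (simp add: V_def)
  qed
  define c where "c = 4 / (V\<^sup>2 * l\<^sup>2)"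
  have c: "c > 0" using V l by (simp add: c_def)
  have "{x. l < \<bar>\<phi> x\<bar>} \<subseteq> {x\<in>space lborel. 1 \<le> ennreal c * ennreal ((V * \<phi> x - avg t x)\<^sup>2)}"
  proof safe
    fix x assume "l < \<bar>\<phi> x\<bar>"
    then have "V * l \<le> V * \<bar>\<phi> x\<bar>" using V by simp
    also have "\<dots> = \<bar>V * \<phi> x\<bar>" using V by (simp add: abs_mult)
    finally have "V * l / 2 \<le> \<bar>V * \<phi> x - avg t x\<bar>" using avg_le[of x] by linarith
    then have "(V * l / 2)\<^sup>2 \<le> \<bar>V * \<phi> x - avg t x\<bar>\<^sup>2" using V l by (intro power_mono) auto
    then have "1 \<le> c * (V * \<phi> x - avg t x)\<^sup>2"
      using V l by (simp add: c_def field_simps power2_eq_square)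
    then show "1 \<le> ennreal c * ennreal ((V * \<phi> x - avg t x)\<^sup>2)"
      using c by (simp flip: ennreal_mult)
  qed auto
  then have "emeasure lborel {x. l < \<bar>\<phi> x\<bar>} \<le> emeasure lborel {x\<in>space lborel. 1 \<le> ennreal c * ennreal ((V * \<phi> x - avg t x)\<^sup>2)}"
    by (intro emeasure_mono) measurable
  also have "\<dots> \<le> ennreal c * (\<integral>\<^sup>+x. ennreal ((V * \<phi> x - avg t x)\<^sup>2) * indicator (space lborel) x \<partial>lborel)"
    by (rule nn_integral_Markov_inequality) auto
  also have "\<dots> \<le> ennreal c * ennreal (V\<^sup>2 * t\<^sup>2 * energy)"
    using avg_error[OF t] by (intro mult_left_mono) (auto simp: V_def)
  also have "\<dots> = ennreal (c * (V\<^sup>2 * t\<^sup>2 * energy))"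
    using c energy_nonneg by (simp flip: ennreal_mult)
  also have "\<dots> \<le> ennreal (c * (V\<^sup>2 * t\<^sup>2 * 1))"
    using c E by (intro ennreal_leI mult_left_mono) auto
  also have "c * (V\<^sup>2 * t\<^sup>2 * 1) = 16384 / (V\<^sup>2 * l ^ 6)"
    using V l by (simp add: c_def t_def field_simps power2_eq_square eval_nat_numeral)
  finally show ?thesis by (simp add: V_def)
qed


end

text \<open>A dyadic layer-cake decomposition: the summand with \<open>2\<^sup>k < w \<le> 2\<^bsup>k+1\<^esup>\<close> alone bounds \<open>w\<^sup>q\<close>.\<close>

lemma powr_le_dyadic_sum:
  fixes w q :: real
  assumes "w \<ge> 0" "q > 0"
  shows "ennreal (w powr q) \<le> 1 + (\<Sum>k. ennreal (2 powr (real (Suc k) * q)) * indicator {s. 2 ^ k < s} w)"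
proof (cases "w \<le> 1")
  case True
  then have "w powr q \<le> 1" using assms powr_mono2[of q w 1] by simp
  then have "ennreal (w powr q) \<le> 1" by simp
  then show ?thesis by (rule order_trans) simp
next
  case False
  define n where "n = (LEAST n. w \<le> 2 ^ n)"
  obtain m where "w < 2 ^ m" using real_arch_pow[of 2 w] by auto
  then have n: "w \<le> 2 ^ n" unfolding n_def by (intro LeastI[of "\<lambda>n. w \<le> 2 ^ n" m]) (rule less_imp_le)
  then have "n \<noteq> 0" using False by (intro notI) simp
  then obtain k where k: "n = Suc k" using not0_implies_Suc by blast
  then have gt: "2 ^ k < w" using not_less_Least[of k "\<lambda>n. w \<le> 2 ^ n"] by (simp add: n_def)
  let ?f = "\<lambda>k. ennreal (2 powr (real (Suc k) * q)) * indicator {s. 2 ^ k < s} w"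
  have "w powr q \<le> (2 ^ n) powr q" using assms n by (intro powr_mono2) auto
  also have "\<dots> = 2 powr (real (Suc k) * q)" by (metis k powr_powr powr_realpow zero_less_numeral)
  finally have "ennreal (w powr q) \<le> ?f k" using gt by (simp add: ennreal_leI)
  also have "?f k = sum ?f {k}" by (simp only: sum.insert finite.emptyI empty_iff not_False_eq_True sum.empty add_0_right)
  also have "\<dots> \<le> (\<Sum>k. ?f k)" by (rule sum_le_suminf) auto
  finally show ?thesis by (rule order_trans) simp
qed

text \<open>On the set where \<open>\<bar>\<phi>\<bar> > 2\<^sup>k\<close>, of measure of order \<open>2\<^bsup>-6k\<^esup>\<close>, the dyadic summand is of order \<open>2\<^bsup>kq\<^esup>\<close>;
  the series converges since \<open>q < 6\<close>.\<close>

lemma sobolev_normalized: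
  fixes q :: real
  assumes dim: "DIM('a::euclidean_space) = 3" and q: "0 < q" "q < 6"
  obtains K where "K \<ge> 0" "\<And>\<phi> g R (S::'a set). C1_compact_support \<phi> g R \<Longrightarrow> C1_compact_support.energy g \<le> 1
    \<Longrightarrow> S \<in> sets borel \<Longrightarrow> (\<integral>\<^sup>+x. indicator S x * ennreal (\<bar>\<phi> x\<bar> powr q) \<partial>lborel) \<le> emeasure lborel S + ennreal K"
proof
  define V where "V = unit_vol TYPE('a)"
  have V: "V > 0" unfolding V_def by (rule content_cball_pos) simp
  define c where "c k = 2 powr (real (Suc k) * q) * (16384 / (V\<^sup>2 * (2 ^ k) ^ 6))" for k :: nat
  have c0: "c k \<ge> 0" for k by (simp add: c_def)
  have c_geometric: "c k = (2 powr q * 16384 / V\<^sup>2) * (2 powr (q - 6)) ^ k" for k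
  proof -
    have "((2::real) ^ k) ^ 6 = 2 powr (real k * 6)"
      by (simp flip: powr_realpow add: powr_powr)
    moreover have "(2 powr (q - 6)) ^ k = 2 powr (real k * q - real k * 6)"
      by (simp flip: powr_realpow add: powr_powr algebra_simps)
    ultimately show ?thesis
      by (simp add: c_def powr_diff powr_add distrib_right)
  qed
  have "norm (2 powr (q - 6)) < 1" using q powr_less_mono[of "q - 6" 0 2] by simp
  then have "summable (\<lambda>k. (2 powr q * 16384 / V\<^sup>2) * (2 powr (q - 6)) ^ k)"
    by (intro summable_mult summable_geometric)
  then have summ: "summable c" using c_geometric by presburger
  show "suminf c \<ge> 0" using summ c0 by (rule suminf_nonneg)
  fix \<phi> :: "'a \<Rightarrow> real" and g R and S :: "'a set"
  assume C: "C1_compact_support \<phi> g R" and E: "C1_compact_support.energy g \<le> 1" and S: "S \<in> sets borel"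
  interpret C1_compact_support \<phi> g R by fact
  have [measurable]: "S \<in> sets borel" by (rule S)
  let ?A = "\<lambda>k::nat. {x. 2 ^ k < \<bar>\<phi> x\<bar>}"
  have "(\<integral>\<^sup>+x. indicator S x * ennreal (\<bar>\<phi> x\<bar> powr q) \<partial>lborel)
    \<le> (\<integral>\<^sup>+x. indicator S x + (\<Sum>k. ennreal (2 powr (real (Suc k) * q)) * indicator (?A k) x) \<partial>lborel)"
  proof (intro nn_integral_mono)
    fix x
    have "(\<Sum>k. ennreal (2 powr (real (Suc k) * q)) * indicator {s. 2 ^ k < s} \<bar>\<phi> x\<bar>)
      = (\<Sum>k. ennreal (2 powr (real (Suc k) * q)) * indicator (?A k) x)"
      by (simp add: indicator_def)
    then show "indicator S x * ennreal (\<bar>\<phi> x\<bar> powr q)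
       \<le> indicator S x + (\<Sum>k. ennreal (2 powr (real (Suc k) * q)) * indicator (?A k) x)"
      using powr_le_dyadic_sum[of "\<bar>\<phi> x\<bar>" q] q(1) by (simp split: split_indicator)
  qed
  also have "\<dots> = emeasure lborel S + (\<Sum>k. ennreal (2 powr (real (Suc k) * q)) * emeasure lborel (?A k))"
    by (simp add: nn_integral_add nn_integral_suminf nn_integral_cmult)
  also have "\<dots> \<le> emeasure lborel S + (\<Sum>k. ennreal (c k))"
  proof (intro add_left_mono suminf_le allI)
    fix k
    have "ennreal (2 powr (real (Suc k) * q)) * emeasure lborel (?A k)
      \<le> ennreal (2 powr (real (Suc k) * q)) * ennreal (16384 / (V\<^sup>2 * (2 ^ k) ^ 6))"
      using weak_sobolev[OF dim E, of "2 ^ k"] by (intro mult_left_mono) (auto simp: V_def)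
    also have "\<dots> = ennreal (c k)" by (simp add: c_def flip: ennreal_mult)
    finally show "ennreal (2 powr (real (Suc k) * q)) * emeasure lborel (?A k) \<le> ennreal (c k)" .
  qed auto
  also have "(\<Sum>k. ennreal (c k)) = ennreal (suminf c)" using c0 summ by (rule suminf_ennreal2)
  finally show "(\<integral>\<^sup>+x. indicator S x * ennreal (\<bar>\<phi> x\<bar> powr q) \<partial>lborel) \<le> emeasure lborel S + ennreal (suminf c)" .
qed

lemma C1_compact_support_cmult:
  assumes "C1_compact_support \<phi> g R"
  shows "C1_compact_support (\<lambda>x. c * \<phi> x) (\<lambda>x. c *\<^sub>R g x) R"
    "C1_compact_support.energy (\<lambda>x. c *\<^sub>R g x) = c\<^sup>2 * C1_compact_support.energy g"
proof -
  interpret C1_compact_support \<phi> g R by fact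
  show *: "C1_compact_support (\<lambda>x. c * \<phi> x) (\<lambda>x. c *\<^sub>R g x) R"
    using deriv cont_g supp by unfold_locales (auto intro!: derivative_eq_intros continuous_intros)
  show "C1_compact_support.energy (\<lambda>x. c *\<^sub>R g x) = c\<^sup>2 * energy"
    by (simp add: C1_compact_support.energy_def[OF *] energy_def power_mult_distrib)
qed

lemma C1_compact_support_diff:
  assumes "C1_compact_support \<phi> g R" "C1_compact_support \<psi> h R"
  shows "C1_compact_support (\<lambda>x. \<phi> x - \<psi> x) (\<lambda>x. g x - h x) R"
    "C1_compact_support.energy (\<lambda>x. g x - h x) \<le> 2 * C1_compact_support.energy g + 2 * C1_compact_support.energy h"
    "C1_compact_support.avg (\<lambda>x. \<phi> x - \<psi> x) t x = C1_compact_support.avg \<phi> t x - C1_compact_support.avg \<psi> t x"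
proof -
  interpret A: C1_compact_support \<phi> g R by fact
  interpret B: C1_compact_support \<psi> h R by fact
  show *: "C1_compact_support (\<lambda>x. \<phi> x - \<psi> x) (\<lambda>x. g x - h x) R"
    using A.deriv A.cont_g A.supp B.deriv B.cont_g B.supp
    by unfold_locales (auto simp: inner_diff_left intro!: derivative_eq_intros continuous_intros)
  interpret D: C1_compact_support "\<lambda>x. \<phi> x - \<psi> x" "\<lambda>x. g x - h x" R by fact
  have "D.energy \<le> (LINT x|lborel. 2 * (norm (g x))\<^sup>2 + 2 * (norm (h x))\<^sup>2)"
    unfolding D.energy_def
  proof (rule integral_mono)
    show "(norm (g x - h x))\<^sup>2 \<le> 2 * (norm (g x))\<^sup>2 + 2 * (norm (h x))\<^sup>2" for x
    proof -
      have "(norm (g x - h x))\<^sup>2 \<le> (norm (g x) + norm (h x))\<^sup>2"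
        by (intro power_mono norm_triangle_ineq4) auto
      also have "\<dots> \<le> 2 * (norm (g x))\<^sup>2 + 2 * (norm (h x))\<^sup>2"
        by (rule square_add_le)
      finally show ?thesis .
    qed
  qed (use D.integrable_g A.integrable_g B.integrable_g in auto)
  also have "\<dots> = 2 * A.energy + 2 * B.energy"
    using A.integrable_g B.integrable_g by (simp add: A.energy_def B.energy_def)
  finally show "D.energy \<le> 2 * A.energy + 2 * B.energy" .
  show "D.avg t x = A.avg t x - B.avg t x"
    unfolding D.avg_def A.avg_def B.avg_def
    by (subst Bochner_Integration.integral_diff[symmetric, OF A.integrable_avg B.integrable_avg]) (simp add: algebra_simps)
qed

text \<open>The normalised bound for \<open>\<phi> / a\<close>. An arbitrary upper bound \<open>a\<close> in place of the norm of the
  gradient avoids a case distinction when that norm is \<open>0\<close>.\<close>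

lemma sobolev:
  fixes q :: real
  assumes dim: "DIM('a::euclidean_space) = 3" and q: "0 < q" "q < 6"
  obtains K where "K \<ge> 0" "\<And>\<phi> g R (S::'a set) a. C1_compact_support \<phi> g R \<Longrightarrow> C1_compact_support.energy g \<le> a\<^sup>2 \<Longrightarrow> a > 0
    \<Longrightarrow> S \<in> sets borel \<Longrightarrow> (\<integral>\<^sup>+x. indicator S x * ennreal (\<bar>\<phi> x\<bar> powr q) \<partial>lborel) \<le> (emeasure lborel S + ennreal K) * ennreal (a powr q)"
proof -
  obtain K where K: "K \<ge> 0" "\<And>\<phi> g R (S::'a set). C1_compact_support \<phi> g R \<Longrightarrow> C1_compact_support.energy g \<le> 1
    \<Longrightarrow> S \<in> sets borel \<Longrightarrow> (\<integral>\<^sup>+x. indicator S x * ennreal (\<bar>\<phi> x\<bar> powr q) \<partial>lborel) \<le> emeasure lborel S + ennreal K"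
    by (rule sobolev_normalized[OF dim q]) (rule that)
  show ?thesis
  proof (rule that[OF K(1)])
    fix \<phi> :: "'a \<Rightarrow> real" and g R a and S :: "'a set"
    assume C: "C1_compact_support \<phi> g R" and E: "C1_compact_support.energy g \<le> a\<^sup>2" and a: "a > 0" and S: "S \<in> sets borel"
    have [measurable]: "S \<in> sets borel" "\<phi> \<in> borel_measurable borel" using S C1_compact_support.measurable_phi[OF C] by auto
    note C' = C1_compact_support_cmult[OF C, of "1 / a"]
    have "C1_compact_support.energy (\<lambda>x. (1 / a) *\<^sub>R g x) \<le> 1"
      unfolding C'(2) using E a by (simp add: power_divide)
    from K(2)[OF C'(1) this S]
    have "(\<integral>\<^sup>+x. indicator S x * ennreal (\<bar>\<phi> x / a\<bar> powr q) \<partial>lborel) \<le> emeasure lborel S + ennreal K" by simp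
    then have "(\<integral>\<^sup>+x. indicator S x * ennreal (\<bar>\<phi> x / a\<bar> powr q) \<partial>lborel) * ennreal (a powr q) \<le> (emeasure lborel S + ennreal K) * ennreal (a powr q)"
      by (rule mult_right_mono) simp
    also have "(\<integral>\<^sup>+x. indicator S x * ennreal (\<bar>\<phi> x / a\<bar> powr q) \<partial>lborel) * ennreal (a powr q)
       = (\<integral>\<^sup>+x. indicator S x * ennreal (\<bar>\<phi> x / a\<bar> powr q) * ennreal (a powr q) \<partial>lborel)"
      by (rule nn_integral_multc[symmetric]) measurable
    also have "\<dots> = (\<integral>\<^sup>+x. indicator S x * ennreal (\<bar>\<phi> x\<bar> powr q) \<partial>lborel)"
      using a by (intro nn_integral_cong) (simp add: mult.assoc abs_divide powr_divide flip: ennreal_mult)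
    finally show "(\<integral>\<^sup>+x. indicator S x * ennreal (\<bar>\<phi> x\<bar> powr q) \<partial>lborel) \<le> (emeasure lborel S + ennreal K) * ennreal (a powr q)" .
  qed
qed

lemma (in C1_compact_support) square_le_avg:
  assumes t: "t > 0"
  shows "ennreal ((unit_vol TYPE('a))\<^sup>2) * (\<integral>\<^sup>+x. ennreal ((\<phi> x)\<^sup>2) \<partial>lborel)
    \<le> 2 * ennreal ((unit_vol TYPE('a))\<^sup>2 * t\<^sup>2 * energy) + 2 * (\<integral>\<^sup>+x. indicator (cball 0 R) x * ennreal ((avg t x)\<^sup>2) \<partial>lborel)"
proof -
  define V where "V = unit_vol TYPE('a)"
  have "ennreal (V\<^sup>2) * (\<integral>\<^sup>+x. ennreal ((\<phi> x)\<^sup>2) \<partial>lborel) = (\<integral>\<^sup>+x. ennreal (V\<^sup>2) * ennreal ((\<phi> x)\<^sup>2) \<partial>lborel)"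
    by (rule nn_integral_cmult[symmetric]) measurable
  also have "\<dots> \<le> (\<integral>\<^sup>+x. 2 * ennreal ((V * \<phi> x - avg t x)\<^sup>2) + 2 * (indicator (cball 0 R) x * ennreal ((avg t x)\<^sup>2)) \<partial>lborel)"
  proof (intro nn_integral_mono)
    fix x
    show "ennreal (V\<^sup>2) * ennreal ((\<phi> x)\<^sup>2) \<le> 2 * ennreal ((V * \<phi> x - avg t x)\<^sup>2) + 2 * (indicator (cball 0 R) x * ennreal ((avg t x)\<^sup>2))"
    proof (cases "norm x \<le> R")
      case True
      have "V\<^sup>2 * (\<phi> x)\<^sup>2 = ((V * \<phi> x - avg t x) + avg t x)\<^sup>2" by (simp add: power_mult_distrib)
      also have "\<dots> \<le> 2 * (V * \<phi> x - avg t x)\<^sup>2 + 2 * (avg t x)\<^sup>2"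
        by (rule square_add_le)
      finally have "ennreal (V\<^sup>2 * (\<phi> x)\<^sup>2) \<le> ennreal (2 * (V * \<phi> x - avg t x)\<^sup>2 + 2 * (avg t x)\<^sup>2)" by (rule ennreal_leI)
      then show ?thesis using True by (simp add: ennreal_mult ennreal_plus)
    qed (simp add: supp)
  qed
  also have "\<dots> = 2 * (\<integral>\<^sup>+x. ennreal ((V * \<phi> x - avg t x)\<^sup>2) \<partial>lborel) + 2 * (\<integral>\<^sup>+x. indicator (cball 0 R) x * ennreal ((avg t x)\<^sup>2) \<partial>lborel)"
  proof -
    have m: "(\<lambda>x. ennreal ((V * \<phi> x - avg t x)\<^sup>2)) \<in> borel_measurable lborel"
      "(\<lambda>x. indicator (cball 0 R) x * ennreal ((avg t x)\<^sup>2)) \<in> borel_measurable lborel"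
      by measurable
    show ?thesis
      using m by (simp add: nn_integral_add nn_integral_cmult)
  qed
  also have "\<dots> \<le> 2 * ennreal (V\<^sup>2 * t\<^sup>2 * energy) + 2 * (\<integral>\<^sup>+x. indicator (cball 0 R) x * ennreal ((avg t x)\<^sup>2) \<partial>lborel)"
    using avg_error[OF t] by (intro add_right_mono mult_left_mono) (auto simp: V_def)
  finally show ?thesis by (simp add: V_def)
qed

lemma convergent_of_dense:
  fixes a :: "nat \<Rightarrow> 'a::metric_space \<Rightarrow> real"
  assumes lip: "\<And>n x y. \<bar>a n x - a n y\<bar> \<le> L * dist x y"
    and D: "\<And>X. open X \<Longrightarrow> X \<noteq> {} \<Longrightarrow> \<exists>d\<in>D. d \<in> X" "\<And>d. d \<in> D \<Longrightarrow> convergent (\<lambda>n. a n d)"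
  shows "convergent (\<lambda>n. a n x)"
proof -
  have "Cauchy (\<lambda>n. a n x)"
  proof (rule metric_CauchyI)
    fix e :: real assume e: "e > 0"
    define \<delta> where "\<delta> = e / 3 / (\<bar>L\<bar> + 1)"
    have "\<delta> > 0" using e by (simp add: \<delta>_def)
    then obtain d where d: "d \<in> D" "dist x d < \<delta>" using D(1)[of "ball x \<delta>"] by auto
    have "\<bar>L\<bar> * dist x d \<le> (\<bar>L\<bar> + 1) * \<delta>" using d by (intro mult_mono) auto
    also have "\<dots> = e / 3"
      unfolding \<delta>_def by (rule nonzero_mult_div_cancel_left[of "\<bar>L\<bar> + 1", simplified times_divide_eq_right[symmetric]]) linarith
    finally have L: "\<bar>a n x - a n d\<bar> \<le> e / 3" for n
      using lip[of n x d] mult_right_mono[OF abs_ge_self[of L] zero_le_dist[of x d]] by simp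
    have "Cauchy (\<lambda>n. a n d)" using D(2)[OF d(1)] convergent_Cauchy by blast
    then obtain N where N: "\<And>m n. m \<ge> N \<Longrightarrow> n \<ge> N \<Longrightarrow> dist (a m d) (a n d) < e / 3"
      using e metric_CauchyD[of "\<lambda>n. a n d" "e / 3"] by auto
    show "\<exists>N. \<forall>m\<ge>N. \<forall>n\<ge>N. dist (a m x) (a n x) < e"
    proof (intro exI allI impI)
      fix m n assume "m \<ge> N" "n \<ge> N"
      then show "dist (a m x) (a n x) < e" using N[of m n] L[of m] L[of n] unfolding dist_real_def by linarith
    qed
  qed
  then show ?thesis using Cauchy_convergent by blast
qed

text \<open>For the radii \<open>t = 1/(k+1)\<close> the averages of the \<open>\<phi>\<^sub>n\<close> are uniformly bounded and equi-Lipschitz, so a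
  diagonal subsequence makes them converge at all points of a countable dense set, hence
  everywhere, hence in \<open>L\<^sup>2\<close> of a ball by dominated convergence. The averages approximate the \<open>\<phi>\<^sub>n\<close>
  uniformly in \<open>n\<close> as \<open>t\<close> tends to \<open>0\<close>, so the subsequence itself is Cauchy.\<close>

lemma rellich:
  fixes \<phi> :: "nat \<Rightarrow> 'a::euclidean_space \<Rightarrow> real" and E R :: real
  assumes dim: "DIM('a) = 3" and C: "\<And>n. C1_compact_support (\<phi> n) (g n) R"
    and E: "\<And>n. C1_compact_support.energy (g n) \<le> E"
  obtains r :: "nat \<Rightarrow> nat" where "strict_mono r"
    "\<And>e. e > 0 \<Longrightarrow> \<exists>N. \<forall>m\<ge>N. \<forall>n\<ge>N. (\<integral>\<^sup>+x. ennreal ((\<phi> (r m) x - \<phi> (r n) x)\<^sup>2) \<partial>lborel) \<le> ennreal e"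
proof -
  interpret C: C1_compact_support "\<phi> n" "g n" R for n by (rule C)
  define V where "V = unit_vol TYPE('a)"
  have V: "V > 0" unfolding V_def by (rule content_cball_pos) simp
  have E0: "E \<ge> 0" using E[of 0] C.energy_nonneg[of 0] by linarith
  obtain D :: "'a set" where D: "countable D" "\<And>X. open X \<Longrightarrow> X \<noteq> {} \<Longrightarrow> \<exists>d\<in>D. d \<in> X"
    by (rule countable_dense_setE) (rule that)
  define t where "t k = 1 / real (Suc k)" for k
  have t: "t k > 0" for k by (simp add: t_def)
  have bound: "\<bar>C.avg n (t k) x\<bar> \<le> 4 * sqrt (V * E / t k)" for n k x
  proof -
    have "V * C.energy n / t k \<le> V * E / t k" using V E t[of k] by (intro divide_right_mono mult_left_mono) auto
    then have "4 * sqrt (V * C.energy n / t k) \<le> 4 * sqrt (V * E / t k)" by simp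
    moreover have "\<bar>C.avg n (t k) x\<bar> \<le> 4 * sqrt (V * C.energy n / t k)"
      using C.abs_avg_le[OF t dim] by (simp add: V_def)
    ultimately show ?thesis by linarith
  qed
  have lip: "\<bar>C.avg n (t k) x - C.avg n (t k) y\<bar> \<le> sqrt (V / t k ^ 3 * E) * dist x y" for n k x y
  proof (rule power2_le_imp_le)
    have "(C.avg n (t k) x - C.avg n (t k) y)\<^sup>2 \<le> V / t k ^ 3 * (dist x y)\<^sup>2 * C.energy n"
      using C.avg_lipschitz[OF t] by (simp add: V_def dim)
    also have "\<dots> \<le> V / t k ^ 3 * (dist x y)\<^sup>2 * E"
      using V t[of k] E[of n] by (intro mult_left_mono) auto
    also have "\<dots> = (sqrt (V / t k ^ 3 * E) * dist x y)\<^sup>2"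
      using V t[of k] E0 by (simp add: power_mult_distrib)
    finally show "\<bar>C.avg n (t k) x - C.avg n (t k) y\<bar>\<^sup>2 \<le> (sqrt (V / t k ^ 3 * E) * dist x y)\<^sup>2" by simp
  qed (use V t[of k] E0 in simp)
  obtain r :: "nat \<Rightarrow> nat" where r: "strict_mono r"
    "\<And>p. p \<in> UNIV \<times> D \<Longrightarrow> \<exists>l. (\<lambda>n. sqrt (t (fst p)) * C.avg (r n) (t (fst p)) (snd p)) \<longlonglongrightarrow> l"
  proof (rule function_convergent_subsequence[of "(UNIV::nat set) \<times> D" "\<lambda>n p. sqrt (t (fst p)) * C.avg n (t (fst p)) (snd p)" "4 * sqrt (V * E)"])
    show "countable ((UNIV::nat set) \<times> D)" using D(1) by simp
    show "norm (sqrt (t (fst p)) * C.avg n (t (fst p)) (snd p)) \<le> 4 * sqrt (V * E)" for n and p :: "nat \<times> 'a"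
    proof -
      have "norm (sqrt (t (fst p)) * C.avg n (t (fst p)) (snd p)) = sqrt (t (fst p)) * \<bar>C.avg n (t (fst p)) (snd p)\<bar>"
        using t[of "fst p"] by (simp add: abs_mult)
      also have "\<dots> \<le> sqrt (t (fst p)) * (4 * sqrt (V * E / t (fst p)))"
        using t[of "fst p"] by (intro mult_left_mono bound) auto
      also have "\<dots> = 4 * sqrt (V * E)" using t[of "fst p"] by (simp add: real_sqrt_divide)
      finally show ?thesis .
    qed
  qed blast
  have conv: "convergent (\<lambda>n. C.avg (r n) (t k) x)" for k x
  proof (rule convergent_of_dense[OF lip D(2)])
    fix d assume "d \<in> D"
    then obtain l where "(\<lambda>n. sqrt (t k) * C.avg (r n) (t k) d) \<longlonglongrightarrow> l" using r(2)[of "(k, d)"] by auto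
    then have "(\<lambda>n. 1 / sqrt (t k) * (sqrt (t k) * C.avg (r n) (t k) d)) \<longlonglongrightarrow> 1 / sqrt (t k) * l" by (rule tendsto_mult_left)
    then show "convergent (\<lambda>n. C.avg (r n) (t k) d)" using t[of k] by (auto simp: convergent_def)
  qed
  define l where "l k x = lim (\<lambda>n. C.avg (r n) (t k) x)" for k x
  have l: "(\<lambda>n. C.avg (r n) (t k) x) \<longlonglongrightarrow> l k x" for k x
    using conv convergent_LIMSEQ_iff unfolding l_def by blast
  have l_meas [measurable]: "l k \<in> borel_measurable borel" for k
    by (rule borel_measurable_LIMSEQ_real[OF l]) measurable
  have l_bound: "\<bar>l k x\<bar> \<le> 4 * sqrt (V * E / t k)" for k x
    by (rule LIMSEQ_le_const2[OF tendsto_rabs[OF l]]) (use bound in blast)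
  define \<delta> where "\<delta> k n = (\<integral>\<^sup>+x. indicator (cball 0 R) x * ennreal ((C.avg (r n) (t k) x - l k x)\<^sup>2) \<partial>lborel)" for k n
  have \<delta>: "\<delta> k \<longlonglongrightarrow> 0" for k
  proof -
    have "(\<lambda>n. \<integral>\<^sup>+x. indicator (cball 0 R) x * ennreal ((C.avg (r n) (t k) x - l k x)\<^sup>2) \<partial>lborel) \<longlonglongrightarrow> (\<integral>\<^sup>+x. (0::ennreal) \<partial>(lborel :: 'a measure))"
    proof (rule nn_integral_dominated_convergence[where w="\<lambda>x. indicator (cball 0 R) x * ennreal ((8 * sqrt (V * E / t k))\<^sup>2)"])
      show "AE x in lborel. indicator (cball 0 R) x * ennreal ((C.avg (r n) (t k) x - l k x)\<^sup>2) \<le> indicator (cball 0 R) x * ennreal ((8 * sqrt (V * E / t k))\<^sup>2)" for n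
      proof (intro AE_I2 mult_left_mono ennreal_leI)
        fix x
        have "\<bar>C.avg (r n) (t k) x - l k x\<bar> \<le> 8 * sqrt (V * E / t k)" using bound[of "r n" k x] l_bound[of k x] by linarith
        then show "(C.avg (r n) (t k) x - l k x)\<^sup>2 \<le> (8 * sqrt (V * E / t k))\<^sup>2" by (metis abs_ge_zero power2_abs power_mono)
      qed auto
      show "(\<integral>\<^sup>+x. indicator (cball 0 R) x * ennreal ((8 * sqrt (V * E / t k))\<^sup>2) \<partial>(lborel :: 'a measure)) < \<infinity>"
        using emeasure_lborel_cball_finite[of "0::'a" R] by (simp add: nn_integral_multc ennreal_mult_less_top)
      show "AE x in lborel. (\<lambda>n. indicator (cball 0 R) x * ennreal ((C.avg (r n) (t k) x - l k x)\<^sup>2)) \<longlonglongrightarrow> 0"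
      proof (intro AE_I2)
        fix x
        have "(\<lambda>n. (C.avg (r n) (t k) x - l k x)\<^sup>2) \<longlonglongrightarrow> (l k x - l k x)\<^sup>2" by (intro tendsto_intros l)
        then have "(\<lambda>n. ennreal ((C.avg (r n) (t k) x - l k x)\<^sup>2)) \<longlonglongrightarrow> ennreal 0" by (intro tendsto_ennrealI) simp
        then show "(\<lambda>n. indicator (cball 0 R) x * ennreal ((C.avg (r n) (t k) x - l k x)\<^sup>2)) \<longlonglongrightarrow> 0" by (auto split: split_indicator)
      qed
    qed auto
    then show ?thesis by (simp add: \<delta>_def[abs_def])
  qed
  show ?thesis
  proof (rule that[OF r(1)])
    fix e :: real assume e: "e > 0"
    define e' where "e' = V\<^sup>2 * e / 16"
    have e': "e' > 0" using e V by (simp add: e'_def)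
    obtain k where k: "V\<^sup>2 * (t k)\<^sup>2 * (4 * E) \<le> e'"
    proof -
      have "(\<lambda>k. V\<^sup>2 * (t k)\<^sup>2 * (4 * E)) \<longlonglongrightarrow> V\<^sup>2 * 0\<^sup>2 * (4 * E)"
        unfolding t_def using LIMSEQ_Suc[OF lim_1_over_n] by (intro tendsto_intros)
      then have "eventually (\<lambda>k. V\<^sup>2 * (t k)\<^sup>2 * (4 * E) < e') sequentially"
        using e' by (intro order_tendstoD(2)) auto
      then obtain k where "V\<^sup>2 * (t k)\<^sup>2 * (4 * E) < e'" by (auto simp: eventually_sequentially)
      then show ?thesis by (rule that[OF less_imp_le])
    qed
    have "eventually (\<lambda>n. \<delta> k n < ennreal e') sequentially"
      using e' \<delta>[of k] by (intro order_tendstoD(2)) auto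
    then obtain N where N: "\<And>n. n \<ge> N \<Longrightarrow> \<delta> k n \<le> ennreal e'"
      unfolding eventually_sequentially by (meson less_imp_le)
    have "(\<integral>\<^sup>+x. ennreal ((\<phi> (r m) x - \<phi> (r n) x)\<^sup>2) \<partial>lborel) \<le> ennreal e" if mn: "m \<ge> N" "n \<ge> N" for m n
    proof -
      note CD = C1_compact_support_diff[OF C C, of "r m" "r n"]
      interpret D: C1_compact_support "\<lambda>x. \<phi> (r m) x - \<phi> (r n) x" "\<lambda>x. g (r m) x - g (r n) x" R by (rule CD(1))
      have "D.energy \<le> 4 * E" using CD(2) E[of "r m"] E[of "r n"] by linarith
      then have 1: "V\<^sup>2 * (t k)\<^sup>2 * D.energy \<le> e'"
        using k mult_left_mono[of D.energy "4 * E" "V\<^sup>2 * (t k)\<^sup>2"] by simp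
      have "(\<integral>\<^sup>+x. indicator (cball 0 R) x * ennreal ((D.avg (t k) x)\<^sup>2) \<partial>lborel)
        \<le> (\<integral>\<^sup>+x. 2 * (indicator (cball 0 R) x * ennreal ((C.avg (r m) (t k) x - l k x)\<^sup>2))
             + 2 * (indicator (cball 0 R) x * ennreal ((C.avg (r n) (t k) x - l k x)\<^sup>2)) \<partial>lborel)"
      proof (intro nn_integral_mono)
        fix x
        let ?a = "C.avg (r m) (t k) x - l k x" and ?b = "C.avg (r n) (t k) x - l k x"
        have "(D.avg (t k) x)\<^sup>2 = (?a - ?b)\<^sup>2" by (simp add: CD(3))
        also have "\<dots> \<le> 2 * ?a\<^sup>2 + 2 * ?b\<^sup>2"
          using square_add_le[of ?a "- ?b"] by (simp only: diff_conv_add_uminus power2_minus)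
        finally have "ennreal ((D.avg (t k) x)\<^sup>2) \<le> ennreal (2 * ?a\<^sup>2 + 2 * ?b\<^sup>2)" by (rule ennreal_leI)
        then show "indicator (cball 0 R) x * ennreal ((D.avg (t k) x)\<^sup>2)
          \<le> 2 * (indicator (cball 0 R) x * ennreal (?a\<^sup>2)) + 2 * (indicator (cball 0 R) x * ennreal (?b\<^sup>2))"
          by (auto simp: ennreal_mult ennreal_plus split: split_indicator)
      qed
      also have "\<dots> = 2 * \<delta> k m + 2 * \<delta> k n"
        unfolding \<delta>_def by (subst nn_integral_add) (auto simp: nn_integral_cmult)
      also have "\<dots> \<le> 2 * ennreal e' + 2 * ennreal e'"
        using N mn by (intro add_mono mult_left_mono) auto
      also have "\<dots> = ennreal (4 * e')" using e' by (simp add: ennreal_mult ennreal_plus flip: distrib_right)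
      finally have "2 * ennreal (V\<^sup>2 * (t k)\<^sup>2 * D.energy) + 2 * (\<integral>\<^sup>+x. indicator (cball 0 R) x * ennreal ((D.avg (t k) x)\<^sup>2) \<partial>lborel)
         \<le> 2 * ennreal e' + 2 * ennreal (4 * e')"
        using 1 by (intro add_mono mult_left_mono ennreal_leI) auto
      also have "\<dots> \<le> ennreal (V\<^sup>2) * ennreal e"
        using e' e by (simp add: e'_def flip: ennreal_mult ennreal_plus ennreal_numeral)
      finally have "ennreal (V\<^sup>2) * (\<integral>\<^sup>+x. ennreal ((\<phi> (r m) x - \<phi> (r n) x)\<^sup>2) \<partial>lborel) \<le> ennreal (V\<^sup>2) * ennreal e"
        using D.square_le_avg[OF t, of k] by (simp add: V_def)
      then show ?thesis using V by (subst (asm) ennreal_mult_le_mult_iff) auto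
    qed
    then show "\<exists>N. \<forall>m\<ge>N. \<forall>n\<ge>N. (\<integral>\<^sup>+x. ennreal ((\<phi> (r m) x - \<phi> (r n) x)\<^sup>2) \<partial>lborel) \<le> ennreal e" by blast
  qed
qed

section \<open>Square integrable functions\<close>

definition sq_int :: "'a measure \<Rightarrow> ('a \<Rightarrow> 'b::euclidean_space) \<Rightarrow> bool" where
  "sq_int M u \<longleftrightarrow> u \<in> borel_measurable M \<and> integrable M (\<lambda>x. (norm (u x))\<^sup>2)"

definition l2 :: "'a measure \<Rightarrow> ('a \<Rightarrow> 'b::euclidean_space) \<Rightarrow> real" where
  "l2 M u = sqrt (LINT x|M. (norm (u x))\<^sup>2)"

lemma L2_iff: "u \<in> L2 \<Omega> \<longleftrightarrow> sq_int (lebesgue_on \<Omega>) u"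
  by (simp add: L2_def sq_int_def)

lemma sq_int_measurable [measurable_dest]: "sq_int M u \<Longrightarrow> u \<in> borel_measurable M"
  by (simp add: sq_int_def)

lemma sq_int_integrable: "sq_int M u \<Longrightarrow> integrable M (\<lambda>x. (norm (u x))\<^sup>2)"
  by (simp add: sq_int_def)

lemma l2_nonneg: "l2 M u \<ge> 0"
  by (simp add: l2_def)

lemma l2_power2: "(l2 M u)\<^sup>2 = (LINT x|M. (norm (u x))\<^sup>2)"
  by (simp add: l2_def)

lemma nn_l2:
  assumes "sq_int M u"
  shows "(\<integral>\<^sup>+x. ennreal ((norm (u x))\<^sup>2) \<partial>M) = ennreal ((l2 M u)\<^sup>2)"
  unfolding l2_power2 using sq_int_integrable[OF assms] by (intro nn_integral_eq_integral) auto

lemma sq_int_boundI: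
  assumes "u \<in> borel_measurable M" "(\<integral>\<^sup>+x. ennreal ((norm (u x))\<^sup>2) \<partial>M) \<le> ennreal (c\<^sup>2)" "c \<ge> 0"
  shows "sq_int M u" "l2 M u \<le> c"
proof -
  have "(\<integral>\<^sup>+x. ennreal ((norm (u x))\<^sup>2) \<partial>M) < \<infinity>" using assms(2) by (simp add: le_less_trans)
  then show *: "sq_int M u" unfolding sq_int_def using assms(1) by (auto intro!: integrableI_nonneg)
  have "(l2 M u)\<^sup>2 \<le> c\<^sup>2" using assms(2) unfolding nn_l2[OF *] by simp
  then show "l2 M u \<le> c" using assms(3) by (rule power2_le_imp_le)
qed

lemma sq_int_zero: "sq_int M (\<lambda>x. 0)" "l2 M (\<lambda>x. 0) = 0"
  by (simp_all add: sq_int_def l2_def)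

lemma sq_int_scaleR:
  assumes "sq_int M u"
  shows "sq_int M (\<lambda>x. c *\<^sub>R u x)" "l2 M (\<lambda>x. c *\<^sub>R u x) = \<bar>c\<bar> * l2 M u"
  using assms by (auto simp: sq_int_def l2_def power_mult_distrib real_sqrt_mult)

lemma sq_int_add:
  assumes "sq_int M u" "sq_int M v"
  shows "sq_int M (\<lambda>x. u x + v x)"
proof -
  note [measurable] = sq_int_measurable[OF assms(1)] sq_int_measurable[OF assms(2)]
  have "(norm (u x + v x))\<^sup>2 \<le> (norm (u x) + norm (v x))\<^sup>2" for x
    by (intro power_mono norm_triangle_ineq norm_ge_zero)
  then have "(norm (u x + v x))\<^sup>2 \<le> 2 * (norm (u x))\<^sup>2 + 2 * (norm (v x))\<^sup>2" for x
    using square_add_le by (rule order_trans)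
  moreover have int: "integrable M (\<lambda>x. 2 * (norm (u x))\<^sup>2 + 2 * (norm (v x))\<^sup>2)"
    using assms by (simp add: sq_int_def)
  ultimately have "integrable M (\<lambda>x. (norm (u x + v x))\<^sup>2)"
    by (intro Bochner_Integration.integrable_bound[OF int] AE_I2) auto
  then show ?thesis by (simp add: sq_int_def)
qed

lemma sq_int_diff:
  assumes "sq_int M u" "sq_int M v"
  shows "sq_int M (\<lambda>x. u x - v x)"
  using sq_int_add[OF assms(1) sq_int_scaleR(1)[OF assms(2), of "-1"]] by simp

lemma l2_minus: "l2 M (\<lambda>x. u x - v x) = l2 M (\<lambda>x. v x - u x)"
  by (simp add: l2_def norm_minus_commute)

lemma l2_Cauchy_Schwarz:
  assumes "sq_int M u" "sq_int M v"
  shows "integrable M (\<lambda>x. u x \<bullet> v x)" "\<bar>LINT x|M. u x \<bullet> v x\<bar> \<le> l2 M u * l2 M v"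
proof -
  note [measurable] = sq_int_measurable[OF assms(1)] sq_int_measurable[OF assms(2)]
  have bound: "norm (u x \<bullet> v x) \<le> norm ((norm (u x))\<^sup>2 + (norm (v x))\<^sup>2)" for x
    using sum_squares_bound[of "norm (u x)" "norm (v x)"] Cauchy_Schwarz_ineq2[of "u x" "v x"]
      mult_nonneg_nonneg[of "norm (u x)" "norm (v x)"] by simp
  show int: "integrable M (\<lambda>x. u x \<bullet> v x)"
  proof (rule Bochner_Integration.integrable_bound[OF _ _ AE_I2[OF bound]])
    show "integrable M (\<lambda>x. (norm (u x))\<^sup>2 + (norm (v x))\<^sup>2)" using assms by (simp add: sq_int_def)
  qed measurable
  have "ennreal \<bar>LINT x|M. u x \<bullet> v x\<bar> \<le> (\<integral>\<^sup>+x. ennreal \<bar>u x \<bullet> v x\<bar> \<partial>M)"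
    using integral_norm_bound_ennreal[OF int] by simp
  also have "\<dots> \<le> (\<integral>\<^sup>+x. ennreal (norm (u x)) * ennreal (norm (v x)) \<partial>M)"
    by (intro nn_integral_mono) (simp add: Cauchy_Schwarz_ineq2 flip: ennreal_mult)
  finally have "(ennreal \<bar>LINT x|M. u x \<bullet> v x\<bar>)\<^sup>2 \<le> (\<integral>\<^sup>+x. ennreal (norm (u x)) * ennreal (norm (v x)) \<partial>M)\<^sup>2"
    by (rule power_mono) simp
  also have "\<dots> \<le> (\<integral>\<^sup>+x. (ennreal (norm (u x)))\<^sup>2 \<partial>M) * (\<integral>\<^sup>+x. (ennreal (norm (v x)))\<^sup>2 \<partial>M)"
    by (rule Cauchy_Schwarz_nn_integral) auto
  also have "\<dots> = ennreal ((l2 M u * l2 M v)\<^sup>2)"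
    by (simp add: ennreal_power nn_l2[OF assms(1)] nn_l2[OF assms(2)] power_mult_distrib flip: ennreal_mult)
  finally have "\<bar>LINT x|M. u x \<bullet> v x\<bar>\<^sup>2 \<le> (l2 M u * l2 M v)\<^sup>2"
    by (simp add: ennreal_power)
  then show "\<bar>LINT x|M. u x \<bullet> v x\<bar> \<le> l2 M u * l2 M v"
    by (rule power2_le_imp_le) (simp add: l2_nonneg)
qed

lemma l2_add_power2:
  assumes "sq_int M u" "sq_int M v"
  shows "(l2 M (\<lambda>x. u x + v x))\<^sup>2 = (l2 M u)\<^sup>2 + 2 * (LINT x|M. u x \<bullet> v x) + (l2 M v)\<^sup>2"
proof -
  have "(norm (u x + v x))\<^sup>2 = (norm (u x))\<^sup>2 + 2 * (u x \<bullet> v x) + (norm (v x))\<^sup>2" for x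
    by (simp add: power2_norm_eq_inner inner_add inner_commute)
  then show ?thesis
    unfolding l2_power2 using assms l2_Cauchy_Schwarz(1)[OF assms] by (simp add: sq_int_def)
qed

lemma l2_triangle:
  assumes "sq_int M u" "sq_int M v"
  shows "l2 M (\<lambda>x. u x + v x) \<le> l2 M u + l2 M v"
proof (rule power2_le_imp_le)
  show "(l2 M (\<lambda>x. u x + v x))\<^sup>2 \<le> (l2 M u + l2 M v)\<^sup>2"
    unfolding l2_add_power2[OF assms] power2_sum using l2_Cauchy_Schwarz(2)[OF assms] by simp
qed (simp add: l2_nonneg)

lemma l2_triangle_diff:
  assumes "sq_int M u" "sq_int M v" "sq_int M w"
  shows "l2 M (\<lambda>x. u x - w x) \<le> l2 M (\<lambda>x. u x - v x) + l2 M (\<lambda>x. v x - w x)"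
  using l2_triangle[OF sq_int_diff[OF assms(1,2)] sq_int_diff[OF assms(2,3)]] by simp

lemma l2_cong_AE:
  assumes "AE x in M. u x = v x" "u \<in> borel_measurable M" "v \<in> borel_measurable M"
  shows "l2 M u = l2 M v"
  unfolding l2_def using assms by (intro arg_cong[where f=sqrt] integral_cong_AE) auto

lemma l2_eq_0_iff: "sq_int M u \<Longrightarrow> l2 M u = 0 \<longleftrightarrow> (AE x in M. u x = 0)"
  unfolding l2_def sq_int_def by (auto simp: integral_nonneg_eq_0_iff_AE)

lemma l2_fatou:
  fixes u :: "nat \<Rightarrow> 'a \<Rightarrow> 'b::euclidean_space"
  assumes u: "\<And>n. sq_int M (u n)" "AE x in M. (\<lambda>n. u n x) \<longlonglongrightarrow> v x" "v \<in> borel_measurable M"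
    and c: "\<And>n. n \<ge> N \<Longrightarrow> l2 M (u n) \<le> c"
  shows "sq_int M v" "l2 M v \<le> c"
proof -
  note [measurable] = sq_int_measurable[OF u(1)] u(3)
  have c0: "c \<ge> 0" using c[of N] l2_nonneg[of M "u N"] by simp
  have "(\<integral>\<^sup>+x. ennreal ((norm (v x))\<^sup>2) \<partial>M) \<le> (\<integral>\<^sup>+x. liminf (\<lambda>n. ennreal ((norm (u n x))\<^sup>2)) \<partial>M)"
  proof (rule nn_integral_mono_AE)
    show "AE x in M. ennreal ((norm (v x))\<^sup>2) \<le> liminf (\<lambda>n. ennreal ((norm (u n x))\<^sup>2))"
      using u(2)
    proof eventually_elim
      case (elim x)
      then have "(\<lambda>n. ennreal ((norm (u n x))\<^sup>2)) \<longlonglongrightarrow> ennreal ((norm (v x))\<^sup>2)" by (intro tendsto_intros)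
      then have "liminf (\<lambda>n. ennreal ((norm (u n x))\<^sup>2)) = ennreal ((norm (v x))\<^sup>2)"
        by (rule lim_imp_Liminf[OF sequentially_bot])
      then show ?case by simp
    qed
  qed
  also have "\<dots> \<le> liminf (\<lambda>n. \<integral>\<^sup>+x. ennreal ((norm (u n x))\<^sup>2) \<partial>M)"
    by (rule nn_integral_liminf) measurable
  also have "\<dots> \<le> liminf (\<lambda>n. ennreal (c\<^sup>2))"
    using c by (intro Liminf_mono eventually_mono[OF eventually_ge_at_top[of N]])
      (auto simp: nn_l2[OF u(1)] intro!: ennreal_leI power_mono l2_nonneg)
  also have "\<dots> = ennreal (c\<^sup>2)" by (simp add: Liminf_const)
  finally show "sq_int M v" "l2 M v \<le> c" using sq_int_boundI[OF u(3) _ c0] by auto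
qed

text \<open>Along a subsequence with increments \<open>d\<^sub>j\<close> of norm below \<open>4\<^bsup>-j\<^esup>\<close> the series of the \<open>2\<^sup>j \<bar>d\<^sub>j\<bar>\<^sup>2\<close> has a
  finite integral. Since \<open>\<bar>d\<^sub>j\<bar> \<le> 2\<^bsup>-j\<^esup> + 2\<^sup>j \<bar>d\<^sub>j\<bar>\<^sup>2\<close>, the increments are summable almost everywhere. The
  limit is then an \<open>L\<^sup>2\<close> limit by Fatou's lemma.\<close>

lemma l2_complete:
  fixes u :: "nat \<Rightarrow> 'a \<Rightarrow> 'b::euclidean_space"
  assumes u: "\<And>n. sq_int M (u n)"
    and Cau: "\<And>e. e > 0 \<Longrightarrow> \<exists>N. \<forall>m\<ge>N. \<forall>n\<ge>N. l2 M (\<lambda>x. u m x - u n x) < e"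
  obtains v where "sq_int M v" "(\<lambda>n. l2 M (\<lambda>x. u n x - v x)) \<longlonglongrightarrow> 0"
proof -
  note [measurable] = sq_int_measurable[OF u]
  have "\<exists>N. \<forall>m\<ge>N. \<forall>n\<ge>N. l2 M (\<lambda>x. u m x - u n x) < (1/4) ^ j" for j :: nat
    by (rule Cau) simp
  then obtain K where K: "\<And>j m n. m \<ge> K j \<Longrightarrow> n \<ge> K j \<Longrightarrow> l2 M (\<lambda>x. u m x - u n x) < (1/4) ^ j" by metis
  \<comment> \<open>The sum makes the subsequence monotone without a recursive choice.\<close>
  define k where "k j = j + (\<Sum>i\<le>j. K i)" for j
  have kK: "k j \<ge> K j" for j
  proof -
    have "K j \<le> (\<Sum>i\<le>j. K i)" by (rule member_le_sum) auto
    then show ?thesis by (simp add: k_def)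
  qed
  have k_mono: "k j \<le> k (Suc j)" for j by (simp add: k_def)
  have k_ge: "k j \<ge> j" for j by (simp add: k_def)
  define d where "d j x = u (k (Suc j)) x - u (k j) x" for j x
  have d: "sq_int M (d j)" "l2 M (d j) < (1/4) ^ j" for j
    using sq_int_diff[OF u u] K[of j "k (Suc j)" "k j"] kK[of j] k_mono[of j] by (auto simp: d_def[abs_def])
  note [measurable] = sq_int_measurable[OF d(1)]
  have "(\<integral>\<^sup>+x. (\<Sum>j. ennreal (2 ^ j * (norm (d j x))\<^sup>2)) \<partial>M) = (\<Sum>j. \<integral>\<^sup>+x. ennreal (2 ^ j * (norm (d j x))\<^sup>2) \<partial>M)"
    by (rule nn_integral_suminf) measurable
  also have "\<dots> \<le> (\<Sum>j. ennreal ((1/8) ^ j))"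
  proof (intro suminf_le allI)
    fix j
    have "(\<integral>\<^sup>+x. ennreal (2 ^ j * (norm (d j x))\<^sup>2) \<partial>M) = (\<integral>\<^sup>+x. ennreal (2 ^ j) * ennreal ((norm (d j x))\<^sup>2) \<partial>M)"
      by (simp add: ennreal_mult)
    also have "\<dots> = ennreal (2 ^ j) * ennreal ((l2 M (d j))\<^sup>2)"
      by (subst nn_integral_cmult) (auto simp: nn_l2[OF d(1)])
    also have "\<dots> \<le> ennreal (2 ^ j) * ennreal (((1/4) ^ j)\<^sup>2)"
      using d(2)[of j] by (intro mult_left_mono ennreal_leI power_mono l2_nonneg) auto
    also have "\<dots> = ennreal (2 ^ j * ((1/4) ^ j)\<^sup>2)" by (simp flip: ennreal_mult)
    also have "2 ^ j * ((1/4) ^ j)\<^sup>2 = (1/8 :: real) ^ j"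
      by (simp add: power2_eq_square flip: power_mult_distrib)
    finally show "(\<integral>\<^sup>+x. ennreal (2 ^ j * (norm (d j x))\<^sup>2) \<partial>M) \<le> ennreal ((1/8) ^ j)" .
  qed auto
  also have "\<dots> = ennreal (\<Sum>j. (1/8) ^ j)"
    by (rule suminf_ennreal2) (auto intro!: summable_geometric)
  finally have "(\<integral>\<^sup>+x. (\<Sum>j. ennreal (2 ^ j * (norm (d j x))\<^sup>2)) \<partial>M) \<noteq> \<infinity>"
    by (auto simp: top_unique)
  then have "AE x in M. (\<Sum>j. ennreal (2 ^ j * (norm (d j x))\<^sup>2)) \<noteq> \<infinity>"
    by (rule nn_integral_PInf_AE[rotated]) measurable
  then have "AE x in M. convergent (\<lambda>j. u (k j) x)"
  proof eventually_elim
    case (elim x)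
    then have s: "summable (\<lambda>j. 2 ^ j * (norm (d j x))\<^sup>2)"
      by (intro summable_suminf_not_top) auto
    have "summable (\<lambda>j. norm (d j x))"
    proof (rule summable_comparison_test')
      show "summable (\<lambda>j. (1/2) ^ j + 2 ^ j * (norm (d j x))\<^sup>2)"
        by (intro summable_add s summable_geometric) simp
      show "norm (norm (d j x)) \<le> (1/2) ^ j + 2 ^ j * (norm (d j x))\<^sup>2" if "j \<ge> 0" for j
      proof (cases "norm (d j x) \<le> (1/2) ^ j")
        case False
        then have "(1/2) ^ j * norm (d j x) \<le> norm (d j x) * norm (d j x)" by (intro mult_right_mono) auto
        then have "2 ^ j * ((1/2) ^ j * norm (d j x)) \<le> 2 ^ j * (norm (d j x) * norm (d j x))" by (intro mult_left_mono) auto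
        then have "norm (d j x) \<le> 2 ^ j * (norm (d j x))\<^sup>2" by (simp add: power_one_over power2_eq_square)
        then show ?thesis by (simp add: add_increasing)
      qed (simp add: add_increasing2)
    qed
    then have "summable (\<lambda>j. d j x)" by (rule summable_norm_cancel)
    then have "convergent (\<lambda>n. \<Sum>j<n. d j x)" by (simp add: summable_iff_convergent)
    moreover have "(\<Sum>j<n. d j x) = u (k n) x - u (k 0) x" for n
      unfolding d_def by (rule sum_lessThan_telescope)
    ultimately have "convergent (\<lambda>n. (u (k n) x - u (k 0) x) + u (k 0) x)"
      by (intro convergent_add convergent_const) simp
    then show ?case by simp
  qed
  define v where "v x = lim (\<lambda>j. u (k j) x)" for x
  have v_lim: "AE x in M. (\<lambda>j. u (k j) x) \<longlonglongrightarrow> v x"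
    using \<open>AE x in M. convergent (\<lambda>j. u (k j) x)\<close> by eventually_elim (simp add: v_def convergent_LIMSEQ_iff)
  have [measurable]: "v \<in> borel_measurable M" unfolding v_def by measurable
  have F: "sq_int M (\<lambda>x. u n x - v x) \<and> l2 M (\<lambda>x. u n x - v x) \<le> (1/4) ^ j" if "n \<ge> k j" for n j
  proof -
    have "AE x in M. (\<lambda>i. u n x - u (k i) x) \<longlonglongrightarrow> u n x - v x"
      using v_lim by eventually_elim (intro tendsto_intros)
    moreover have "l2 M (\<lambda>x. u n x - u (k i) x) \<le> (1/4) ^ j" if "i \<ge> k j" for i
      using K[of j n "k i"] \<open>n \<ge> k j\<close> that kK[of j] k_ge[of i] by simp
    ultimately show ?thesis
      using l2_fatou[of M "\<lambda>i x. u n x - u (k i) x" "\<lambda>x. u n x - v x" "k j" "(1/4) ^ j"] sq_int_diff[OF u u] by simp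
  qed
  have v: "sq_int M v"
    using sq_int_diff[OF u F[THEN conjunct1, OF order_refl], of "k 0" 0] by simp
  have "(\<lambda>n. l2 M (\<lambda>x. u n x - v x)) \<longlonglongrightarrow> 0"
  proof (rule LIMSEQ_I)
    fix e :: real assume "e > 0"
    then obtain j where j: "(1/4) ^ j < e" using real_arch_pow_inv[of e "1/4"] by auto
    show "\<exists>N. \<forall>n\<ge>N. norm (l2 M (\<lambda>x. u n x - v x) - 0) < e"
    proof (intro exI allI impI)
      fix n assume "k j \<le> n"
      then show "norm (l2 M (\<lambda>x. u n x - v x) - 0) < e"
        using F[of j n] j l2_nonneg[of M "\<lambda>x. u n x - v x"] by simp
    qed
  qed
  with v show ?thesis by (rule that)
qed

lemma l2_AE_subseq:
  fixes u :: "nat \<Rightarrow> 'a \<Rightarrow> 'b::euclidean_space"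
  assumes u: "\<And>n. sq_int M (u n)" "sq_int M v" and lim: "(\<lambda>n. l2 M (\<lambda>x. u n x - v x)) \<longlonglongrightarrow> 0"
  obtains r :: "nat \<Rightarrow> nat" where "strict_mono r" "AE x in M. (\<lambda>n. u (r n) x) \<longlonglongrightarrow> v x"
proof -
  have "(\<lambda>n. (l2 M (\<lambda>x. u n x - v x))\<^sup>2) \<longlonglongrightarrow> 0\<^sup>2" by (intro tendsto_intros lim)
  then have "(\<lambda>n. LINT x|M. norm ((norm (u n x - v x))\<^sup>2)) \<longlonglongrightarrow> 0" by (simp add: l2_power2)
  moreover have "integrable M (\<lambda>x. (norm (u n x - v x))\<^sup>2)" for n
    using sq_int_diff[OF u] sq_int_integrable by blast
  ultimately obtain r :: "nat \<Rightarrow> nat" where r: "strict_mono r" "AE x in M. (\<lambda>n. (norm (u (r n) x - v x))\<^sup>2) \<longlonglongrightarrow> 0"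
    using tendsto_L1_AE_subseq[of M "\<lambda>n x. (norm (u n x - v x))\<^sup>2"] by blast
  have "AE x in M. (\<lambda>n. u (r n) x) \<longlonglongrightarrow> v x"
    using r(2)
  proof eventually_elim
    case (elim x)
    then have "(\<lambda>n. sqrt ((norm (u (r n) x - v x))\<^sup>2)) \<longlonglongrightarrow> sqrt 0" by (intro tendsto_intros)
    then show ?case by (simp add: tendsto_norm_zero_iff LIM_zero_iff)
  qed
  with r(1) show ?thesis by (rule that)
qed

section \<open>The fundamental lemma of the calculus of variations\<close>

lemma integral_indicator_limit:
  fixes h :: "'a \<Rightarrow> real"
  assumes h: "integrable M h" and A: "\<And>n. A n \<in> sets M" "B \<in> sets M"
    and lim: "\<And>x. (\<lambda>n. indicator (A n) x :: real) \<longlonglongrightarrow> indicator B x"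
    and 0: "\<And>n. (LINT x|M. indicator (A n) x * h x) = 0"
  shows "(LINT x|M. indicator B x * h x) = 0"
proof -
  note [measurable] = A borel_measurable_integrable[OF h]
  have "(\<lambda>n. LINT x|M. indicator (A n) x * h x) \<longlonglongrightarrow> (LINT x|M. indicator B x * h x)"
  proof (rule integral_dominated_convergence[where w="\<lambda>x. norm (h x)"])
    show "AE x in M. (\<lambda>n. indicator (A n) x * h x) \<longlonglongrightarrow> indicator B x * h x"
      by (intro AE_I2 tendsto_mult lim tendsto_const)
    show "AE x in M. norm (indicator (A n) x * h x) \<le> norm (h x)" for n
      by (intro AE_I2) (auto split: split_indicator)
  qed (use h in auto)
  then show ?thesis unfolding 0 by (simp add: LIMSEQ_const_iff)
qed

lemma sets_lebesgue_open: "open S \<Longrightarrow> S \<in> sets lebesgue"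
  by simp

text \<open>The integral of \<open>h\<close> vanishes over finite unions of balls, whose indicator functions are bounded
  limits of test functions; then over open sets, which are countable unions of balls; then over
  measurable sets, which differ from countable intersections of open sets by null sets. The sets
  where \<open>h \<ge> 0\<close> and \<open>h \<le> 0\<close> finish the proof.\<close>

lemma fundamental_lemma:
  fixes h :: "real^'n::finite \<Rightarrow> real"
  assumes open_\<Omega>: "open \<Omega>" and h: "integrable (lebesgue_on \<Omega>) h"
    and orth: "\<And>\<phi>. \<phi> \<in> test_functions \<Omega> \<Longrightarrow> (LINT x|lebesgue_on \<Omega>. h x * \<phi> x) = 0"
  shows "AE x in lebesgue_on \<Omega>. h x = 0"
proof -
  let ?M = "lebesgue_on \<Omega>"
  have \<Omega>: "\<Omega> \<in> sets lebesgue" using open_\<Omega> by simp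
  have sets_M: "A \<inter> \<Omega> \<in> sets ?M" if "A \<in> sets lebesgue" for A
    using that \<Omega> by (auto simp: sets_restrict_space)
  have space_M: "space ?M = \<Omega>" by (simp add: space_restrict_space)
  note [measurable] = borel_measurable_integrable[OF h]
  define Z where "Z A \<longleftrightarrow> (LINT x|?M. indicator A x * h x) = 0" for A
  have balls: "Z (\<Union>(c, r)\<in>I. ball c r)"
    if I: "finite I" "\<And>c r. (c, r) \<in> I \<Longrightarrow> r > 0 \<and> cball c r \<subseteq> \<Omega>" for I
  proof -
    have "\<exists>\<phi>. \<phi> \<in> test_functions \<Omega> \<and> (\<forall>x. \<phi> x \<ge> 0) \<and> (\<forall>x. \<phi> x > 0 \<longleftrightarrow> x \<in> ball (fst p) (snd p))" if "p \<in> I" for p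
    proof -
      have "snd p > 0" "cball (fst p) (snd p) \<subseteq> \<Omega>" using I(2)[of "fst p" "snd p"] that by auto
      from bump_exists[OF this] show ?thesis by metis
    qed
    then obtain \<beta> where \<beta>: "\<And>p. p \<in> I \<Longrightarrow> \<beta> p \<in> test_functions \<Omega>" "\<And>p x. p \<in> I \<Longrightarrow> \<beta> p x \<ge> 0"
      "\<And>p x. p \<in> I \<Longrightarrow> \<beta> p x > 0 \<longleftrightarrow> x \<in> ball (fst p) (snd p)" by metis
    define s where "s x = (\<Sum>p\<in>I. \<beta> p x)" for x
    have s: "s \<in> test_functions \<Omega>" unfolding s_def using I(1) \<beta>(1) by (rule test_functions_sum)
    have s0: "s x \<ge> 0" for x unfolding s_def using \<beta>(2) by (simp add: sum_nonneg)
    have s_pos: "s x > 0 \<longleftrightarrow> x \<in> (\<Union>(c, r)\<in>I. ball c r)" for x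
    proof -
      have "s x = 0 \<longleftrightarrow> (\<forall>p\<in>I. \<beta> p x = 0)" unfolding s_def using I(1) \<beta>(2) by (intro sum_nonneg_eq_0_iff) auto
      then have "s x > 0 \<longleftrightarrow> (\<exists>p\<in>I. \<beta> p x \<noteq> 0)" using s0[of x] by (auto simp: less_le)
      also have "\<dots> \<longleftrightarrow> (\<exists>p\<in>I. \<beta> p x > 0)" using \<beta>(2) by (metis less_le)
      also have "\<dots> \<longleftrightarrow> x \<in> (\<Union>(c, r)\<in>I. ball c r)" using \<beta>(3) by (auto simp: case_prod_beta)
      finally show ?thesis .
    qed
    define \<psi> where "\<psi> n x = 1 - exp (- (real n * s x))" for n x
    have \<psi>: "\<psi> n \<in> test_functions \<Omega>" for n
      unfolding \<psi>_def by (intro test_functions_one_minus_exp test_functions_cmult s)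
    have "(\<lambda>n. LINT x|?M. h x * \<psi> n x) \<longlonglongrightarrow> (LINT x|?M. h x * indicator (\<Union>(c, r)\<in>I. ball c r) x)"
    proof (rule integral_dominated_convergence[where w="\<lambda>x. norm (h x)"])
      have "\<psi> n \<in> borel_measurable borel" for n
        using test_functions_continuous[OF \<psi>] by (rule borel_measurable_continuous_onI)
      then have [measurable]: "\<psi> n \<in> borel_measurable ?M" for n
        by (intro measurable_restrict_space1 measurable_completion) simp
      show "(\<lambda>x. h x * \<psi> n x) \<in> borel_measurable ?M" for n by measurable
      have "open (\<Union>(c, r)\<in>I. ball c r)" by (auto simp: case_prod_beta)
      then have "(\<Union>(c, r)\<in>I. ball c r) \<inter> \<Omega> \<in> sets ?M" by (intro sets_M) simp
      then have "(\<lambda>x. h x * indicator ((\<Union>(c, r)\<in>I. ball c r) \<inter> \<Omega>) x) \<in> borel_measurable ?M" by measurable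
      then show "(\<lambda>x. h x * indicator (\<Union>(c, r)\<in>I. ball c r) x) \<in> borel_measurable ?M"
        by (rule measurable_cong[THEN iffD1, rotated]) (auto simp: space_M split: split_indicator)
      show "AE x in ?M. (\<lambda>n. h x * \<psi> n x) \<longlonglongrightarrow> h x * indicator (\<Union>(c, r)\<in>I. ball c r) x"
      proof (intro AE_I2 tendsto_mult tendsto_const)
        fix x
        show "(\<lambda>n. \<psi> n x) \<longlonglongrightarrow> indicator (\<Union>(c, r)\<in>I. ball c r) x"
        proof (cases "s x > 0")
          case True
          have "filterlim (\<lambda>n. real n * s x) at_top sequentially"
            using True by (intro filterlim_at_top_mult_tendsto_pos[OF tendsto_const] filterlim_real_sequentially)
          then have "(\<lambda>n. exp (- (real n * s x))) \<longlonglongrightarrow> 0"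
            by (intro filterlim_compose[OF exp_at_bot] filterlim_uminus_at_bot_at_top[THEN filterlim_compose])
          then have "(\<lambda>n. \<psi> n x) \<longlonglongrightarrow> 1 - 0" unfolding \<psi>_def by (intro tendsto_intros)
          then show ?thesis using True s_pos[of x] by simp
        next
          case False
          then have "s x = 0" "x \<notin> (\<Union>(c, r)\<in>I. ball c r)" using s0[of x] s_pos[of x] by auto
          then show ?thesis by (simp add: \<psi>_def)
        qed
      qed
      have "\<bar>\<psi> n x\<bar> \<le> 1" for n x using s0[of x] by (simp add: \<psi>_def)
      then show "AE x in ?M. norm (h x * \<psi> n x) \<le> norm (h x)" for n
        by (intro AE_I2) (simp add: abs_mult mult_left_le)
    qed (use h in auto)
    then have "(LINT x|?M. h x * indicator (\<Union>(c, r)\<in>I. ball c r) x) = 0"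
      using orth[OF \<psi>] by (simp add: LIMSEQ_const_iff)
    then show ?thesis by (simp add: Z_def mult.commute)
  qed
  have limit: "Z B" if "\<And>n. A n \<in> sets lebesgue" "B \<in> sets lebesgue" "\<And>n. Z (A n)"
    "\<And>x. x \<in> \<Omega> \<Longrightarrow> (\<lambda>n. indicator (A n) x :: real) \<longlonglongrightarrow> indicator B x" for A :: "nat \<Rightarrow> (real^'n) set" and B
  proof -
    have eq: "(LINT x|?M. indicator (A \<inter> \<Omega>) x * h x) = (LINT x|?M. indicator A x * h x)" for A
      by (intro Bochner_Integration.integral_cong) (auto simp: space_M split: split_indicator)
    have "(\<lambda>n. indicator (A n \<inter> \<Omega>) x :: real) \<longlonglongrightarrow> indicator (B \<inter> \<Omega>) x" for x
      using that(4)[of x] by (cases "x \<in> \<Omega>") (auto simp: indicator_inter_arith)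
    from integral_indicator_limit[OF h sets_M[OF that(1)] sets_M[OF that(2)] this] that(3)
    show ?thesis by (simp add: eq Z_def)
  qed
  have open_Z: "Z U" if U: "open U" "U \<subseteq> \<Omega>" for U
  proof (cases "U = {}")
    case True then show ?thesis by (simp add: Z_def)
  next
    case False
    define F where "F = {ball c r |c r. r > 0 \<and> cball c r \<subseteq> U}"
    have UF: "\<Union>F = U"
    proof
      show "U \<subseteq> \<Union>F"
      proof
        fix x assume "x \<in> U"
        then obtain r where "r > 0" "cball x r \<subseteq> U" using U(1) open_contains_cball by blast
        then show "x \<in> \<Union>F" unfolding F_def by (intro UnionI[of "ball x r"]) auto
      qed
      show "\<Union>F \<subseteq> U" unfolding F_def using ball_subset_cball by blast
    qed
    have "\<And>S. S \<in> F \<Longrightarrow> open S" by (auto simp: F_def)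
    then obtain F' where F': "F' \<subseteq> F" "countable F'" "\<Union>F' = \<Union>F" by (rule Lindelof)
    have "F' \<noteq> {}" using F'(3) UF False by auto
    then have e: "range (from_nat_into F') = F'" using F'(2) by (rule range_from_nat_into)
    define e where "e = from_nat_into F'"
    note e = e[folded e_def]
    have "\<exists>c r. e n = ball c r \<and> r > 0 \<and> cball c r \<subseteq> U" for n
      using e F'(1) unfolding F_def by blast
    then obtain c r where cr: "\<And>n. e n = ball (c n) (r n)" "\<And>n. r n > 0" "\<And>n. cball (c n) (r n) \<subseteq> U" by metis
    have Zn: "Z (\<Union>i<n. e i)" for n
    proof -
      have "(\<Union>(c, r)\<in>(\<lambda>i. (c i, r i)) ` {..<n}. ball c r) = (\<Union>i<n. e i)" using cr(1) by auto
      moreover have "Z (\<Union>(c, r)\<in>(\<lambda>i. (c i, r i)) ` {..<n}. ball c r)"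
      proof (rule balls)
        fix c' r' assume "(c', r') \<in> (\<lambda>i. (c i, r i)) ` {..<n}"
        then obtain i where "c' = c i" "r' = r i" by auto
        then show "r' > 0 \<and> cball c' r' \<subseteq> \<Omega>" using cr(2)[of i] subset_trans[OF cr(3) U(2), of i] by simp
      qed simp
      ultimately show ?thesis by simp
    qed
    have opn: "open (\<Union>i<n. e i)" for n using cr(1) by auto
    show ?thesis
    proof (rule limit[OF _ _ Zn])
      show "(\<lambda>n. indicator (\<Union>i<n. e i) x :: real) \<longlonglongrightarrow> indicator U x" for x
        using LIMSEQ_indicator_UN[of e x] e F'(3) UF by simp
      show "(\<Union>i<n. e i) \<in> sets lebesgue" for n using opn[of n] by (rule sets_lebesgue_open)
      show "U \<in> sets lebesgue" using U(1) by (rule sets_lebesgue_open)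
    qed
  qed
  have Z: "Z S" if S: "S \<in> sets lebesgue" "S \<subseteq> \<Omega>" for S
  proof -
    have "\<exists>T. open T \<and> S \<subseteq> T \<and> emeasure lebesgue (T - S) < ennreal (1 / real (Suc n))" for n
      using sets_lebesgue_outer_open[OF S(1), of "1 / real (Suc n)"] by (metis of_nat_0_less_iff zero_less_Suc zero_less_divide_1_iff)
    then obtain T where T: "\<And>n. open (T n)" "\<And>n. S \<subseteq> T n" "\<And>n. emeasure lebesgue (T n - S) < ennreal (1 / real (Suc n))"
      by metis
    define W where "W n = (\<Inter>i\<le>n. T i) \<inter> \<Omega>" for n
    define B where "B = (\<Inter>i. T i) \<inter> \<Omega>"
    have W: "open (W n)" "W n \<subseteq> \<Omega>" for n unfolding W_def using T(1) open_\<Omega> by auto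
    have B: "B \<in> sets lebesgue" unfolding B_def
      using T(1) \<Omega> by (intro sets.Int sets.countable_INT) auto
    have "Z B"
    proof (rule limit[of W])
      show "W n \<in> sets lebesgue" for n using W(1) by (rule sets_lebesgue_open)
      show "Z (W n)" for n using W open_Z by blast
      show "(\<lambda>n. indicator (W n) x :: real) \<longlonglongrightarrow> indicator B x" for x
      proof (cases "x \<in> B")
        case True
        then have "x \<in> W n" for n by (auto simp: W_def B_def)
        then show ?thesis using True by simp
      next
        case False
        show ?thesis
        proof (cases "x \<in> \<Omega>")
          case True
          then obtain N where "x \<notin> T N" using False by (auto simp: B_def)
          then have "x \<notin> W n" if "n \<ge> N" for n using that by (auto simp: W_def)
          then have "eventually (\<lambda>n. indicator (W n) x = (0::real)) sequentially"
            by (intro eventually_sequentiallyI[of N]) simp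
          then show ?thesis using False by (simp add: tendsto_eventually)
        qed (use False in \<open>simp add: W_def\<close>)
      qed
    qed (fact B)
    have "S \<subseteq> B" using T(2) S(2) by (auto simp: B_def)
    have "emeasure lebesgue (B - S) \<le> ennreal (1 / real (Suc n))" for n
    proof -
      have "emeasure lebesgue (B - S) \<le> emeasure lebesgue (T n - S)"
        using T(1)[of n] S(1) by (intro emeasure_mono) (auto simp: B_def)
      then show ?thesis using T(3)[of n] by simp
    qed
    moreover have "(\<lambda>n. ennreal (1 / real (Suc n))) \<longlonglongrightarrow> ennreal 0"
      by (intro tendsto_ennrealI LIMSEQ_Suc[OF lim_1_over_n])
    ultimately have "emeasure lebesgue (B - S) \<le> ennreal 0"
      by (intro LIMSEQ_le_const) auto
    then have "B - S \<in> null_sets lebesgue" using B S(1) by (auto simp: null_sets_def)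
    then have "AE x in lebesgue. x \<notin> B - S" by (rule AE_not_in)
    then have "AE x in ?M. x \<notin> B - S"
      using \<Omega> by (subst AE_restrict_space_iff) auto
    then have "AE x in ?M. indicator S x * h x = indicator B x * h x"
    proof eventually_elim
      case (elim x)
      then show ?case using \<open>S \<subseteq> B\<close> by (auto split: split_indicator)
    qed
    moreover have [measurable]: "S \<in> sets ?M" "B \<in> sets ?M"
      using sets_M[OF S(1)] sets_M[OF B] S(2) by (auto simp: Int_absorb2 B_def Int_assoc)
    ultimately have "(LINT x|?M. indicator S x * h x) = (LINT x|?M. indicator B x * h x)"
      by (intro integral_cong_AE) auto
    then show ?thesis using \<open>Z B\<close> by (simp add: Z_def)
  qed
  have part: "AE x in ?M. indicator S x * h x = 0" if S: "S \<in> sets ?M" and sgn: "(\<forall>x\<in>S. h x \<ge> 0) \<or> (\<forall>x\<in>S. h x \<le> 0)" for S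
  proof -
    have [measurable]: "S \<in> sets ?M" by fact
    have "S \<in> sets lebesgue" "S \<subseteq> \<Omega>" using S \<Omega> by (auto simp: sets_restrict_space)
    then have "Z S" by (rule Z)
    have int: "integrable ?M (\<lambda>x. indicator S x * h x)"
      using integrable_mult_indicator[OF S h] by simp
    show ?thesis using sgn
    proof
      assume "\<forall>x\<in>S. h x \<ge> 0"
      then have "AE x in ?M. 0 \<le> indicator S x * h x" by (intro AE_I2) (auto split: split_indicator)
      then show ?thesis using integral_nonneg_eq_0_iff_AE[OF int] \<open>Z S\<close> by (simp add: Z_def)
    next
      assume "\<forall>x\<in>S. h x \<le> 0"
      then have "AE x in ?M. 0 \<le> - (indicator S x * h x)" by (intro AE_I2) (auto split: split_indicator)
      then show ?thesis using integral_nonneg_eq_0_iff_AE[OF integrable_minus[OF int]] \<open>Z S\<close> by (simp add: Z_def)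
    qed
  qed
  have "{x \<in> space ?M. h x \<ge> 0} \<in> sets ?M" "{x \<in> space ?M. h x \<le> 0} \<in> sets ?M" by measurable
  then have "AE x in ?M. indicator {x \<in> space ?M. h x \<ge> 0} x * h x = 0" "AE x in ?M. indicator {x \<in> space ?M. h x \<le> 0} x * h x = 0"
    using part by auto
  then show ?thesis
  proof (rule AE_mp[OF AE_conjI], intro AE_I2 impI)
    fix x assume "x \<in> space ?M" "indicator {x \<in> space ?M. 0 \<le> h x} x * h x = 0 \<and> indicator {x \<in> space ?M. h x \<le> 0} x * h x = 0"
    then show "h x = 0" by (cases "h x \<ge> 0") auto
  qed
qed

section \<open>The space \<open>H\<^sub>0\<^sup>1\<close> of a bounded open set\<close>

locale bounded_open =
  fixes \<Omega> :: "(real^3) set"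
  assumes open_\<Omega>: "open \<Omega>" and bounded_\<Omega>: "bounded \<Omega>"
begin

abbreviation \<mu> :: "(real^3) measure" where "\<mu> \<equiv> lebesgue_on \<Omega>"

abbreviation test :: "(real^3 \<Rightarrow> real) set" where "test \<equiv> test_functions \<Omega>"

lemma \<Omega>_sets: "\<Omega> \<in> sets borel" "\<Omega> \<in> sets lborel" "\<Omega> \<in> sets lebesgue"
  using open_\<Omega> by simp_all

lemma space_\<mu>: "space \<mu> = \<Omega>"
  by (simp add: space_restrict_space)

lemma emeasure_\<Omega>_finite: "emeasure lborel \<Omega> < \<infinity>"
  using emeasure_bounded_finite[OF bounded_\<Omega>] by simp

lemma finite_measure_\<mu>: "finite_measure \<mu>"
proof
  show "emeasure \<mu> (space \<mu>) \<noteq> \<infinity>"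
    using emeasure_\<Omega>_finite \<Omega>_sets by (simp add: space_\<mu> emeasure_restrict_space)
qed

sublocale finite_measure \<mu> by (rule finite_measure_\<mu>)

lemma measurable_\<mu>: "f \<in> borel_measurable borel \<Longrightarrow> f \<in> borel_measurable \<mu>"
  by (intro measurable_restrict_space1 measurable_completion) simp

lemma nn_integral_\<mu>:
  assumes [measurable]: "f \<in> borel_measurable borel"
  shows "(\<integral>\<^sup>+x. f x \<partial>\<mu>) = (\<integral>\<^sup>+x. indicator \<Omega> x * f x \<partial>lborel)"
proof -
  have [measurable]: "\<Omega> \<in> sets borel" by (rule \<Omega>_sets)
  show ?thesis
    using \<Omega>_sets by (simp add: nn_integral_restrict_space nn_integral_completion mult.commute)
qed

lemma integral_\<mu>:
  fixes f :: "real^3 \<Rightarrow> real"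
  assumes [measurable]: "f \<in> borel_measurable borel" and 0: "\<And>x. x \<notin> \<Omega> \<Longrightarrow> f x = 0"
  shows "(LINT x|\<mu>. f x) = (LINT x|lborel. f x)"
proof -
  have "(\<lambda>x. indicator \<Omega> x *\<^sub>R f x) = f" using 0 by (auto simp: fun_eq_iff split: split_indicator)
  then show ?thesis
    using \<Omega>_sets by (simp add: integral_restrict_space integral_completion)
qed

lemma radius_exists: "\<exists>R. R \<ge> 0 \<and> \<Omega> \<subseteq> cball 0 R"
proof -
  obtain R where "\<Omega> \<subseteq> ball 0 R" using bounded_subset_ballD[OF bounded_\<Omega>, of 0] by auto
  then show ?thesis using ball_subset_cball[of 0 R] by (intro exI[of _ "max R 0"]) auto
qed

definition radius :: real where "radius = (SOME R. R \<ge> 0 \<and> \<Omega> \<subseteq> cball 0 R)"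

lemma radius: "radius \<ge> 0" "\<Omega> \<subseteq> cball 0 radius"
  using someI_ex[OF radius_exists] by (auto simp: radius_def)

lemma test_outside: "\<phi> \<in> test \<Longrightarrow> x \<notin> \<Omega> \<Longrightarrow> \<phi> x = 0" "\<phi> \<in> test \<Longrightarrow> x \<notin> \<Omega> \<Longrightarrow> grad \<phi> x = 0"
  by (metis test_functionsE subsetD)+

lemma test_C1:
  assumes "\<phi> \<in> test"
  shows "C1_compact_support \<phi> (grad \<phi>) radius"
proof
  have "x \<notin> \<Omega>" if "norm x > radius" for x using radius(2) that by force
  then show "\<phi> x = 0" "grad \<phi> x = 0" if "norm x > radius" for x using test_outside[OF assms] that by auto
qed (use assms in \<open>auto intro: test_functions_derivative test_functions_continuous_grad\<close>)

lemma test_measurable: "\<phi> \<in> test \<Longrightarrow> \<phi> \<in> borel_measurable borel" "\<phi> \<in> test \<Longrightarrow> grad \<phi> \<in> borel_measurable borel"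
  using C1_compact_support.measurable_phi C1_compact_support.measurable_g test_C1 by blast+

lemma test_grad_l2:
  assumes "\<phi> \<in> test"
  shows "sq_int \<mu> (grad \<phi>)" "(l2 \<mu> (grad \<phi>))\<^sup>2 = C1_compact_support.energy (grad \<phi>)"
proof -
  interpret C1_compact_support \<phi> "grad \<phi>" radius by (rule test_C1[OF assms])
  have "(\<integral>\<^sup>+x. ennreal ((norm (grad \<phi> x))\<^sup>2) \<partial>\<mu>) = (\<integral>\<^sup>+x. indicator \<Omega> x * ennreal ((norm (grad \<phi> x))\<^sup>2) \<partial>lborel)"
    by (rule nn_integral_\<mu>) measurable
  also have "\<dots> = (\<integral>\<^sup>+x. ennreal ((norm (grad \<phi> x))\<^sup>2) \<partial>lborel)"
    using test_outside(2)[OF assms] by (intro nn_integral_cong) (auto split: split_indicator)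
  also have "\<dots> = ennreal ((sqrt energy)\<^sup>2)" using energy_nonneg by (simp add: nn_energy)
  finally show "sq_int \<mu> (grad \<phi>)"
    using energy_nonneg by (intro sq_int_boundI(1)[where c="sqrt energy"] measurable_\<mu> test_measurable[OF assms]) auto
  show "(l2 \<mu> (grad \<phi>))\<^sup>2 = energy"
    unfolding l2_power2 energy_def using test_outside(2)[OF assms] by (intro integral_\<mu>) auto
qed

lemma test_poincare:
  assumes "\<phi> \<in> test"
  shows "sq_int \<mu> \<phi>" "l2 \<mu> \<phi> \<le> (2 * radius + 1) * l2 \<mu> (grad \<phi>)"
proof -
  interpret C1_compact_support \<phi> "grad \<phi>" radius by (rule test_C1[OF assms])
  have "(\<integral>\<^sup>+x. ennreal ((norm (\<phi> x))\<^sup>2) \<partial>\<mu>) = (\<integral>\<^sup>+x. indicator \<Omega> x * ennreal ((norm (\<phi> x))\<^sup>2) \<partial>lborel)"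
    by (rule nn_integral_\<mu>) measurable
  also have "\<dots> = (\<integral>\<^sup>+x. ennreal ((\<phi> x)\<^sup>2) \<partial>lborel)"
    using test_outside(1)[OF assms] by (intro nn_integral_cong) (auto split: split_indicator)
  also have "\<dots> \<le> ennreal (((2 * radius + 1) * l2 \<mu> (grad \<phi>))\<^sup>2)"
    using poincare[OF radius(1)] by (simp add: power_mult_distrib test_grad_l2(2)[OF assms])
  finally have "(\<integral>\<^sup>+x. ennreal ((norm (\<phi> x))\<^sup>2) \<partial>\<mu>) \<le> ennreal (((2 * radius + 1) * l2 \<mu> (grad \<phi>))\<^sup>2)" .
  from sq_int_boundI[OF measurable_\<mu>[OF test_measurable(1)[OF assms]] this]
  show "sq_int \<mu> \<phi>" "l2 \<mu> \<phi> \<le> (2 * radius + 1) * l2 \<mu> (grad \<phi>)"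
    using radius(1) l2_nonneg[of \<mu> "grad \<phi>"] by auto
qed

lemma sq_int_axis:
  fixes \<psi> :: "real^3 \<Rightarrow> real"
  assumes "sq_int \<mu> \<psi>"
  shows "sq_int \<mu> (\<lambda>x. \<psi> x *\<^sub>R axis i 1 :: real^3)"
  using assms by (auto simp: sq_int_def)

text \<open>By the product rule, the two integrands of the integration by parts add up to a component of the
  gradient of \<open>\<phi> \<psi>\<close>, which has integral \<open>0\<close>.\<close>

lemma test_weak_grad:
  assumes \<phi>: "\<phi> \<in> test"
  shows "is_weak_grad \<Omega> \<phi> (grad \<phi>)"
  unfolding is_weak_grad_def L2_iff
proof (intro conjI ballI allI test_grad_l2(1)[OF \<phi>])
  fix \<psi> i assume \<psi>: "\<psi> \<in> test"
  note [measurable] = test_measurable[OF \<phi>] test_measurable[OF \<psi>]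
  have pd: "partial_deriv i \<psi> x = grad \<psi> x \<bullet> axis i 1" for x by (simp add: grad_def inner_axis)
  note prod = test_functions_mult[OF \<phi> \<psi>]
  interpret C1_compact_support "\<lambda>x. \<phi> x * \<psi> x" "grad (\<lambda>x. \<phi> x * \<psi> x)" radius
    by (rule test_C1[OF prod(1)])
  have "(LINT x|\<mu>. grad (\<lambda>x. \<phi> x * \<psi> x) x \<bullet> axis i 1) = 0"
    using integral_gradient_zero[of "axis i 1"] test_outside(2)[OF prod(1)]
    by (subst integral_\<mu>) auto
  then have "(LINT x|\<mu>. \<phi> x * (grad \<psi> x \<bullet> axis i 1) + \<psi> x * (grad \<phi> x \<bullet> axis i 1)) = 0"
    unfolding prod(2) by (simp add: inner_add_left)
  moreover have "integrable \<mu> (\<lambda>x. grad \<psi> x \<bullet> (\<phi> x *\<^sub>R axis i 1))" "integrable \<mu> (\<lambda>x. grad \<phi> x \<bullet> (\<psi> x *\<^sub>R axis i 1))"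
    by (rule l2_Cauchy_Schwarz(1)[OF test_grad_l2(1)[OF \<psi>] sq_int_axis[OF test_poincare(1)[OF \<phi>]]],
        rule l2_Cauchy_Schwarz(1)[OF test_grad_l2(1)[OF \<phi>] sq_int_axis[OF test_poincare(1)[OF \<psi>]]])
  ultimately have "(LINT x|\<mu>. \<phi> x * (grad \<psi> x \<bullet> axis i 1)) + (LINT x|\<mu>. \<psi> x * (grad \<phi> x \<bullet> axis i 1)) = 0"
    by simp
  then show "(LINT x|\<mu>. \<phi> x * partial_deriv i \<psi> x) = - (LINT x|\<mu>. grad \<phi> x $ i * \<psi> x)"
    by (simp add: pd inner_axis mult.commute)
qed

lemma weak_grad_pairing:
  assumes "is_weak_grad \<Omega> u g" "\<psi> \<in> test"
  shows "(LINT x|\<mu>. u x \<bullet> (grad \<psi> x \<bullet> axis i 1)) = - (LINT x|\<mu>. g x \<bullet> (\<psi> x *\<^sub>R axis i 1))"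
  using assms by (simp add: is_weak_grad_def grad_def inner_axis mult.commute)

lemma is_weak_gradI:
  assumes "sq_int \<mu> g" "\<And>\<psi> i. \<psi> \<in> test \<Longrightarrow> (LINT x|\<mu>. u x \<bullet> (grad \<psi> x \<bullet> axis i 1)) = - (LINT x|\<mu>. g x \<bullet> (\<psi> x *\<^sub>R axis i 1))"
  shows "is_weak_grad \<Omega> u g"
  using assms by (simp add: is_weak_grad_def L2_iff grad_def inner_axis mult.commute)

lemma test_partial_sq_int: "\<psi> \<in> test \<Longrightarrow> sq_int \<mu> (\<lambda>x. grad \<psi> x \<bullet> axis i 1)"
proof (rule sq_int_boundI(1)[where c="l2 \<mu> (grad \<psi>)"])
  assume \<psi>: "\<psi> \<in> test"
  note [measurable] = measurable_\<mu>[OF test_measurable(2)[OF \<psi>]]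
  show "(\<lambda>x. grad \<psi> x \<bullet> axis i 1) \<in> borel_measurable \<mu>" by measurable
  have "(norm (grad \<psi> x \<bullet> axis i 1))\<^sup>2 \<le> (norm (grad \<psi> x))\<^sup>2" for x
    using Cauchy_Schwarz_ineq2[of "grad \<psi> x" "axis i 1"] by (intro power_mono) (auto simp: norm_axis_1)
  then have "(\<integral>\<^sup>+x. ennreal ((norm (grad \<psi> x \<bullet> axis i 1))\<^sup>2) \<partial>\<mu>) \<le> (\<integral>\<^sup>+x. ennreal ((norm (grad \<psi> x))\<^sup>2) \<partial>\<mu>)"
    by (intro nn_integral_mono ennreal_leI)
  then show "(\<integral>\<^sup>+x. ennreal ((norm (grad \<psi> x \<bullet> axis i 1))\<^sup>2) \<partial>\<mu>) \<le> ennreal ((l2 \<mu> (grad \<psi>))\<^sup>2)"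
    by (simp add: nn_l2[OF test_grad_l2(1)[OF \<psi>]])
qed (rule l2_nonneg)

lemma weak_grad_lincomb:
  assumes "is_weak_grad \<Omega> u g" "is_weak_grad \<Omega> v k" "sq_int \<mu> u" "sq_int \<mu> v"
  shows "is_weak_grad \<Omega> (\<lambda>x. u x + c * v x) (\<lambda>x. g x + c *\<^sub>R k x)"
proof (rule is_weak_gradI)
  have g: "sq_int \<mu> g" "sq_int \<mu> k" using assms by (auto simp: is_weak_grad_def L2_iff)
  then show "sq_int \<mu> (\<lambda>x. g x + c *\<^sub>R k x)" by (intro sq_int_add sq_int_scaleR)
  fix \<psi> i assume \<psi>: "\<psi> \<in> test"
  note A = l2_Cauchy_Schwarz(1)[OF _ test_partial_sq_int[OF \<psi>, of i]]
    l2_Cauchy_Schwarz(1)[OF _ sq_int_axis[OF test_poincare(1)[OF \<psi>], of i]]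
  show "(LINT x|\<mu>. (u x + c * v x) \<bullet> (grad \<psi> x \<bullet> axis i 1)) = - (LINT x|\<mu>. (g x + c *\<^sub>R k x) \<bullet> (\<psi> x *\<^sub>R axis i 1))"
    using weak_grad_pairing[OF assms(1) \<psi>, of i] weak_grad_pairing[OF assms(2) \<psi>, of i]
      A(1)[OF assms(3)] A(1)[OF assms(4)] A(2)[OF g(1)] A(2)[OF g(2)]
    by (simp add: inner_add_left algebra_simps)
qed

text \<open>This makes the choice in the definition of \<open>weak_grad\<close> harmless: every weak gradient that is
  found by other means agrees with it.\<close>

lemma weak_grad_unique:
  assumes "is_weak_grad \<Omega> u g" "is_weak_grad \<Omega> u k"
  shows "AE x in \<mu>. g x = k x"
proof -
  have g: "sq_int \<mu> g" "sq_int \<mu> k" using assms by (auto simp: is_weak_grad_def L2_iff)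
  have gk: "sq_int \<mu> (\<lambda>x. g x - k x)" using g by (rule sq_int_diff)
  have "AE x in \<mu>. (g x - k x) \<bullet> axis i 1 = 0" for i
  proof (rule fundamental_lemma[OF open_\<Omega>])
    have "sq_int \<mu> (\<lambda>x. axis i (1::real) :: real^3)" by (simp add: sq_int_def)
    with gk show "integrable \<mu> (\<lambda>x. (g x - k x) \<bullet> axis i 1)" by (rule l2_Cauchy_Schwarz(1))
    fix \<psi> assume \<psi>: "\<psi> \<in> test"
    note A = l2_Cauchy_Schwarz(1)[OF _ sq_int_axis[OF test_poincare(1)[OF \<psi>], of i]]
    have "(LINT x|\<mu>. g x \<bullet> (\<psi> x *\<^sub>R axis i 1)) = (LINT x|\<mu>. k x \<bullet> (\<psi> x *\<^sub>R axis i 1))"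
      using weak_grad_pairing[OF assms(1) \<psi>, of i] weak_grad_pairing[OF assms(2) \<psi>, of i] by simp
    then have "(LINT x|\<mu>. g x \<bullet> (\<psi> x *\<^sub>R axis i 1) - k x \<bullet> (\<psi> x *\<^sub>R axis i 1)) = 0"
      using A[OF g(1)] A[OF g(2)] by simp
    then show "(LINT x|\<mu>. ((g x - k x) \<bullet> axis i 1) * \<psi> x) = 0"
      by (simp add: inner_diff_left algebra_simps)
  qed
  then have "AE x in \<mu>. \<forall>i\<in>UNIV. (g x - k x) \<bullet> axis i 1 = 0" by (intro AE_finite_allI) auto
  then show ?thesis by eventually_elim (simp add: vec_eq_iff inner_axis)
qed

lemma weak_grad_AE: "is_weak_grad \<Omega> u g \<Longrightarrow> AE x in \<mu>. weak_grad \<Omega> u x = g x"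
  "is_weak_grad \<Omega> u g \<Longrightarrow> is_weak_grad \<Omega> u (weak_grad \<Omega> u)"
  unfolding weak_grad_def by (metis weak_grad_unique someI)+

text \<open>The closure of the graph of the gradient on test functions. It describes \<open>H\<^sub>0\<^sup>1\<close> without referring
  to a chosen weak gradient (\<open>approx_H01\<close>, \<open>H01_approx\<close>), so that closure properties can be proved
  with \<open>L\<^sup>2\<close> norms.\<close>

definition approx :: "(real^3 \<Rightarrow> real) \<Rightarrow> (real^3 \<Rightarrow> real^3) \<Rightarrow> bool" where
  "approx u g \<longleftrightarrow> sq_int \<mu> u \<and> sq_int \<mu> g \<and>
    (\<forall>e>0. \<exists>\<phi>\<in>test. l2 \<mu> (\<lambda>x. u x - \<phi> x) < e \<and> l2 \<mu> (\<lambda>x. g x - grad \<phi> x) < e)"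

lemma approxD: "approx u g \<Longrightarrow> sq_int \<mu> u" "approx u g \<Longrightarrow> sq_int \<mu> g"
  by (auto simp: approx_def)

lemma approxE:
  assumes "approx u g" "e > 0"
  obtains \<phi> where "\<phi> \<in> test" "l2 \<mu> (\<lambda>x. u x - \<phi> x) < e" "l2 \<mu> (\<lambda>x. g x - grad \<phi> x) < e"
  using assms unfolding approx_def by blast

lemma approx_test: "\<phi> \<in> test \<Longrightarrow> approx \<phi> (grad \<phi>)"
  unfolding approx_def using test_grad_l2(1) test_poincare(1) by (auto intro!: bexI[of _ \<phi>] simp: sq_int_zero)

lemma approx_lincomb:
  assumes "approx u g" "approx v k"
  shows "approx (\<lambda>x. u x + c * v x) (\<lambda>x. g x + c *\<^sub>R k x)"
  unfolding approx_def
proof (intro conjI allI impI)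
  note sq = approxD[OF assms(1)] approxD[OF assms(2)]
  have scv: "sq_int \<mu> (\<lambda>x. c * v x)" using sq_int_scaleR(1)[OF sq(3), of c] by simp
  show "sq_int \<mu> (\<lambda>x. u x + c * v x)" using sq(1) scv by (rule sq_int_add)
  show "sq_int \<mu> (\<lambda>x. g x + c *\<^sub>R k x)" using sq by (intro sq_int_add sq_int_scaleR)
  fix e :: real assume e: "e > 0"
  define d where "d = e / (1 + \<bar>c\<bar>)"
  have "1 + \<bar>c\<bar> > 0" by simp
  then have d: "d > 0" "d * (1 + \<bar>c\<bar>) = e" using e by (simp_all add: d_def)
  then have d: "d > 0" "d + \<bar>c\<bar> * d = e" by (simp_all add: algebra_simps)
  obtain \<phi> where \<phi>: "\<phi> \<in> test" "l2 \<mu> (\<lambda>x. u x - \<phi> x) < d" "l2 \<mu> (\<lambda>x. g x - grad \<phi> x) < d"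
    using approxE[OF assms(1) d(1)] by blast
  obtain \<psi> where \<psi>: "\<psi> \<in> test" "l2 \<mu> (\<lambda>x. v x - \<psi> x) < d" "l2 \<mu> (\<lambda>x. k x - grad \<psi> x) < d"
    using approxE[OF assms(2) d(1)] by blast
  note sqt = test_poincare(1)[OF \<phi>(1)] test_grad_l2(1)[OF \<phi>(1)] test_poincare(1)[OF \<psi>(1)] test_grad_l2(1)[OF \<psi>(1)]
  note c\<psi> = test_functions_cmult[OF \<psi>(1), of c]
  note s = test_functions_add[OF \<phi>(1) c\<psi>(1)]
  have "l2 \<mu> (\<lambda>x. (u x + c * v x) - (\<phi> x + c * \<psi> x)) = l2 \<mu> (\<lambda>x. (u x - \<phi> x) + c *\<^sub>R (v x - \<psi> x))"
    by (simp add: algebra_simps)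
  also have "\<dots> \<le> l2 \<mu> (\<lambda>x. u x - \<phi> x) + l2 \<mu> (\<lambda>x. c *\<^sub>R (v x - \<psi> x))"
    by (intro l2_triangle sq_int_scaleR sq_int_diff sq sqt)
  also have "\<dots> = l2 \<mu> (\<lambda>x. u x - \<phi> x) + \<bar>c\<bar> * l2 \<mu> (\<lambda>x. v x - \<psi> x)"
    by (subst sq_int_scaleR(2)[OF sq_int_diff[OF sq(3) sqt(3)]]) simp
  also have "\<dots> < e" unfolding d(2)[symmetric] using \<phi>(2) \<psi>(2) by (intro add_less_le_mono mult_left_mono) auto
  finally have 1: "l2 \<mu> (\<lambda>x. (u x + c * v x) - (\<phi> x + c * \<psi> x)) < e" .
  have "l2 \<mu> (\<lambda>x. (g x + c *\<^sub>R k x) - (grad \<phi> x + c *\<^sub>R grad \<psi> x)) = l2 \<mu> (\<lambda>x. (g x - grad \<phi> x) + c *\<^sub>R (k x - grad \<psi> x))"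
    by (simp add: algebra_simps)
  also have "\<dots> \<le> l2 \<mu> (\<lambda>x. g x - grad \<phi> x) + l2 \<mu> (\<lambda>x. c *\<^sub>R (k x - grad \<psi> x))"
    by (intro l2_triangle sq_int_scaleR sq_int_diff sq sqt)
  also have "\<dots> = l2 \<mu> (\<lambda>x. g x - grad \<phi> x) + \<bar>c\<bar> * l2 \<mu> (\<lambda>x. k x - grad \<psi> x)"
    by (subst sq_int_scaleR(2)[OF sq_int_diff[OF sq(4) sqt(4)]]) simp
  also have "\<dots> < e" unfolding d(2)[symmetric] using \<phi>(3) \<psi>(3) by (intro add_less_le_mono mult_left_mono) auto
  finally have 2: "l2 \<mu> (\<lambda>x. (g x + c *\<^sub>R k x) - (grad \<phi> x + c *\<^sub>R grad \<psi> x)) < e" .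
  show "\<exists>\<phi>\<in>test. l2 \<mu> (\<lambda>x. u x + c * v x - \<phi> x) < e \<and> l2 \<mu> (\<lambda>x. g x + c *\<^sub>R k x - grad \<phi> x) < e"
    by (rule bexI[OF _ s(1)]) (use 1 2 in \<open>simp add: s(2) c\<psi>(2)\<close>)
qed

lemma approx_closed:
  assumes "sq_int \<mu> u" "sq_int \<mu> g"
    and "\<And>e. e > 0 \<Longrightarrow> \<exists>v k. approx v k \<and> l2 \<mu> (\<lambda>x. u x - v x) < e \<and> l2 \<mu> (\<lambda>x. g x - k x) < e"
  shows "approx u g"
  unfolding approx_def
proof (intro conjI allI impI assms(1,2))
  fix e :: real assume e: "e > 0"
  then obtain v k where vk: "approx v k" "l2 \<mu> (\<lambda>x. u x - v x) < e / 2" "l2 \<mu> (\<lambda>x. g x - k x) < e / 2"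
    using assms(3)[of "e / 2"] by auto
  obtain \<phi> where \<phi>: "\<phi> \<in> test" "l2 \<mu> (\<lambda>x. v x - \<phi> x) < e / 2" "l2 \<mu> (\<lambda>x. k x - grad \<phi> x) < e / 2"
    using approxE[OF vk(1), of "e / 2"] e by auto
  have "l2 \<mu> (\<lambda>x. u x - \<phi> x) < e"
    using l2_triangle_diff[OF assms(1) approxD(1)[OF vk(1)] test_poincare(1)[OF \<phi>(1)]] vk(2) \<phi>(2) by linarith
  moreover have "l2 \<mu> (\<lambda>x. g x - grad \<phi> x) < e"
    using l2_triangle_diff[OF assms(2) approxD(2)[OF vk(1)] test_grad_l2(1)[OF \<phi>(1)]] vk(3) \<phi>(3) by linarith
  ultimately show "\<exists>\<phi>\<in>test. l2 \<mu> (\<lambda>x. u x - \<phi> x) < e \<and> l2 \<mu> (\<lambda>x. g x - grad \<phi> x) < e" using \<phi>(1) by blast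
qed

text \<open>The defining identity of weak gradients holds for test functions, and both of its sides are
  continuous in \<open>L\<^sup>2\<close>.\<close>

lemma approx_weak_grad:
  assumes "approx u g"
  shows "is_weak_grad \<Omega> u g"
proof (rule is_weak_gradI)
  note sq = approxD[OF assms]
  show "sq_int \<mu> g" by (rule sq)
  fix \<psi> i assume \<psi>: "\<psi> \<in> test"
  let ?p = "\<lambda>x. grad \<psi> x \<bullet> axis i 1" and ?q = "\<lambda>x. \<psi> x *\<^sub>R axis i (1::real) :: real^3"
  have pq: "sq_int \<mu> ?p" "sq_int \<mu> ?q" using test_partial_sq_int[OF \<psi>] sq_int_axis[OF test_poincare(1)[OF \<psi>]] by auto
  define S where "S = (LINT x|\<mu>. u x \<bullet> ?p x) + (LINT x|\<mu>. g x \<bullet> ?q x)"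
  define C where "C = l2 \<mu> ?p + l2 \<mu> ?q"
  have C: "C \<ge> 0" unfolding C_def by (simp add: l2_nonneg)
  have "\<bar>S\<bar> \<le> e * C" if e: "e > 0" for e
  proof -
    obtain \<phi> where \<phi>: "\<phi> \<in> test" "l2 \<mu> (\<lambda>x. u x - \<phi> x) < e" "l2 \<mu> (\<lambda>x. g x - grad \<phi> x) < e"
      using approxE[OF assms e] by blast
    note sqt = test_poincare(1)[OF \<phi>(1)] test_grad_l2(1)[OF \<phi>(1)]
    have "S = (LINT x|\<mu>. (u x - \<phi> x) \<bullet> ?p x) + (LINT x|\<mu>. (g x - grad \<phi> x) \<bullet> ?q x)"
    proof -
      have "(LINT x|\<mu>. (u x - \<phi> x) \<bullet> ?p x) = (LINT x|\<mu>. u x \<bullet> ?p x) - (LINT x|\<mu>. \<phi> x \<bullet> ?p x)"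
        unfolding inner_diff_left by (rule Bochner_Integration.integral_diff; rule l2_Cauchy_Schwarz(1)[OF _ pq(1)]; rule sq sqt)
      moreover have "(LINT x|\<mu>. (g x - grad \<phi> x) \<bullet> ?q x) = (LINT x|\<mu>. g x \<bullet> ?q x) - (LINT x|\<mu>. grad \<phi> x \<bullet> ?q x)"
        unfolding inner_diff_left by (rule Bochner_Integration.integral_diff; rule l2_Cauchy_Schwarz(1)[OF _ pq(2)]; rule sq sqt)
      ultimately show ?thesis
        using weak_grad_pairing[OF test_weak_grad[OF \<phi>(1)] \<psi>, of i] by (simp add: S_def)
    qed
    then have "\<bar>S\<bar> \<le> l2 \<mu> (\<lambda>x. u x - \<phi> x) * l2 \<mu> ?p + l2 \<mu> (\<lambda>x. g x - grad \<phi> x) * l2 \<mu> ?q"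
      using l2_Cauchy_Schwarz(2)[OF sq_int_diff[OF sq(1) sqt(1)] pq(1)] l2_Cauchy_Schwarz(2)[OF sq_int_diff[OF sq(2) sqt(2)] pq(2)]
      by linarith
    also have "\<dots> \<le> e * l2 \<mu> ?p + e * l2 \<mu> ?q"
      using \<phi> by (intro add_mono mult_right_mono l2_nonneg) auto
    finally show ?thesis by (simp add: C_def distrib_left)
  qed
  then have le: "\<bar>S\<bar> \<le> 0 + e" if "e > 0" for e
  proof -
    have "\<bar>S\<bar> \<le> e / (C + 1) * C" using \<open>\<And>e. e > 0 \<Longrightarrow> \<bar>S\<bar> \<le> e * C\<close>[of "e / (C + 1)"] that C by simp
    also have "\<dots> \<le> e" using that C by (simp add: field_simps)
    finally show ?thesis by simp
  qed
  have "\<bar>S\<bar> \<le> 0" by (rule field_le_epsilon) (use le in auto)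
  then show "(LINT x|\<mu>. u x \<bullet> ?p x) = - (LINT x|\<mu>. g x \<bullet> ?q x)" unfolding S_def by linarith
qed

lemma H1_norm_eq:
  assumes "is_weak_grad \<Omega> u g"
  shows "H1_norm \<Omega> u = sqrt ((l2 \<mu> u)\<^sup>2 + (l2 \<mu> g)\<^sup>2)" "H01_norm \<Omega> u = l2 \<mu> g"
proof -
  have m: "weak_grad \<Omega> u \<in> borel_measurable \<mu>" "g \<in> borel_measurable \<mu>"
    using weak_grad_AE(2)[OF assms] assms by (auto simp: is_weak_grad_def L2_def)
  have "l2 \<mu> (weak_grad \<Omega> u) = l2 \<mu> g" using weak_grad_AE(1)[OF assms] m by (rule l2_cong_AE)
  then show "H1_norm \<Omega> u = sqrt ((l2 \<mu> u)\<^sup>2 + (l2 \<mu> g)\<^sup>2)" "H01_norm \<Omega> u = l2 \<mu> g"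
    by (simp_all add: H1_norm_def H01_norm_def l2_def)
qed

lemma approx_H01:
  assumes "approx u g"
  shows "u \<in> H01 \<Omega>"
proof -
  note w = approx_weak_grad[OF assms] and sq = approxD[OF assms]
  have "\<exists>\<phi>\<in>test. H1_norm \<Omega> (\<lambda>x. u x - \<phi> x) < e" if e: "e > 0" for e
  proof -
    obtain \<phi> where \<phi>: "\<phi> \<in> test" "l2 \<mu> (\<lambda>x. u x - \<phi> x) < e / 2" "l2 \<mu> (\<lambda>x. g x - grad \<phi> x) < e / 2"
      using approxE[OF assms, of "e / 2"] e by auto
    have "is_weak_grad \<Omega> (\<lambda>x. u x - \<phi> x) (\<lambda>x. g x - grad \<phi> x)"
      using weak_grad_lincomb[OF w test_weak_grad[OF \<phi>(1)] sq(1) test_poincare(1)[OF \<phi>(1)], of "-1"] by simp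
    from H1_norm_eq(1)[OF this]
    have "H1_norm \<Omega> (\<lambda>x. u x - \<phi> x) \<le> l2 \<mu> (\<lambda>x. u x - \<phi> x) + l2 \<mu> (\<lambda>x. g x - grad \<phi> x)"
      using sqrt_add_le_add_sqrt[of "(l2 \<mu> (\<lambda>x. u x - \<phi> x))\<^sup>2" "(l2 \<mu> (\<lambda>x. g x - grad \<phi> x))\<^sup>2"] by (simp add: l2_nonneg)
    with \<phi> show ?thesis by (intro bexI[of _ \<phi>]) auto
  qed
  then show ?thesis using w sq by (auto simp: H01_def H1_def L2_iff)
qed

lemma H01_approx:
  assumes "u \<in> H01 \<Omega>"
  shows "approx u (weak_grad \<Omega> u)"
  unfolding approx_def
proof (intro conjI allI impI)
  have u: "u \<in> H1 \<Omega>" using assms by (simp add: H01_def)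
  then show sq: "sq_int \<mu> u" by (simp add: H1_def L2_iff)
  obtain g where g: "is_weak_grad \<Omega> u g" using u by (auto simp: H1_def)
  note w = weak_grad_AE(2)[OF g]
  then show "sq_int \<mu> (weak_grad \<Omega> u)" by (simp add: is_weak_grad_def L2_iff)
  fix e :: real assume "e > 0"
  then obtain \<phi> where \<phi>: "\<phi> \<in> test" "H1_norm \<Omega> (\<lambda>x. u x - \<phi> x) < e" using assms by (auto simp: H01_def)
  have "is_weak_grad \<Omega> (\<lambda>x. u x - \<phi> x) (\<lambda>x. weak_grad \<Omega> u x - grad \<phi> x)"
    using weak_grad_lincomb[OF w test_weak_grad[OF \<phi>(1)] sq test_poincare(1)[OF \<phi>(1)], of "-1"] by simp
  note n = H1_norm_eq(1)[OF this]
  have "l2 \<mu> (\<lambda>x. u x - \<phi> x) \<le> H1_norm \<Omega> (\<lambda>x. u x - \<phi> x)" unfolding n by (rule real_le_rsqrt) simp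
  moreover have "l2 \<mu> (\<lambda>x. weak_grad \<Omega> u x - grad \<phi> x) \<le> H1_norm \<Omega> (\<lambda>x. u x - \<phi> x)" unfolding n by (rule real_le_rsqrt) simp
  ultimately show "\<exists>\<phi>\<in>test. l2 \<mu> (\<lambda>x. u x - \<phi> x) < e \<and> l2 \<mu> (\<lambda>x. weak_grad \<Omega> u x - grad \<phi> x) < e"
    using \<phi> by (intro bexI[of _ \<phi>]) auto
qed

end

section \<open>Embeddings, compactness and absolute values in \<open>H\<^sub>0\<^sup>1\<close>\<close>

text \<open>The pointwise form of interpolation between \<open>L\<^sup>2\<close> and \<open>L\<^sup>p\<close>: beyond a threshold \<open>R\<close> the power
  \<open>t\<^sup>q\<close> is absorbed by a small multiple of \<open>t\<^sup>p\<close>, below it by a multiple of \<open>t\<^sup>2\<close>.\<close>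

lemma powr_interpolation:
  assumes q: "2 \<le> q" "q < p" and e: "e > (0::real)"
  obtains C where "C \<ge> 0" "\<And>t. t \<ge> 0 \<Longrightarrow> t powr q \<le> e * t powr p + C * t\<^sup>2"
proof
  define R where "R = e powr (- 1 / (p - q))"
  have R: "R > 0" using e by (simp add: R_def)
  have Re: "R powr (q - p) = e"
  proof -
    have "- 1 / (p - q) * (q - p) = 1" using q by (simp add: field_simps)
    then show ?thesis using e by (simp add: R_def powr_powr)
  qed
  show "R powr (q - 2) \<ge> 0" by simp
  fix t :: real assume t: "t \<ge> 0"
  show "t powr q \<le> e * t powr p + R powr (q - 2) * t\<^sup>2"
  proof (cases "t \<ge> R")
    case True
    then have "t powr (q - p) \<le> R powr (q - p)" using R q by (intro powr_mono2') auto
    then have "t powr (q - p) * t powr p \<le> e * t powr p" unfolding Re by (intro mult_right_mono) auto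
    moreover have "t powr q = t powr (q - p) * t powr p" by (simp flip: powr_add)
    ultimately show ?thesis by (simp add: add_increasing2)
  next
    case False
    show ?thesis
    proof (cases "t = 0")
      case False
      have "t powr (q - 2) * t powr 2 \<le> R powr (q - 2) * t\<^sup>2"
        using \<open>\<not> t \<ge> R\<close> t q False by (intro mult_mono powr_mono2) auto
      moreover have "t powr q = t powr (q - 2) * t powr 2" by (simp flip: powr_add)
      ultimately show ?thesis using e by (simp add: add_increasing)
    qed (use q in simp)
  qed
qed

context bounded_open begin

abbreviation H :: "(real^3 \<Rightarrow> real) set" where "H \<equiv> H01 \<Omega>"
abbreviation N :: "(real^3 \<Rightarrow> real) \<Rightarrow> real" where "N \<equiv> H01_norm \<Omega>"
abbreviation D :: "(real^3 \<Rightarrow> real) \<Rightarrow> real^3 \<Rightarrow> real^3" where "D \<equiv> weak_grad \<Omega>"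

definition ip :: "(real^3 \<Rightarrow> real) \<Rightarrow> (real^3 \<Rightarrow> real) \<Rightarrow> real" where
  "ip u v = (LINT x|\<mu>. D u x \<bullet> D v x)"

lemma H_sq_int: "u \<in> H \<Longrightarrow> sq_int \<mu> u" "u \<in> H \<Longrightarrow> sq_int \<mu> (D u)"
  using H01_approx approxD by blast+

lemma H_measurable: "u \<in> H \<Longrightarrow> u \<in> borel_measurable \<mu>"
  using H_sq_int(1) sq_int_measurable by blast

lemma approx_AE: "approx u g \<Longrightarrow> AE x in \<mu>. D u x = g x" "approx u g \<Longrightarrow> N u = l2 \<mu> g"
  using weak_grad_AE(1) H1_norm_eq(2) approx_weak_grad by blast+

lemma N_eq: "u \<in> H \<Longrightarrow> N u = l2 \<mu> (D u)"
  using approx_AE(2) H01_approx by blast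

lemma N_nonneg: "N u \<ge> 0"
  by (simp add: H01_norm_def)

lemma test_H: "\<phi> \<in> test \<Longrightarrow> \<phi> \<in> H" "\<phi> \<in> test \<Longrightarrow> N \<phi> = l2 \<mu> (grad \<phi>)"
  using approx_test approx_H01 approx_AE(2) by blast+

lemma H_lincomb:
  assumes "u \<in> H" "v \<in> H"
  shows "(\<lambda>x. u x + c * v x) \<in> H" "AE x in \<mu>. D (\<lambda>x. u x + c * v x) x = D u x + c *\<^sub>R D v x"
  using approx_lincomb[OF H01_approx[OF assms(1)] H01_approx[OF assms(2)], of c] approx_H01 approx_AE(1) by auto

lemma H_zero: "(\<lambda>x. 0) \<in> H"
  using test_H(1)[OF test_functions_0] .

lemma H_add: "u \<in> H \<Longrightarrow> v \<in> H \<Longrightarrow> (\<lambda>x. u x + v x) \<in> H"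
  using H_lincomb(1)[of u v 1] by simp

lemma H_diff: "u \<in> H \<Longrightarrow> v \<in> H \<Longrightarrow> (\<lambda>x. u x - v x) \<in> H"
  using H_lincomb(1)[of u v "-1"] by simp

lemma H_cmult: "u \<in> H \<Longrightarrow> (\<lambda>x. c * u x) \<in> H"
  using H_lincomb(1)[OF H_zero, of u c] by simp

lemma N_lincomb_eq:
  assumes "u \<in> H" "v \<in> H"
  shows "N (\<lambda>x. u x + c * v x) = l2 \<mu> (\<lambda>x. D u x + c *\<^sub>R D v x)"
  unfolding N_eq[OF H_lincomb(1)[OF assms]]
  using H_lincomb(2)[OF assms] H_sq_int(2)[OF H_lincomb(1)[OF assms]] H_sq_int(2)[OF assms(1)] H_sq_int(2)[OF assms(2)]
  by (intro l2_cong_AE) (auto simp: sq_int_def)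

lemma N_lincomb:
  assumes "u \<in> H" "v \<in> H"
  shows "(N (\<lambda>x. u x + c * v x))\<^sup>2 = (N u)\<^sup>2 + 2 * c * ip u v + c\<^sup>2 * (N v)\<^sup>2"
  using l2_add_power2[OF H_sq_int(2)[OF assms(1)] sq_int_scaleR(1)[OF H_sq_int(2)[OF assms(2)]], of c]
  by (simp add: N_lincomb_eq[OF assms] N_eq assms sq_int_scaleR(2)[OF H_sq_int(2)[OF assms(2)]] ip_def power_mult_distrib mult.assoc)

lemma ip_commute: "ip u v = ip v u"
  by (simp add: ip_def inner_commute)

lemma ip_self: "u \<in> H \<Longrightarrow> ip u u = (N u)\<^sup>2"
  by (simp add: ip_def N_eq l2_power2 power2_norm_eq_inner)

lemma ip_bound: "u \<in> H \<Longrightarrow> v \<in> H \<Longrightarrow> \<bar>ip u v\<bar> \<le> N u * N v"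
  unfolding ip_def using l2_Cauchy_Schwarz(2)[OF H_sq_int(2) H_sq_int(2), of u v] by (simp add: N_eq)

lemma ip_lincomb:
  assumes "u \<in> H" "v \<in> H" "w \<in> H"
  shows "ip (\<lambda>x. u x + c * v x) w = ip u w + c * ip v w"
proof -
  note m = sq_int_measurable[OF H_sq_int(2)]
  have "ip (\<lambda>x. u x + c * v x) w = (LINT x|\<mu>. (D u x + c *\<^sub>R D v x) \<bullet> D w x)"
    unfolding ip_def
  proof (rule integral_cong_AE)
    show "AE x in \<mu>. D (\<lambda>x. u x + c * v x) x \<bullet> D w x = (D u x + c *\<^sub>R D v x) \<bullet> D w x"
      using H_lincomb(2)[OF assms(1,2), of c] by eventually_elim simp
  qed (use m[OF assms(1)] m[OF assms(2)] m[OF assms(3)] m[OF H_lincomb(1)[OF assms(1,2)]] in auto)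
  also have "\<dots> = ip u w + c * ip v w"
    using l2_Cauchy_Schwarz(1)[OF H_sq_int(2)[OF assms(1)] H_sq_int(2)[OF assms(3)]]
      l2_Cauchy_Schwarz(1)[OF H_sq_int(2)[OF assms(2)] H_sq_int(2)[OF assms(3)]]
    by (simp add: ip_def inner_add_left)
  finally show ?thesis .
qed

lemma N_zero: "N (\<lambda>x. 0) = 0"
proof -
  have "grad (\<lambda>x::real^3. 0) = (\<lambda>x. 0)" using grad_unique[of "\<lambda>x::real^3. 0" 0] by (simp add: fun_eq_iff)
  then show ?thesis using test_H(2)[OF test_functions_0] by (simp add: sq_int_zero)
qed

lemma N_cmult: "u \<in> H \<Longrightarrow> N (\<lambda>x. c * u x) = \<bar>c\<bar> * N u"
proof -
  assume u: "u \<in> H"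
  have "ip (\<lambda>x. 0) u = 0" using ip_bound[OF H_zero u] by (simp add: N_zero)
  then have "(N (\<lambda>x. c * u x))\<^sup>2 = (\<bar>c\<bar> * N u)\<^sup>2"
    using N_lincomb[OF H_zero u, of c] by (simp add: N_zero power_mult_distrib)
  then show ?thesis by (simp add: N_nonneg)
qed

lemma N_triangle: "u \<in> H \<Longrightarrow> v \<in> H \<Longrightarrow> N (\<lambda>x. u x + v x) \<le> N u + N v"
  using N_lincomb_eq[of u v 1] l2_triangle[OF H_sq_int(2) H_sq_int(2)] by (simp add: N_eq)

lemma N_diff_triangle: "u \<in> H \<Longrightarrow> v \<in> H \<Longrightarrow> N (\<lambda>x. u x - v x) \<le> N u + N v"
  using N_triangle[of u "\<lambda>x. -1 * v x"] H_cmult[of v "-1"] N_cmult[of v "-1"] by simp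

lemma N_diff_eq: "u \<in> H \<Longrightarrow> v \<in> H \<Longrightarrow> N (\<lambda>x. u x - v x) = l2 \<mu> (\<lambda>x. D u x - D v x)"
  using N_lincomb_eq[of u v "-1"] by simp

lemma H_approx_seq:
  assumes "u \<in> H"
  obtains \<phi> where "\<And>n::nat. \<phi> n \<in> test" "(\<lambda>n. l2 \<mu> (\<lambda>x. \<phi> n x - u x)) \<longlonglongrightarrow> 0" "\<And>n. N (\<phi> n) \<le> N u + 1 / real (Suc n)"
proof -
  have ex: "\<exists>\<phi>. \<phi> \<in> test \<and> l2 \<mu> (\<lambda>x. u x - \<phi> x) < 1 / real (Suc n) \<and> l2 \<mu> (\<lambda>x. D u x - grad \<phi> x) < 1 / real (Suc n)" for n
  proof -
    have "1 / real (Suc n) > 0" by simp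
    from approxE[OF H01_approx[OF assms] this] show ?thesis by blast
  qed
  obtain \<phi> where "\<forall>n. \<phi> n \<in> test \<and> l2 \<mu> (\<lambda>x. u x - \<phi> n x) < 1 / real (Suc n) \<and> l2 \<mu> (\<lambda>x. D u x - grad (\<phi> n) x) < 1 / real (Suc n)"
    using choice[OF allI[OF ex]] ..
  then have \<phi>: "\<And>n. \<phi> n \<in> test" "\<And>n. l2 \<mu> (\<lambda>x. u x - \<phi> n x) < 1 / real (Suc n)"
    "\<And>n. l2 \<mu> (\<lambda>x. D u x - grad (\<phi> n) x) < 1 / real (Suc n)" by blast+
  show ?thesis
  proof (rule that[OF \<phi>(1)])
    show "(\<lambda>n. l2 \<mu> (\<lambda>x. \<phi> n x - u x)) \<longlonglongrightarrow> 0"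
    proof (rule tendsto_sandwich[OF _ _ tendsto_const LIMSEQ_Suc[OF lim_1_over_n]])
      show "\<forall>\<^sub>F n in sequentially. l2 \<mu> (\<lambda>x. \<phi> n x - u x) \<le> 1 / real (Suc n)"
        using less_imp_le[OF \<phi>(2)] by (simp add: l2_minus[of _ "\<phi> _"])
    qed (simp add: l2_nonneg)
    show "N (\<phi> n) \<le> N u + 1 / real (Suc n)" for n
    proof -
      have "l2 \<mu> (\<lambda>x. grad (\<phi> n) x) \<le> l2 \<mu> (\<lambda>x. grad (\<phi> n) x - D u x) + l2 \<mu> (D u)"
        using l2_triangle[OF sq_int_diff[OF test_grad_l2(1)[OF \<phi>(1)] H_sq_int(2)[OF assms]] H_sq_int(2)[OF assms]] by simp
      also have "l2 \<mu> (\<lambda>x. grad (\<phi> n) x - D u x) = l2 \<mu> (\<lambda>x. D u x - grad (\<phi> n) x)" by (rule l2_minus)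
      finally show ?thesis using \<phi>(3)[of n] by (simp add: test_H(2)[OF \<phi>(1)] N_eq[OF assms])
    qed
  qed
qed

lemma poincare_H:
  assumes "u \<in> H"
  shows "l2 \<mu> u \<le> (2 * radius + 1) * N u"
proof -
  obtain \<phi> where \<phi>: "\<And>n::nat. \<phi> n \<in> test" "(\<lambda>n. l2 \<mu> (\<lambda>x. \<phi> n x - u x)) \<longlonglongrightarrow> 0" "\<And>n. N (\<phi> n) \<le> N u + 1 / real (Suc n)"
    by (rule H_approx_seq[OF assms]) (rule that)
  have "l2 \<mu> u \<le> l2 \<mu> (\<lambda>x. \<phi> n x - u x) + (2 * radius + 1) * (N u + 1 / real (Suc n))" for n
  proof -
    have "l2 \<mu> u \<le> l2 \<mu> (\<lambda>x. u x - \<phi> n x) + l2 \<mu> (\<phi> n)"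
      using l2_triangle[OF sq_int_diff[OF H_sq_int(1)[OF assms] test_poincare(1)[OF \<phi>(1)[of n]]] test_poincare(1)[OF \<phi>(1)[of n]]] by simp
    also have "l2 \<mu> (\<phi> n) \<le> (2 * radius + 1) * N (\<phi> n)"
      using test_poincare(2)[OF \<phi>(1)] by (simp add: test_H(2)[OF \<phi>(1)])
    also have "\<dots> \<le> (2 * radius + 1) * (N u + 1 / real (Suc n))"
      using \<phi>(3)[of n] radius(1) by (intro mult_left_mono) auto
    finally show ?thesis by (simp add: l2_minus[of _ u])
  qed
  moreover have "(\<lambda>n. l2 \<mu> (\<lambda>x. \<phi> n x - u x) + (2 * radius + 1) * (N u + 1 / real (Suc n))) \<longlonglongrightarrow> 0 + (2 * radius + 1) * (N u + 0)"
    by (intro tendsto_intros \<phi>(2) LIMSEQ_Suc[OF lim_1_over_n])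
  ultimately show ?thesis using LIMSEQ_le_const by fastforce
qed

lemma N_eq_0_iff:
  assumes "u \<in> H"
  shows "N u = 0 \<longleftrightarrow> (AE x in \<mu>. u x = 0)"
proof
  assume "N u = 0"
  then have "l2 \<mu> u = 0" using poincare_H[OF assms] l2_nonneg[of \<mu> u] by simp
  then show "AE x in \<mu>. u x = 0" using l2_eq_0_iff[OF H_sq_int(1)[OF assms]] by simp
next
  assume 0: "AE x in \<mu>. u x = 0"
  have "is_weak_grad \<Omega> u (\<lambda>x. 0)"
  proof (rule is_weak_gradI)
    fix \<psi> i assume \<psi>: "\<psi> \<in> test"
    note [measurable] = H_measurable[OF assms] measurable_\<mu>[OF test_measurable(2)[OF \<psi>]]
    have "(LINT x|\<mu>. u x \<bullet> (grad \<psi> x \<bullet> axis i 1)) = (LINT x|\<mu>. 0)"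
      using 0 by (intro integral_cong_AE) (auto elim: eventually_mono)
    then show "(LINT x|\<mu>. u x \<bullet> (grad \<psi> x \<bullet> axis i 1)) = - (LINT x|\<mu>. 0 \<bullet> (\<psi> x *\<^sub>R axis i 1))" by simp
  qed (rule sq_int_zero)
  then show "N u = 0" by (simp add: H1_norm_eq(2) sq_int_zero)
qed

lemma nontrivial_iff: "u \<in> H \<Longrightarrow> nontrivial_on \<Omega> u \<longleftrightarrow> N u > 0"
  unfolding nontrivial_on_def using N_eq_0_iff N_nonneg[of u] by (auto simp: less_le)

lemma nontrivial_exists:
  assumes "\<Omega> \<noteq> {}"
  obtains u where "u \<in> H" "N u = 1"
proof -
  obtain c where c: "c \<in> \<Omega>" using assms by auto
  obtain r where r: "r > 0" "cball c r \<subseteq> \<Omega>" using open_\<Omega> c open_contains_cball by blast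
  obtain \<phi> where \<phi>: "\<phi> \<in> test" "\<And>x. \<phi> x \<ge> 0" "\<And>x. \<phi> x > 0 \<longleftrightarrow> x \<in> ball c r"
    by (rule bump_exists[OF r]) (rule that)
  have "N \<phi> \<noteq> 0"
  proof
    assume "N \<phi> = 0"
    then have "AE x in \<mu>. \<phi> x = 0" using N_eq_0_iff test_H(1)[OF \<phi>(1)] by blast
    then have "AE x in lebesgue. x \<in> \<Omega> \<longrightarrow> \<phi> x = 0"
      using \<Omega>_sets by (simp add: AE_restrict_space_iff)
    then have "AE x in lborel. x \<in> \<Omega> \<longrightarrow> \<phi> x = 0" by (simp add: AE_completion_iff)
    then have "AE x in lborel. x \<notin> ball c r"
    proof eventually_elim
      case (elim x)
      have "x \<in> \<Omega>" if "x \<in> ball c r" using that r(2) ball_subset_cball by blast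
      then show ?case using elim \<phi>(3)[of x] by auto
    qed
    then have "emeasure lborel (ball c r) = 0" by (subst (asm) AE_iff_measurable[where N="ball c r"]) auto
    then have "measure lborel (ball c r) = 0" by (simp add: measure_def)
    then show False using content_ball_pos[OF r(1), of c] by simp
  qed
  then have "N (\<lambda>x. 1 / N \<phi> * \<phi> x) = 1"
    using N_cmult[OF test_H(1)[OF \<phi>(1)], of "1 / N \<phi>"] N_nonneg[of \<phi>] by simp
  then show ?thesis using that H_cmult[OF test_H(1)[OF \<phi>(1)]] by blast
qed

text \<open>The bound for test functions passes to the limit by Fatou's lemma along a subsequence that
  converges almost everywhere.\<close>

lemma sobolev_H:
  assumes q: "0 < q" "q < 6"
  obtains C where "C \<ge> 0" "\<And>u a. u \<in> H \<Longrightarrow> a > 0 \<Longrightarrow> N u \<le> a \<Longrightarrow> integrable \<mu> (\<lambda>x. \<bar>u x\<bar> powr q)"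
    "\<And>u a. u \<in> H \<Longrightarrow> a > 0 \<Longrightarrow> N u \<le> a \<Longrightarrow> (LINT x|\<mu>. \<bar>u x\<bar> powr q) \<le> C * a powr q"
proof -
  have dim: "DIM(real^3) = 3" by simp
  obtain K where K: "K \<ge> 0" "\<And>\<phi> g R (S::(real^3) set) a. C1_compact_support \<phi> g R \<Longrightarrow> C1_compact_support.energy g \<le> a\<^sup>2 \<Longrightarrow> a > 0
    \<Longrightarrow> S \<in> sets borel \<Longrightarrow> (\<integral>\<^sup>+x. indicator S x * ennreal (\<bar>\<phi> x\<bar> powr q) \<partial>lborel) \<le> (emeasure lborel S + ennreal K) * ennreal (a powr q)"
    by (rule sobolev[OF dim q]) (rule that)
  define C where "C = (measure lborel \<Omega> + K) * 2 powr q"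
  have C: "C \<ge> 0" using K(1) by (simp add: C_def)
  have nn: "(\<integral>\<^sup>+x. ennreal (\<bar>u x\<bar> powr q) \<partial>\<mu>) \<le> ennreal (C * a powr q)" if u: "u \<in> H" "a > 0" "N u \<le> a" for u a
  proof -
    obtain \<phi> where \<phi>: "\<And>n::nat. \<phi> n \<in> test" "(\<lambda>n. l2 \<mu> (\<lambda>x. \<phi> n x - u x)) \<longlonglongrightarrow> 0" "\<And>n. N (\<phi> n) \<le> N u + 1 / real (Suc n)"
      by (rule H_approx_seq[OF u(1)]) (rule that)
    obtain r :: "nat \<Rightarrow> nat" where r: "strict_mono r" "AE x in \<mu>. (\<lambda>n. \<phi> (r n) x) \<longlonglongrightarrow> u x"
      by (rule l2_AE_subseq[OF test_poincare(1)[OF \<phi>(1)] H_sq_int(1)[OF u(1)] \<phi>(2)]) (rule that)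
    note [measurable] = measurable_\<mu>[OF test_measurable(1)[OF \<phi>(1)]] test_measurable(1)[OF \<phi>(1)]
    have "(\<integral>\<^sup>+x. ennreal (\<bar>u x\<bar> powr q) \<partial>\<mu>) \<le> (\<integral>\<^sup>+x. liminf (\<lambda>n. ennreal (\<bar>\<phi> (r n) x\<bar> powr q)) \<partial>\<mu>)"
    proof (rule nn_integral_mono_AE)
      show "AE x in \<mu>. ennreal (\<bar>u x\<bar> powr q) \<le> liminf (\<lambda>n. ennreal (\<bar>\<phi> (r n) x\<bar> powr q))"
        using r(2)
      proof eventually_elim
        case (elim x)
        have "(\<lambda>n. ennreal (\<bar>\<phi> (r n) x\<bar> powr q)) \<longlonglongrightarrow> ennreal (\<bar>u x\<bar> powr q)"
          using q(1) by (intro tendsto_ennrealI tendsto_powr' tendsto_rabs elim tendsto_const) auto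
        then have "liminf (\<lambda>n. ennreal (\<bar>\<phi> (r n) x\<bar> powr q)) = ennreal (\<bar>u x\<bar> powr q)"
          by (rule lim_imp_Liminf[OF sequentially_bot])
        then show ?case by simp
      qed
    qed
    also have "\<dots> \<le> liminf (\<lambda>n. \<integral>\<^sup>+x. ennreal (\<bar>\<phi> (r n) x\<bar> powr q) \<partial>\<mu>)"
      by (rule nn_integral_liminf) measurable
    also have "\<dots> \<le> liminf (\<lambda>n. ennreal (C * a powr q))"
    proof (intro Liminf_mono)
      \<comment> \<open>From \<open>n0\<close> on the approximating test functions have norm at most \<open>2 a\<close>.\<close>
      obtain n0 where n0: "1 / real (Suc n0) \<le> a" using reals_Archimedean[OF u(2)] by (auto simp: inverse_eq_divide intro: less_imp_le)
      have "(\<integral>\<^sup>+x. ennreal (\<bar>\<phi> (r n) x\<bar> powr q) \<partial>\<mu>) \<le> ennreal (C * a powr q)" if n: "n \<ge> n0" for n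
      proof -
        have "r n \<ge> n0" using n seq_suble[OF r(1), of n] by simp
        then have "1 / real (Suc (r n)) \<le> 1 / real (Suc n0)" by (intro divide_left_mono) auto
        then have "N (\<phi> (r n)) \<le> 2 * a" using \<phi>(3)[of "r n"] n0 u(3) by linarith
        then have "(N (\<phi> (r n)))\<^sup>2 \<le> (2 * a)\<^sup>2" by (intro power_mono N_nonneg)
        then have E: "C1_compact_support.energy (grad (\<phi> (r n))) \<le> (2 * a)\<^sup>2"
          by (simp add: test_H(2)[OF \<phi>(1)] test_grad_l2(2)[OF \<phi>(1)])
        have "(\<integral>\<^sup>+x. ennreal (\<bar>\<phi> (r n) x\<bar> powr q) \<partial>\<mu>) = (\<integral>\<^sup>+x. indicator \<Omega> x * ennreal (\<bar>\<phi> (r n) x\<bar> powr q) \<partial>lborel)"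
          by (rule nn_integral_\<mu>) measurable
        also have "\<dots> \<le> (emeasure lborel \<Omega> + ennreal K) * ennreal ((2 * a) powr q)"
          using u(2) by (intro K(2)[OF test_C1[OF \<phi>(1)] E] \<Omega>_sets) auto
        also have "emeasure lborel \<Omega> = ennreal (measure lborel \<Omega>)"
          using emeasure_\<Omega>_finite by (intro emeasure_eq_ennreal_measure) auto
        also have "(ennreal (measure lborel \<Omega>) + ennreal K) * ennreal ((2 * a) powr q) = ennreal (C * a powr q)"
          using K(1) u(2) by (simp add: C_def powr_mult mult.assoc flip: ennreal_mult ennreal_plus)
        finally show ?thesis .
      qed
      then show "\<forall>\<^sub>F n in sequentially. (\<integral>\<^sup>+x. ennreal (\<bar>\<phi> (r n) x\<bar> powr q) \<partial>\<mu>) \<le> ennreal (C * a powr q)"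
        by (auto simp: eventually_sequentially)
    qed
    also have "\<dots> = ennreal (C * a powr q)" by (simp add: Liminf_const)
    finally show ?thesis .
  qed
  have int: "integrable \<mu> (\<lambda>x. \<bar>u x\<bar> powr q)" if u: "u \<in> H" "a > 0" "N u \<le> a" for u a
  proof (rule integrableI_nonneg)
    note [measurable] = H_measurable[OF u(1)]
    show "(\<lambda>x. \<bar>u x\<bar> powr q) \<in> borel_measurable \<mu>" by measurable
    show "(\<integral>\<^sup>+x. ennreal (\<bar>u x\<bar> powr q) \<partial>\<mu>) < \<infinity>" using nn[OF u] by (simp add: le_less_trans)
  qed simp
  show ?thesis
  proof (rule that[OF C int])
    fix u a assume u: "u \<in> H" "a > 0" "N u \<le> a"
    have "ennreal (LINT x|\<mu>. \<bar>u x\<bar> powr q) \<le> ennreal (C * a powr q)"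
      using nn[OF u] by (subst nn_integral_eq_integral[OF int[OF u], symmetric]) auto
    then show "(LINT x|\<mu>. \<bar>u x\<bar> powr q) \<le> C * a powr q" using C by simp
  qed
qed

lemma rellich_H:
  assumes u: "\<And>n::nat. u n \<in> H" "\<And>n. N (u n) \<le> a"
  obtains r :: "nat \<Rightarrow> nat" and v where "strict_mono r" "sq_int \<mu> v" "(\<lambda>n. l2 \<mu> (\<lambda>x. u (r n) x - v x)) \<longlonglongrightarrow> 0"
proof -
  have ex: "\<exists>\<phi>. \<phi> \<in> test \<and> l2 \<mu> (\<lambda>x. u n x - \<phi> x) < 1 / real (Suc n) \<and> N \<phi> \<le> a + 1" for n
  proof -
    obtain \<phi> where \<phi>: "\<And>n::nat. \<phi> n \<in> test" "(\<lambda>k. l2 \<mu> (\<lambda>x. \<phi> k x - u n x)) \<longlonglongrightarrow> 0" "\<And>k. N (\<phi> k) \<le> N (u n) + 1 / real (Suc k)"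
      by (rule H_approx_seq[OF u(1)]) (rule that)
    have "eventually (\<lambda>k. l2 \<mu> (\<lambda>x. \<phi> k x - u n x) < 1 / real (Suc n)) sequentially"
      using \<phi>(2) by (rule order_tendstoD) simp
    then obtain k where "l2 \<mu> (\<lambda>x. \<phi> k x - u n x) < 1 / real (Suc n)" by (auto simp: eventually_sequentially)
    moreover have "1 / real (Suc k) \<le> 1" by simp
    then have "N (\<phi> k) \<le> a + 1" using \<phi>(3)[of k] u(2)[of n] by linarith
    ultimately show ?thesis using \<phi>(1)[of k] by (auto simp: l2_minus[of _ "u n"])
  qed
  obtain \<phi> where "\<forall>n. \<phi> n \<in> test \<and> l2 \<mu> (\<lambda>x. u n x - \<phi> n x) < 1 / real (Suc n) \<and> N (\<phi> n) \<le> a + 1"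
    using choice[OF allI[OF ex]] ..
  then have \<phi>: "\<And>n. \<phi> n \<in> test" "\<And>n. l2 \<mu> (\<lambda>x. u n x - \<phi> n x) < 1 / real (Suc n)" "\<And>n. N (\<phi> n) \<le> a + 1"
    by blast+
  have E: "C1_compact_support.energy (grad (\<phi> n)) \<le> (a + 1)\<^sup>2" for n
    using power_mono[OF \<phi>(3)[of n] N_nonneg, of 2] by (simp add: test_H(2)[OF \<phi>(1)] test_grad_l2(2)[OF \<phi>(1)])
  have dim: "DIM(real^3) = 3" by simp
  obtain r :: "nat \<Rightarrow> nat" where r: "strict_mono r"
    "\<And>e. e > 0 \<Longrightarrow> \<exists>N. \<forall>m\<ge>N. \<forall>n\<ge>N. (\<integral>\<^sup>+x. ennreal ((\<phi> (r m) x - \<phi> (r n) x)\<^sup>2) \<partial>lborel) \<le> ennreal e"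
    by (rule rellich[OF dim test_C1[OF \<phi>(1)] E]) (rule that)
  have Cau: "\<exists>N. \<forall>m\<ge>N. \<forall>n\<ge>N. l2 \<mu> (\<lambda>x. \<phi> (r m) x - \<phi> (r n) x) < e" if e: "e > 0" for e
  proof -
    obtain K where K: "\<And>m n. m \<ge> K \<Longrightarrow> n \<ge> K \<Longrightarrow> (\<integral>\<^sup>+x. ennreal ((\<phi> (r m) x - \<phi> (r n) x)\<^sup>2) \<partial>lborel) \<le> ennreal ((e / 2)\<^sup>2)"
    proof -
      have "(e / 2)\<^sup>2 > 0" using e by simp
      from r(2)[OF this] show ?thesis using that by blast
    qed
    have "l2 \<mu> (\<lambda>x. \<phi> (r m) x - \<phi> (r n) x) < e" if mn: "m \<ge> K" "n \<ge> K" for m n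
    proof -
      note [measurable] = test_measurable(1)[OF \<phi>(1)]
      have "(\<integral>\<^sup>+x. ennreal ((norm (\<phi> (r m) x - \<phi> (r n) x))\<^sup>2) \<partial>\<mu>) = (\<integral>\<^sup>+x. indicator \<Omega> x * ennreal ((norm (\<phi> (r m) x - \<phi> (r n) x))\<^sup>2) \<partial>lborel)"
        by (rule nn_integral_\<mu>) measurable
      also have "\<dots> \<le> (\<integral>\<^sup>+x. ennreal ((\<phi> (r m) x - \<phi> (r n) x)\<^sup>2) \<partial>lborel)"
        by (intro nn_integral_mono) (auto split: split_indicator)
      also have "\<dots> \<le> ennreal ((e / 2)\<^sup>2)" by (rule K[OF mn])
      finally have "l2 \<mu> (\<lambda>x. \<phi> (r m) x - \<phi> (r n) x) \<le> e / 2"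
        using e by (intro sq_int_boundI(2) measurable_\<mu>) auto
      then show ?thesis using e by simp
    qed
    then show ?thesis by blast
  qed
  obtain v where v: "sq_int \<mu> v" "(\<lambda>n. l2 \<mu> (\<lambda>x. \<phi> (r n) x - v x)) \<longlonglongrightarrow> 0"
    by (rule l2_complete[of \<mu> "\<lambda>n. \<phi> (r n)", OF test_poincare(1)[OF \<phi>(1)] Cau], assumption) (rule that)
  have "(\<lambda>n. l2 \<mu> (\<lambda>x. u (r n) x - v x)) \<longlonglongrightarrow> 0"
  proof (rule tendsto_sandwich[OF _ _ tendsto_const])
    have "(\<lambda>n. 1 / real (Suc (r n)) + l2 \<mu> (\<lambda>x. \<phi> (r n) x - v x)) \<longlonglongrightarrow> 0 + 0"
      by (intro tendsto_add v(2) LIMSEQ_subseq_LIMSEQ[OF LIMSEQ_Suc[OF lim_1_over_n] r(1), unfolded o_def])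
    then show "(\<lambda>n. 1 / real (Suc (r n)) + l2 \<mu> (\<lambda>x. \<phi> (r n) x - v x)) \<longlonglongrightarrow> 0" by simp
    show "\<forall>\<^sub>F n in sequentially. l2 \<mu> (\<lambda>x. u (r n) x - v x) \<le> 1 / real (Suc (r n)) + l2 \<mu> (\<lambda>x. \<phi> (r n) x - v x)"
    proof (intro always_eventually allI)
      fix n
      show "l2 \<mu> (\<lambda>x. u (r n) x - v x) \<le> 1 / real (Suc (r n)) + l2 \<mu> (\<lambda>x. \<phi> (r n) x - v x)"
        using l2_triangle_diff[OF H_sq_int(1)[OF u(1)] test_poincare(1)[OF \<phi>(1)] v(1), of "r n" "r n"] \<phi>(2)[of "r n"] by linarith
    qed
  qed (simp add: l2_nonneg)
  with r(1) v(1) show ?thesis by (rule that)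
qed

text \<open>Balls of \<open>H\<^sub>0\<^sup>1\<close> are closed in \<open>L\<^sup>2\<close>, which serves as a substitute for weak compactness and lower
  semicontinuity of the norm. Among the elements of the ball at \<open>L\<^sup>2\<close> distance at most \<open>1/(n+1)\<close> from
  \<open>v\<close>, choose \<open>w\<^sub>n\<close> of almost minimal norm. The midpoint of \<open>w\<^sub>m\<close> and \<open>w\<^sub>n\<close> is again a candidate, so the
  parallelogram law makes the gradients of the \<open>w\<^sub>n\<close> a Cauchy sequence.\<close>

lemma weak_closure:
  assumes v: "sq_int \<mu> v" and W: "\<And>d. d > 0 \<Longrightarrow> \<exists>w\<in>H. N w \<le> K \<and> l2 \<mu> (\<lambda>x. w x - v x) < d"
  shows "v \<in> H" "N v \<le> K"
proof -
  define d where "d n = 1 / real (Suc n)" for n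
  have d: "d n > 0" "n \<le> m \<Longrightarrow> d m \<le> d n" for n m
    unfolding d_def by (auto intro!: divide_left_mono)
  have d_lim: "d \<longlonglongrightarrow> 0" unfolding d_def[abs_def] by (rule LIMSEQ_Suc[OF lim_1_over_n])
  define S where "S n = {w \<in> H. N w \<le> K \<and> l2 \<mu> (\<lambda>x. w x - v x) \<le> d n}" for n
  define A where "A n = Inf ((\<lambda>w. (N w)\<^sup>2) ` S n)" for n
  have S_ne: "S n \<noteq> {}" for n using W[OF d(1)[of n]] by (auto simp: S_def less_imp_le)
  have S_mono: "S m \<subseteq> S n" if "n \<le> m" for n m using d(2)[OF that] by (auto simp: S_def)
  have bdd: "bdd_below ((\<lambda>w. (N w)\<^sup>2) ` S n)" for n by (rule bdd_belowI[of _ 0]) auto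
  have A_le: "A n \<le> (N w)\<^sup>2" if "w \<in> S n" for w n unfolding A_def using that by (intro cInf_lower bdd) auto
  have "incseq A"
    unfolding A_def by (intro incseq_SucI cInf_superset_mono bdd image_mono S_mono) (use S_ne in auto)
  moreover have "A n \<le> K\<^sup>2" for n
  proof -
    obtain w where w: "w \<in> S n" using S_ne by blast
    then have "(N w)\<^sup>2 \<le> K\<^sup>2" by (intro power_mono N_nonneg) (simp add: S_def)
    then show ?thesis using A_le[OF w] by simp
  qed
  ultimately obtain L where L: "A \<longlonglongrightarrow> L" "\<And>n. A n \<le> L"
    using incseq_convergent[of A "K\<^sup>2"] by blast
  have "\<exists>w\<in>S n. (N w)\<^sup>2 < A n + d n" for n
    using cInf_lessD[of "(\<lambda>w. (N w)\<^sup>2) ` S n" "A n + d n"] S_ne d(1)[of n] unfolding A_def by auto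
  then obtain w where w: "\<And>n. w n \<in> S n" "\<And>n. (N (w n))\<^sup>2 < A n + d n" by metis
  have wH: "w n \<in> H" "N (w n) \<le> K" "l2 \<mu> (\<lambda>x. w n x - v x) \<le> d n" for n using w(1)[of n] by (auto simp: S_def)
  have est: "(N (\<lambda>x. w m x - w n x))\<^sup>2 \<le> 4 * (L - A k) + 4 * d k" if mn: "m \<ge> k" "n \<ge> k" for m n k
  proof -
    define z where "z = (\<lambda>x. 1 / 2 * (w m x + w n x))"
    have sH: "(\<lambda>x. w m x + w n x) \<in> H" by (rule H_add[OF wH(1) wH(1)])
    have zH: "z \<in> H" unfolding z_def by (rule H_cmult[OF sH])
    have Nz: "N z = 1 / 2 * N (\<lambda>x. w m x + w n x)" unfolding z_def by (subst N_cmult[OF sH]) simp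
    have "z \<in> S k"
      unfolding S_def
    proof (intro CollectI conjI zH)
      show "N z \<le> K" using N_triangle[OF wH(1) wH(1), of m n] wH(2)[of m] wH(2)[of n] unfolding Nz by simp
      have sq: "sq_int \<mu> (\<lambda>x. w m x - v x)" "sq_int \<mu> (\<lambda>x. w n x - v x)"
        using sq_int_diff[OF H_sq_int(1)[OF wH(1)] v] by auto
      have "l2 \<mu> (\<lambda>x. z x - v x) = l2 \<mu> (\<lambda>x. (1 / 2) *\<^sub>R ((w m x - v x) + (w n x - v x)))"
        by (simp add: z_def algebra_simps)
      also have "\<dots> = 1 / 2 * l2 \<mu> (\<lambda>x. (w m x - v x) + (w n x - v x))"
        by (subst sq_int_scaleR(2)[OF sq_int_add[OF sq]]) simp
      also have "\<dots> \<le> d k"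
        using l2_triangle[OF sq] wH(3)[of m] wH(3)[of n] d(2)[OF mn(1)] d(2)[OF mn(2)] by simp
      finally show "l2 \<mu> (\<lambda>x. z x - v x) \<le> d k" .
    qed
    then have "4 * A k \<le> (N (\<lambda>x. w m x + w n x))\<^sup>2" using A_le[of z k] by (simp add: Nz power2_eq_square)
    moreover have "(N (\<lambda>x. w m x - w n x))\<^sup>2 = 2 * (N (w m))\<^sup>2 + 2 * (N (w n))\<^sup>2 - (N (\<lambda>x. w m x + w n x))\<^sup>2"
      using N_lincomb[OF wH(1) wH(1), of m 1 n] N_lincomb[OF wH(1) wH(1), of m "-1" n] by simp
    moreover have "(N (w m))\<^sup>2 \<le> L + d k" "(N (w n))\<^sup>2 \<le> L + d k"
      using w(2)[of m] w(2)[of n] L(2)[of m] L(2)[of n] d(2)[OF mn(1)] d(2)[OF mn(2)] by linarith+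
    ultimately show ?thesis by (simp add: algebra_simps)
  qed
  have Cau: "\<exists>M. \<forall>m\<ge>M. \<forall>n\<ge>M. l2 \<mu> (\<lambda>x. D (w m) x - D (w n) x) < e" if e: "e > 0" for e
  proof -
    have "(\<lambda>k. 4 * (L - A k) + 4 * d k) \<longlonglongrightarrow> 4 * (L - L) + 4 * 0" by (intro tendsto_intros L(1) d_lim)
    then have "eventually (\<lambda>k. 4 * (L - A k) + 4 * d k < e\<^sup>2) sequentially"
      using e by (intro order_tendstoD(2)) auto
    then obtain k where k: "4 * (L - A k) + 4 * d k < e\<^sup>2" by (auto simp: eventually_sequentially)
    have "l2 \<mu> (\<lambda>x. D (w m) x - D (w n) x) < e" if "m \<ge> k" "n \<ge> k" for m n
    proof (rule power2_less_imp_less)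
      show "(l2 \<mu> (\<lambda>x. D (w m) x - D (w n) x))\<^sup>2 < e\<^sup>2"
        using est[OF that] k by (simp add: N_diff_eq[OF wH(1) wH(1)])
    qed (use e in simp)
    then show ?thesis by blast
  qed
  obtain g where g: "sq_int \<mu> g" "(\<lambda>n. l2 \<mu> (\<lambda>x. D (w n) x - g x)) \<longlonglongrightarrow> 0"
    by (rule l2_complete[of \<mu> "\<lambda>n. D (w n)", OF H_sq_int(2)[OF wH(1)] Cau], assumption) (rule that)
  have close: "\<exists>n. l2 \<mu> (\<lambda>x. w n x - v x) < e \<and> l2 \<mu> (\<lambda>x. D (w n) x - g x) < e" if e: "e > 0" for e
  proof -
    have "eventually (\<lambda>n. d n < e \<and> l2 \<mu> (\<lambda>x. D (w n) x - g x) < e) sequentially"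
      using order_tendstoD(2)[OF d_lim e] order_tendstoD(2)[OF g(2) e] by eventually_elim simp
    then obtain n where "d n < e" "l2 \<mu> (\<lambda>x. D (w n) x - g x) < e" by (auto simp: eventually_sequentially)
    then show ?thesis using wH(3)[of n] by (intro exI[of _ n]) simp
  qed
  have vg: "approx v g"
  proof (rule approx_closed[OF v g(1)])
    fix e :: real assume "e > 0"
    then obtain n where "l2 \<mu> (\<lambda>x. w n x - v x) < e" "l2 \<mu> (\<lambda>x. D (w n) x - g x) < e" using close by blast
    then show "\<exists>u k. approx u k \<and> l2 \<mu> (\<lambda>x. v x - u x) < e \<and> l2 \<mu> (\<lambda>x. g x - k x) < e"
      using H01_approx[OF wH(1), of n] by (intro exI[of _ "w n"] exI[of _ "D (w n)"]) (simp add: l2_minus[of _ v] l2_minus[of _ g])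
  qed
  then show "v \<in> H" by (rule approx_H01)
  have "N v \<le> K + e" if e: "e > 0" for e
  proof -
    obtain n where n: "l2 \<mu> (\<lambda>x. D (w n) x - g x) < e" using close[OF e] by blast
    have "l2 \<mu> g \<le> l2 \<mu> (\<lambda>x. g x - D (w n) x) + l2 \<mu> (D (w n))"
      using l2_triangle[OF sq_int_diff[OF g(1) H_sq_int(2)[OF wH(1)[of n]]] H_sq_int(2)[OF wH(1)[of n]]] by simp
    then show ?thesis using n wH(2)[of n] by (simp add: approx_AE(2)[OF vg] N_eq[OF wH(1)] l2_minus[of _ g])
  qed
  then show "N v \<le> K" by (rule field_le_epsilon)
qed

text \<open>Convergence in \<open>L\<^sup>2\<close> improves to \<open>L\<^sup>q\<close> by interpolation with an exponent between \<open>q\<close> and \<open>6\<close>, in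
  which the sequence is bounded.\<close>

lemma compact_embedding:
  assumes u: "\<And>n::nat. u n \<in> H" "\<And>n. N (u n) \<le> a"
  obtains r :: "nat \<Rightarrow> nat" and v where "strict_mono r" "v \<in> H" "N v \<le> a" 
    "\<And>q. 2 \<le> q \<Longrightarrow> q < 6 \<Longrightarrow> (\<lambda>n. LINT x|\<mu>. \<bar>u (r n) x - v x\<bar> powr q) \<longlonglongrightarrow> 0"
proof -
  obtain r :: "nat \<Rightarrow> nat" and v where r: "strict_mono r" and v: "sq_int \<mu> v" "(\<lambda>n. l2 \<mu> (\<lambda>x. u (r n) x - v x)) \<longlonglongrightarrow> 0"
    by (rule rellich_H[OF u]) (rule that)
  have cl: "\<exists>w\<in>H. N w \<le> a \<and> l2 \<mu> (\<lambda>x. w x - v x) < d" if d0: "d > 0" for d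
  proof -
    obtain n where "l2 \<mu> (\<lambda>x. u (r n) x - v x) < d"
      using order_tendstoD(2)[OF v(2) d0] by (auto simp: eventually_sequentially)
    then show ?thesis using u by blast
  qed
  note vH = weak_closure[OF v(1) cl]
  have a0: "a \<ge> 0" using u(2)[of 0] N_nonneg[of "u 0"] by linarith
  show ?thesis
  proof (rule that[OF r vH])
    fix q :: real assume q: "2 \<le> q" "q < 6"
    define p where "p = (q + 6) / 2"
    have p: "q < p" "0 < p" "p < 6" using q by (auto simp: p_def)
    obtain C where C: "C \<ge> 0" "\<And>u a. u \<in> H \<Longrightarrow> a > 0 \<Longrightarrow> N u \<le> a \<Longrightarrow> integrable \<mu> (\<lambda>x. \<bar>u x\<bar> powr p)"
      "\<And>u a. u \<in> H \<Longrightarrow> a > 0 \<Longrightarrow> N u \<le> a \<Longrightarrow> (LINT x|\<mu>. \<bar>u x\<bar> powr p) \<le> C * a powr p"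
      by (rule sobolev_H[OF p(2,3)]) (rule that)
    have q0: "0 < q" using q by simp
    obtain Cq where Cq: "\<And>u a. u \<in> H \<Longrightarrow> a > 0 \<Longrightarrow> N u \<le> a \<Longrightarrow> integrable \<mu> (\<lambda>x. \<bar>u x\<bar> powr q)"
      by (rule sobolev_H[OF q0 q(2)]) (rule that)
    \<comment> \<open>A positive bound for the norms of the differences, also if \<open>a = 0\<close>.\<close>
    define b where "b = 2 * a + 1"
    have b: "b > 0" using a0 by (simp add: b_def)
    have wH: "(\<lambda>x. u (r n) x - v x) \<in> H" for n by (rule H_diff[OF u(1) vH(1)])
    have Nw: "N (\<lambda>x. u (r n) x - v x) \<le> b" for n
      using N_diff_triangle[OF u(1) vH(1), of "r n"] u(2)[of "r n"] vH(2) by (simp add: b_def)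
    show "(\<lambda>n. LINT x|\<mu>. \<bar>u (r n) x - v x\<bar> powr q) \<longlonglongrightarrow> 0"
    proof (rule order_tendstoI)
      fix e :: real assume e: "e < 0"
      show "\<forall>\<^sub>F n in sequentially. e < (LINT x|\<mu>. \<bar>u (r n) x - v x\<bar> powr q)"
        using e by (intro always_eventually allI order_less_le_trans[OF e]) simp
    next
      fix e :: real assume e: "e > 0"
      define Q where "Q = C * b powr p + 1"
      have Q: "Q > 0" unfolding Q_def using C(1) by (simp add: add_nonneg_pos)
      define e' where "e' = e / (2 * Q)"
      have e': "e' > 0" using e Q by (simp add: e'_def)
      obtain K where K: "K \<ge> 0" "\<And>t. t \<ge> 0 \<Longrightarrow> t powr q \<le> e' * t powr p + K * t\<^sup>2"
        by (rule powr_interpolation[OF q(1) p(1) e']) (rule that)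
      have "(\<lambda>n. K * (l2 \<mu> (\<lambda>x. u (r n) x - v x))\<^sup>2) \<longlonglongrightarrow> K * 0\<^sup>2" by (intro tendsto_intros v(2))
      then have "\<forall>\<^sub>F n in sequentially. K * (l2 \<mu> (\<lambda>x. u (r n) x - v x))\<^sup>2 < e / 2"
        using e by (intro order_tendstoD(2)) auto
      then show "\<forall>\<^sub>F n in sequentially. (LINT x|\<mu>. \<bar>u (r n) x - v x\<bar> powr q) < e"
      proof eventually_elim
        case (elim n)
        let ?w = "\<lambda>x. u (r n) x - v x"
        have i1: "integrable \<mu> (\<lambda>x. \<bar>?w x\<bar> powr p)" by (rule C(2)[OF wH b Nw])
        have i2: "integrable \<mu> (\<lambda>x. (norm (?w x))\<^sup>2)" by (rule sq_int_integrable[OF H_sq_int(1)[OF wH]])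
        have "(LINT x|\<mu>. \<bar>?w x\<bar> powr q) \<le> (LINT x|\<mu>. e' * \<bar>?w x\<bar> powr p + K * (norm (?w x))\<^sup>2)"
          using K(2)[of "\<bar>?w _\<bar>"] i1 i2 by (intro integral_mono Cq[OF wH b Nw]) auto
        also have "\<dots> = e' * (LINT x|\<mu>. \<bar>?w x\<bar> powr p) + K * (l2 \<mu> ?w)\<^sup>2"
          using i1 i2 by (simp add: l2_power2)
        also have "\<dots> \<le> e' * (C * b powr p) + K * (l2 \<mu> ?w)\<^sup>2"
          using e' C(3)[OF wH b Nw] by (intro add_right_mono mult_left_mono) auto
        also have "e' * (C * b powr p) \<le> e' * Q" using e' by (simp add: Q_def)
        also have "\<dots> = e / 2" using Q by (simp add: e'_def)
        finally show ?case using elim by simp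
      qed
    qed
  qed
qed

text \<open>Smoothed absolute values of test functions that approximate \<open>u\<close> converge to \<open>\<bar>u\<bar>\<close> in \<open>L\<^sup>2\<close> and have
  asymptotically no larger norm, so \<open>weak_closure\<close> applies.\<close>

lemma H_abs:
  assumes u: "u \<in> H"
  shows "(\<lambda>x. \<bar>u x\<bar>) \<in> H" "N (\<lambda>x. \<bar>u x\<bar>) \<le> N u"
proof -
  obtain \<phi> where \<phi>: "\<And>n::nat. \<phi> n \<in> test" "(\<lambda>n. l2 \<mu> (\<lambda>x. \<phi> n x - u x)) \<longlonglongrightarrow> 0" "\<And>n. N (\<phi> n) \<le> N u + 1 / real (Suc n)"
    by (rule H_approx_seq[OF u]) (rule that)
  note [measurable] = H_measurable[OF u]
  have sq: "sq_int \<mu> (\<lambda>x. \<bar>u x\<bar>)" using H_sq_int(1)[OF u] by (simp add: sq_int_def)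
  have close: "\<exists>w\<in>H. N w \<le> N u + e \<and> l2 \<mu> (\<lambda>x. w x - \<bar>u x\<bar>) < d" if e: "e > 0" and d: "d > 0" for e d
  proof -
    define V where "V = sqrt (measure \<mu> \<Omega>) + 1"
    have V: "V > 0" by (simp add: V_def add_nonneg_pos)
    define \<eta> where "\<eta> = d / (2 * V)"
    have \<eta>: "\<eta> > 0" "\<eta> * V = d / 2" using d V by (simp_all add: \<eta>_def)
    have "eventually (\<lambda>n. l2 \<mu> (\<lambda>x. \<phi> n x - u x) < d / 2 \<and> 1 / real (Suc n) < e) sequentially"
      using order_tendstoD(2)[OF \<phi>(2), of "d / 2"] order_tendstoD(2)[OF LIMSEQ_Suc[OF lim_1_over_n] e] d
      by (auto elim: eventually_elim2)
    then obtain n where n: "l2 \<mu> (\<lambda>x. \<phi> n x - u x) < d / 2" "1 / real (Suc n) < e" by (auto simp: eventually_sequentially)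
    define \<psi> where "\<psi> = (\<lambda>x. sqrt ((\<phi> n x)\<^sup>2 + \<eta>\<^sup>2) - \<eta>)"
    note \<psi> = test_functions_smooth_abs[OF \<phi>(1)[of n] \<eta>(1), folded \<psi>_def]
    have \<psi>3: "\<bar>\<psi> x - \<bar>\<phi> n x\<bar>\<bar> \<le> \<eta>" for x using \<psi>(3) by (simp add: \<psi>_def)
    have "l2 \<mu> (grad \<psi>) \<le> l2 \<mu> (grad (\<phi> n))"
      unfolding l2_def using sq_int_integrable[OF test_grad_l2(1)[OF \<psi>(1)]] sq_int_integrable[OF test_grad_l2(1)[OF \<phi>(1)]]
      by (intro real_sqrt_le_mono integral_mono power_mono \<psi>(2)) auto
    then have N\<psi>: "N \<psi> \<le> N u + e" using \<phi>(3)[of n] n(2) by (simp add: test_H(2)[OF \<psi>(1)] test_H(2)[OF \<phi>(1)])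
    note m\<phi> = measurable_\<mu>[OF test_measurable(1)[OF \<phi>(1)]] measurable_\<mu>[OF test_measurable(1)[OF \<psi>(1)]]
    have sq\<phi>: "sq_int \<mu> (\<lambda>x. \<bar>\<phi> n x\<bar>)"
      using test_poincare(1)[OF \<phi>(1)[of n]] by (auto simp: sq_int_def intro!: borel_measurable_abs)
    have "l2 \<mu> (\<lambda>x. \<psi> x - \<bar>u x\<bar>) \<le> l2 \<mu> (\<lambda>x. \<psi> x - \<bar>\<phi> n x\<bar>) + l2 \<mu> (\<lambda>x. \<bar>\<phi> n x\<bar> - \<bar>u x\<bar>)"
      by (rule l2_triangle_diff[OF test_poincare(1)[OF \<psi>(1)] sq\<phi> sq])
    also have "l2 \<mu> (\<lambda>x. \<bar>\<phi> n x\<bar> - \<bar>u x\<bar>) \<le> l2 \<mu> (\<lambda>x. \<phi> n x - u x)"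
      unfolding l2_def using sq_int_integrable[OF sq_int_diff[OF sq\<phi> sq]] sq_int_integrable[OF sq_int_diff[OF test_poincare(1)[OF \<phi>(1)] H_sq_int(1)[OF u]]]
      by (intro real_sqrt_le_mono integral_mono power_mono) auto
    also have "l2 \<mu> (\<lambda>x. \<psi> x - \<bar>\<phi> n x\<bar>) \<le> \<eta> * sqrt (measure \<mu> \<Omega>)"
    proof -
      have "(LINT x|\<mu>. (norm (\<psi> x - \<bar>\<phi> n x\<bar>))\<^sup>2) \<le> (LINT x|\<mu>. \<eta>\<^sup>2)"
        using sq_int_integrable[OF sq_int_diff[OF test_poincare(1)[OF \<psi>(1)] sq\<phi>]] \<psi>3
        by (intro integral_mono power_mono) auto
      also have "\<dots> = \<eta>\<^sup>2 * measure \<mu> \<Omega>" by (simp add: space_\<mu> mult.commute)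
      finally have "l2 \<mu> (\<lambda>x. \<psi> x - \<bar>\<phi> n x\<bar>) \<le> sqrt (\<eta>\<^sup>2 * measure \<mu> \<Omega>)" unfolding l2_def by (rule real_sqrt_le_mono)
      then show ?thesis using \<eta>(1) by (simp add: real_sqrt_mult)
    qed
    also have "\<eta> * sqrt (measure \<mu> \<Omega>) \<le> \<eta> * V" using \<eta>(1) by (simp add: V_def)
    finally show ?thesis using n(1) \<eta>(2) N\<psi> test_H(1)[OF \<psi>(1)] by (intro bexI[of _ \<psi>]) auto
  qed
  show "(\<lambda>x. \<bar>u x\<bar>) \<in> H" using weak_closure(1)[OF sq close[of 1]] by simp
  have "N (\<lambda>x. \<bar>u x\<bar>) \<le> N u + e" if "e > 0" for e by (rule weak_closure(2)[OF sq close[OF that]])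
  then show "N (\<lambda>x. \<bar>u x\<bar>) \<le> N u" by (rule field_le_epsilon)
qed

end

section \<open>Subcritical nonlinearities\<close>

lemma primitive_has_derivative:
  assumes "continuous_on {a..b} h" "a \<le> 0" "0 \<le> b" "a \<le> x" "x \<le> b"
  shows "(primitive h has_real_derivative h x) (at x within {a..b})"
proof -
  have "primitive h = (\<lambda>u. LBINT y=ereal 0..ereal u. h y)" by (simp add: primitive_def fun_eq_iff)
  then show ?thesis
    using interval_integral_FTC2[of a 0 b h x] assms
    by (simp add: has_real_derivative_iff_has_vector_derivative zero_ereal_def[symmetric])
qed

lemma primitive_zero: "primitive h 0 = 0"
  by (simp add: primitive_def zero_ereal_def[symmetric])

lemma powr_add_le:
  fixes x y p :: real
  assumes "x \<ge> 0" "y \<ge> 0" "p > 0"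
  shows "(x + y) powr p \<le> 2 powr p * (x powr p + y powr p)"
proof -
  have "(x + y) powr p \<le> (2 * max x y) powr p" using assms by (intro powr_mono2) auto
  also have "\<dots> = 2 powr p * max x y powr p" using assms by (simp add: powr_mult)
  also have "max x y powr p \<le> x powr p + y powr p" by (auto simp: max_def)
  finally show ?thesis by simp
qed

text \<open>Young's inequality in its crudest form: replace the smaller of \<open>x\<close> and \<open>y\<close> by the larger.\<close>

lemma mult_powr_le:
  fixes x y p :: real
  assumes "x \<ge> 0" "y \<ge> 0" "p > 0"
  shows "x * y powr p \<le> x powr (p + 1) + y powr (p + 1)"
proof -
  have e: "z * z powr p = z powr (p + 1)" if "z \<ge> 0" for z :: real
    using that by (cases "z = 0") (auto simp: powr_add)
  show ?thesis
  proof (cases "x \<le> y")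
    case True
    then have "x * y powr p \<le> y * y powr p" by (intro mult_right_mono) auto
    then show ?thesis using assms by (simp add: e add_increasing)
  next
    case False
    then have "x * y powr p \<le> x * x powr p" using assms by (intro mult_left_mono powr_mono2) auto
    then show ?thesis using assms by (simp add: e add_increasing2)
  qed
qed

text \<open>With \<open>s\<close> and \<open>t\<close> bounds for the norms of the functions \<open>x\<close> and \<open>y\<close>, integration gives an estimate
  of order \<open>s t\<^sup>p\<close>; this takes the place of Hoelder's inequality.\<close>

lemma mult_powr_le_scaled:
  fixes x y p s t :: real
  assumes "x \<ge> 0" "y \<ge> 0" "p > 0" "s > 0" "t > 0"
  shows "x * y powr p \<le> s * t powr p * (x powr (p + 1) / s powr (p + 1) + y powr (p + 1) / t powr (p + 1))"
proof -
  have "x * y powr p = s * t powr p * ((x / s) * (y / t) powr p)"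
    using assms by (simp add: powr_divide)
  also have "\<dots> \<le> s * t powr p * ((x / s) powr (p + 1) + (y / t) powr (p + 1))"
    using assms by (intro mult_left_mono mult_powr_le) auto
  finally show ?thesis using assms by (simp add: powr_divide)
qed

locale nonlinearity =
  fixes f :: "real \<Rightarrow> real" and \<alpha> :: real
  assumes f_odd: "f (- t) = - f t"
    and f_C1: "f C1_differentiable_on UNIV"
    and f_nonneg: "t \<ge> 0 \<Longrightarrow> f t \<ge> 0"
    and f_small: "((\<lambda>t. f t / t) \<longlongrightarrow> 0) (at 0)"
    and F_large: "filterlim (\<lambda>t. primitive f t / t ^ 4) at_top at_top"
    and \<alpha>: "4 < \<alpha>" "\<alpha> < 6"
    and f_subcritical: "((\<lambda>t. f t / t powr (\<alpha> - 1)) \<longlongrightarrow> 0) at_top"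
begin

abbreviation p :: real where "p \<equiv> \<alpha> - 1"
abbreviation F :: "real \<Rightarrow> real" where "F \<equiv> primitive f"

lemma f_zero: "f 0 = 0" using f_odd[of 0] by simp

lemma f_abs: "\<bar>f t\<bar> = f \<bar>t\<bar>"
  using f_odd[of t] f_nonneg[of "\<bar>t\<bar>"] by (cases "t \<ge> 0") auto

lemma f_derivative:
  obtains f' where "\<And>x. (f has_real_derivative f' x) (at x)" "continuous_on UNIV f'"
  using f_C1 unfolding C1_differentiable_on_def has_real_derivative_iff_has_vector_derivative by auto

lemma f_cont: "continuous_on S f"
proof -
  obtain f' where "\<And>x. (f has_real_derivative f' x) (at x)" by (rule f_derivative) (rule that)
  then show ?thesis using DERIV_isCont by (intro continuous_at_imp_continuous_on) blast
qed

lemma f_bounded: obtains K where "K \<ge> 0" "\<And>t. \<bar>t\<bar> \<le> R \<Longrightarrow> \<bar>f t\<bar> \<le> K"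
proof -
  have "bounded (f ` {-R..R})"
    by (intro compact_imp_bounded compact_continuous_image f_cont) simp
  then obtain K where "K > 0" "\<forall>x\<in>f ` {-R..R}. norm x \<le> K" by (auto simp: bounded_pos)
  then show ?thesis by (intro that[of K]) (auto simp: abs_le_iff)
qed

lemma f_lipschitz: obtains L where "L \<ge> 0" "\<And>x y. \<bar>x\<bar> \<le> R \<Longrightarrow> \<bar>y\<bar> \<le> R \<Longrightarrow> \<bar>f x - f y\<bar> \<le> L * \<bar>x - y\<bar>"
proof -
  obtain f' where f': "\<And>x. (f has_real_derivative f' x) (at x)" "continuous_on UNIV f'" by (rule f_derivative) (rule that)
  have "bounded (f' ` {-R..R})"
    by (intro compact_imp_bounded compact_continuous_image continuous_on_subset[OF f'(2)]) auto
  then obtain L where L: "L > 0" "\<forall>x\<in>f' ` {-R..R}. norm x \<le> L" by (auto simp: bounded_pos)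
  have "\<bar>f x - f y\<bar> \<le> L * \<bar>x - y\<bar>" if "\<bar>x\<bar> \<le> R" "\<bar>y\<bar> \<le> R" for x y
    using field_differentiable_bound[of "{-R..R}" f f' L x y] L(2) f'(1) that
    by (auto intro: has_field_derivative_at_within simp: abs_le_iff)
  with L(1) show ?thesis by (intro that[of L]) auto
qed

lemma F_derivative: "(F has_real_derivative f t) (at t)"
proof -
  have "(F has_real_derivative f t) (at t within {-(\<bar>t\<bar> + 1)..\<bar>t\<bar> + 1})"
    by (rule primitive_has_derivative) (auto intro: f_cont)
  moreover have "t \<in> interior {-(\<bar>t\<bar> + 1)..\<bar>t\<bar> + 1}" by auto
  ultimately show ?thesis by (metis at_within_interior)
qed

lemma F_even: "F (- t) = F t"
proof -
  have "((\<lambda>t. F (- t) - F t) has_real_derivative 0) (at t)" for t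
    using f_odd[of t] by (auto intro!: derivative_eq_intros F_derivative DERIV_chain2[OF F_derivative])
  then show ?thesis using DERIV_isconst_all[of "\<lambda>t. F (- t) - F t" t 0] by (simp add: primitive_zero)
qed

lemma F_abs: "F \<bar>t\<bar> = F t"
  using F_even[of t] by (cases "t \<ge> 0") auto

lemma F_mono: "0 \<le> s \<Longrightarrow> s \<le> t \<Longrightarrow> F s \<le> F t"
  by (rule DERIV_nonneg_imp_nondecreasing) (use F_derivative f_nonneg in \<open>auto intro!: exI\<close>)

lemma F_nonneg: "F t \<ge> 0"
  using F_mono[of 0 "\<bar>t\<bar>"] by (simp add: primitive_zero F_abs)

lemma f_tail:
  assumes e: "e > 0"
  obtains R where "R > 0" "\<And>t. \<bar>t\<bar> \<ge> R \<Longrightarrow> \<bar>f t\<bar> \<le> e * \<bar>t\<bar> powr p"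
proof -
  obtain R where R: "\<And>t. t \<ge> R \<Longrightarrow> \<bar>f t / t powr p\<bar> < e"
    using tendstoD[OF f_subcritical e] by (auto simp: eventually_at_top_linorder)
  have "\<bar>f t\<bar> \<le> e * \<bar>t\<bar> powr p" if t: "\<bar>t\<bar> \<ge> max R 1" for t
  proof -
    have "\<bar>t\<bar> powr p > 0" using t by auto
    then show ?thesis using R[of "\<bar>t\<bar>"] t by (simp add: f_abs[of t] f_nonneg divide_less_eq)
  qed
  then show ?thesis by (intro that[of "max R 1"]) auto
qed

lemma f_growth:
  assumes e: "e > 0"
  obtains K where "K \<ge> 0" "\<And>t. \<bar>f t\<bar> \<le> e * \<bar>t\<bar> powr p + K"
proof -
  obtain R where R: "R > 0" "\<And>t. \<bar>t\<bar> \<ge> R \<Longrightarrow> \<bar>f t\<bar> \<le> e * \<bar>t\<bar> powr p" by (rule f_tail[OF e]) (rule that)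
  obtain K where K: "K \<ge> 0" "\<And>t. \<bar>t\<bar> \<le> R \<Longrightarrow> \<bar>f t\<bar> \<le> K" by (rule f_bounded) (rule that)
  have "\<bar>f t\<bar> \<le> e * \<bar>t\<bar> powr p + K" for t
    using R(2)[of t] K(1) K(2)[of t] e by (cases "\<bar>t\<bar> \<ge> R") (auto intro: add_increasing add_increasing2)
  with K(1) show ?thesis by (rule that)
qed

text \<open>This takes the place of the continuity of superposition with \<open>f\<close> between Lebesgue spaces. If \<open>\<bar>b\<bar> \<ge> 1\<close>
  it follows from the growth of \<open>f\<close>. If \<open>\<bar>b\<bar> < 1\<close>, then \<open>f\<close> is Lipschitz as long as \<open>a\<close> stays in a
  bounded set, and is a small multiple of \<open>\<bar>a\<bar>\<^sup>p\<close> at \<open>a\<close> and \<open>a + b\<close> otherwise.\<close>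

lemma f_difference:
  assumes e: "e > 0"
  obtains C where "C \<ge> 0" "\<And>a b. \<bar>f (a + b) - f a\<bar> \<le> e * (1 + \<bar>a\<bar> powr p) + C * (\<bar>b\<bar> + \<bar>b\<bar> powr p)"
proof -
  define c where "c = (2::real) powr p"
  have c: "c > 0" by (simp add: c_def)
  \<comment> \<open>The growth bound is used at \<open>a\<close> and at \<open>a + b\<close>, at the cost of a factor \<open>2 c + 1\<close>.\<close>
  define d where "d = e / (2 * c + 1)"
  have d: "d > 0" "d * (2 * c + 1) = e" using e c by (simp_all add: d_def add_pos_pos)
  obtain R where R: "R > 0" "\<And>t. \<bar>t\<bar> \<ge> R \<Longrightarrow> \<bar>f t\<bar> \<le> d * \<bar>t\<bar> powr p" by (rule f_tail[OF d(1)]) (rule that)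
  obtain K where K: "K \<ge> 0" "\<And>t. \<bar>f t\<bar> \<le> d * \<bar>t\<bar> powr p + K" by (rule f_growth[OF d(1)]) (rule that)
  obtain L where L: "L \<ge> 0" "\<And>x y. \<bar>x\<bar> \<le> R + 2 \<Longrightarrow> \<bar>y\<bar> \<le> R + 2 \<Longrightarrow> \<bar>f x - f y\<bar> \<le> L * \<bar>x - y\<bar>"
    by (rule f_lipschitz) (rule that)
  define C where "C = L + d * c + 2 * K"
  have C: "C \<ge> 0" using L(1) K(1) d c by (simp add: C_def)
  have sum_powr: "\<bar>a + b\<bar> powr p \<le> c * \<bar>a\<bar> powr p + c * \<bar>b\<bar> powr p" for a b
  proof -
    have "\<bar>a + b\<bar> powr p \<le> (\<bar>a\<bar> + \<bar>b\<bar>) powr p" using \<alpha> by (intro powr_mono2) auto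
    also have "\<dots> \<le> c * (\<bar>a\<bar> powr p + \<bar>b\<bar> powr p)" unfolding c_def using \<alpha> by (intro powr_add_le) auto
    finally show ?thesis by (simp add: distrib_left)
  qed
  have "\<bar>f (a + b) - f a\<bar> \<le> e * (1 + \<bar>a\<bar> powr p) + C * (\<bar>b\<bar> + \<bar>b\<bar> powr p)" for a b
  proof -
    define A B where "A = \<bar>a\<bar> powr p" and "B = \<bar>b\<bar> powr p"
    have AB: "A \<ge> 0" "B \<ge> 0" by (simp_all add: A_def B_def)
    have eA: "e * (1 + A) = d * (2 * c + 1) + d * (2 * c + 1) * A" using d(2) by (simp add: distrib_left)
    have dAB: "d * \<bar>a + b\<bar> powr p \<le> d * (c * A + c * B)"
      using d(1) sum_powr[of a b] by (intro mult_left_mono) (auto simp: A_def B_def)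
    have pos: "d * c * A \<ge> 0" "d * A \<ge> 0" "d * c \<ge> 0" "d * c * B \<ge> 0" "L * \<bar>b\<bar> \<ge> 0" "d * c * \<bar>b\<bar> \<ge> 0" "K * \<bar>b\<bar> \<ge> 0" "L * B \<ge> 0" "K * B \<ge> 0"
      using d c AB L K by simp_all
    have exp: "e * (1 + A) + C * (\<bar>b\<bar> + B) = (2 * (d * c) + d) + (2 * (d * c * A) + d * A)
      + (L * \<bar>b\<bar> + d * c * \<bar>b\<bar> + 2 * (K * \<bar>b\<bar>)) + (L * B + d * c * B + 2 * (K * B))"
      unfolding eA C_def by (simp add: algebra_simps)
    have "\<bar>f (a + b) - f a\<bar> \<le> e * (1 + A) + C * (\<bar>b\<bar> + B)"
    proof (cases "\<bar>b\<bar> \<ge> 1")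
      case True
      have "\<bar>f (a + b) - f a\<bar> \<le> d * \<bar>a + b\<bar> powr p + d * A + 2 * K"
        using K(2)[of "a + b"] K(2)[of a] unfolding A_def by linarith
      also have "\<dots> \<le> d * c * A + d * c * B + d * A + 2 * K" using dAB by (simp add: algebra_simps)
      also have "K \<le> K * \<bar>b\<bar>" using K(1) True by (simp add: mult_le_cancel_left1)
      finally show ?thesis unfolding exp using pos d(1) by linarith
    next
      case False
      show ?thesis
      proof (cases "\<bar>a\<bar> \<le> R + 1")
        case True
        then have "\<bar>f (a + b) - f a\<bar> \<le> L * \<bar>b\<bar>" using False L(2)[of "a + b" a] by simp
        then show ?thesis unfolding exp using pos d(1) by linarith
      next
        case 2: False
        have "B \<le> 1" unfolding B_def using False \<alpha> powr_mono2[of p "\<bar>b\<bar>" 1] by simp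
        then have "d * c * B \<le> d * c * 1" using d c by (intro mult_left_mono) auto
        moreover have "\<bar>f (a + b)\<bar> \<le> d * \<bar>a + b\<bar> powr p" "\<bar>f a\<bar> \<le> d * A"
          using 2 False R(2)[of "a + b"] R(2)[of a] by (auto simp: A_def)
        moreover have "d * (c * A + c * B) = d * c * A + d * c * B" by (simp add: algebra_simps)
        ultimately show ?thesis unfolding exp using pos d(1) dAB by linarith
      qed
    qed
    then show ?thesis by (simp add: A_def B_def)
  qed
  with C show ?thesis by (rule that)
qed

text \<open>The linear term is taken at \<open>a\<close> but the increment starts at \<open>a + c\<close>, as strict differentiability
  requires.\<close>

lemma F_taylor:
  assumes e: "e > 0"
  obtains C where "C \<ge> 0" "\<And>a c b. \<bar>F (a + c + b) - F (a + c) - f a * b\<bar>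
    \<le> \<bar>b\<bar> * (e * (1 + \<bar>a\<bar> powr p) + C * (\<bar>c\<bar> + \<bar>b\<bar> + \<bar>c\<bar> powr p + \<bar>b\<bar> powr p))"
proof -
  obtain C where C: "C \<ge> 0" "\<And>a b. \<bar>f (a + b) - f a\<bar> \<le> e * (1 + \<bar>a\<bar> powr p) + C * (\<bar>b\<bar> + \<bar>b\<bar> powr p)"
    by (rule f_difference[OF e]) (rule that)
  have "\<bar>F (a + c + b) - F (a + c) - f a * b\<bar>
    \<le> \<bar>b\<bar> * (e * (1 + \<bar>a\<bar> powr p) + (C * 2 powr p) * (\<bar>c\<bar> + \<bar>b\<bar> + \<bar>c\<bar> powr p + \<bar>b\<bar> powr p))" for a b c
  proof -
    have "\<exists>s. \<bar>s\<bar> \<le> \<bar>b\<bar> \<and> F (a + c + b) - F (a + c) = f (a + c + s) * b"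
    proof -
      have "(\<lambda>s. F (a + c + s * b)) 1 - (\<lambda>s. F (a + c + s * b)) 0 = F (a + c + b) - F (a + c)" by simp
      moreover have "\<exists>s::real. 0 < s \<and> s < 1 \<and> (\<lambda>s. F (a + c + s * b)) 1 - (\<lambda>s. F (a + c + s * b)) 0 = (1 - 0) * (f (a + c + s * b) * b)"
        by (rule MVT2) (auto intro!: DERIV_chain2[OF F_derivative] derivative_eq_intros)
      ultimately obtain s :: real where s: "0 < s" "s < 1" "F (a + c + b) - F (a + c) = f (a + c + s * b) * b" by auto
      have "\<bar>s * b\<bar> \<le> \<bar>b\<bar>" using s by (simp add: abs_mult mult_left_le_one_le)
      then show ?thesis using s(3) by blast
    qed
    then obtain s where s: "\<bar>s\<bar> \<le> \<bar>b\<bar>" "F (a + c + b) - F (a + c) = f (a + c + s) * b" by blast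
    have cs: "\<bar>c + s\<bar> \<le> \<bar>c\<bar> + \<bar>b\<bar>" using s(1) by linarith
    have "1 \<le> (2::real) powr p" using \<alpha> by (intro ge_one_powr_ge_zero) auto
    then have one: "\<bar>c\<bar> + \<bar>b\<bar> \<le> 2 powr p * (\<bar>c\<bar> + \<bar>b\<bar>)"
      by (meson abs_ge_zero add_nonneg_nonneg mult_le_cancel_right1 linorder_not_less)
    have "\<bar>c + s\<bar> powr p \<le> (\<bar>c\<bar> + \<bar>b\<bar>) powr p" using \<alpha> cs by (intro powr_mono2) auto
    also have "\<dots> \<le> 2 powr p * (\<bar>c\<bar> powr p + \<bar>b\<bar> powr p)" using \<alpha> by (intro powr_add_le) auto
    finally have "\<bar>c + s\<bar> + \<bar>c + s\<bar> powr p \<le> 2 powr p * (\<bar>c\<bar> + \<bar>b\<bar>) + 2 powr p * (\<bar>c\<bar> powr p + \<bar>b\<bar> powr p)"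
      using cs one by linarith
    also have "\<dots> = 2 powr p * (\<bar>c\<bar> + \<bar>b\<bar> + \<bar>c\<bar> powr p + \<bar>b\<bar> powr p)" by (simp add: algebra_simps)
    finally have "C * (\<bar>c + s\<bar> + \<bar>c + s\<bar> powr p) \<le> (C * 2 powr p) * (\<bar>c\<bar> + \<bar>b\<bar> + \<bar>c\<bar> powr p + \<bar>b\<bar> powr p)"
      using C(1) by (simp add: mult_left_mono mult.assoc)
    then have "\<bar>f (a + (c + s)) - f a\<bar> \<le> e * (1 + \<bar>a\<bar> powr p) + (C * 2 powr p) * (\<bar>c\<bar> + \<bar>b\<bar> + \<bar>c\<bar> powr p + \<bar>b\<bar> powr p)"
      using C(2)[of a "c + s"] by linarith
    then have "\<bar>b\<bar> * \<bar>f (a + (c + s)) - f a\<bar> \<le> \<bar>b\<bar> * (e * (1 + \<bar>a\<bar> powr p) + (C * 2 powr p) * (\<bar>c\<bar> + \<bar>b\<bar> + \<bar>c\<bar> powr p + \<bar>b\<bar> powr p))"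
      by (rule mult_left_mono) simp
    moreover have "\<bar>F (a + c + b) - F (a + c) - f a * b\<bar> = \<bar>b\<bar> * \<bar>f (a + (c + s)) - f a\<bar>"
      unfolding s(2) by (simp add: abs_mult[symmetric] algebra_simps)
    ultimately show ?thesis by simp
  qed
  with C(1) show ?thesis by (intro that[of "C * 2 powr p"]) auto
qed

lemma F_small:
  assumes e: "e > 0"
  obtains C where "C \<ge> 0" "\<And>t. F t \<le> e * t\<^sup>2 + C * \<bar>t\<bar> powr \<alpha>"
proof -
  have "eventually (\<lambda>t. \<bar>f t / t\<bar> < e) (at 0)" using tendstoD[OF f_small e] by simp
  then obtain d where d: "d > 0" "\<And>t. t \<noteq> 0 \<Longrightarrow> \<bar>t\<bar> < d \<Longrightarrow> \<bar>f t / t\<bar> < e"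
    by (auto simp: eventually_at dist_real_def)
  have fs: "f t \<le> e * t" if "0 \<le> t" "t < d" for t
    using that d(2)[of t] f_zero f_nonneg[of t] by (cases "t = 0") (auto simp: divide_less_eq)
  obtain K where K: "K \<ge> 0" "\<And>t. \<bar>f t\<bar> \<le> 1 * \<bar>t\<bar> powr p + K" by (rule f_growth[of 1]) (auto intro: that)
  define C where "C = 1 + K / d powr p"
  have C: "C \<ge> 0" using K(1) by (simp add: C_def)
  have fb: "f s \<le> e * t + C * t powr p" if s: "0 \<le> s" "s \<le> t" for s t
  proof (cases "s < d")
    case True
    have "f s \<le> e * s" using fs s True by simp
    also have "\<dots> \<le> e * t" using e s by simp
    finally show ?thesis using C by (simp add: add_increasing2)
  next
    case False
    have sp: "s powr p \<le> t powr p" using s \<alpha> by (intro powr_mono2) auto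
    have "d powr p \<le> s powr p" using False d \<alpha> by (intro powr_mono2) auto
    then have "K / d powr p * d powr p \<le> K / d powr p * s powr p" using K(1) by (intro mult_left_mono) auto
    then have "f s \<le> C * s powr p" using K(2)[of s] s d(1) by (simp add: C_def distrib_right)
    also have "\<dots> \<le> C * t powr p" using C sp by (rule mult_left_mono[rotated])
    finally show ?thesis using e s by (simp add: add_increasing)
  qed
  have F0: "F t \<le> e * t\<^sup>2 + C * t powr \<alpha>" if t: "t > 0" for t
  proof -
    obtain s where s: "0 < s" "s < t" "F t - F 0 = (t - 0) * f s"
      using MVT2[OF t, of F f] F_derivative by blast
    have "F t = t * f s" using s(3) by (simp add: primitive_zero)
    also have "\<dots> \<le> t * (e * t + C * t powr p)" using t fb[of s t] s by (intro mult_left_mono) auto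
    also have "\<dots> = e * t\<^sup>2 + C * (t * t powr p)" by (simp add: algebra_simps power2_eq_square)
    also have "t * t powr p = t powr \<alpha>" using t by (simp add: powr_mult_base)
    finally show ?thesis .
  qed
  have "F t \<le> e * t\<^sup>2 + C * \<bar>t\<bar> powr \<alpha>" for t
    using F0[of "\<bar>t\<bar>"] by (cases "t = 0") (auto simp: F_abs primitive_zero)
  with C show ?thesis by (rule that)
qed

lemma F_superquartic:
  obtains R where "R > 0" "\<And>t. \<bar>t\<bar> \<ge> R \<Longrightarrow> F t \<ge> A * t ^ 4"
proof -
  obtain R where R: "\<And>t. t \<ge> R \<Longrightarrow> A \<le> F t / t ^ 4"
    using F_large by (auto simp: filterlim_at_top eventually_at_top_linorder)
  have "F t \<ge> A * t ^ 4" if t: "\<bar>t\<bar> \<ge> max R 1" for t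
  proof -
    have "\<bar>t\<bar> ^ 4 > 0" using t by (intro zero_less_power) auto
    then show ?thesis using R[of "\<bar>t\<bar>"] t by (simp add: F_abs field_simps)
  qed
  then show ?thesis by (intro that[of "max R 1"]) auto
qed

end

section \<open>The energy functional and its derivative\<close>

locale kirchhoff = bounded_open \<Omega> + nonlinearity f \<alpha>
  for \<Omega> :: "(real^3) set" and f :: "real \<Rightarrow> real" and \<alpha> :: real +
  fixes M :: "real \<Rightarrow> real"
  assumes M_cont: "continuous_on {0..} M"
    and M_mono: "strict_mono_on {0..} M" and M_pos: "M 0 > 0"
    and M_ratio: "strict_antimono_on {0<..} (\<lambda>t. M t / t)"
    and f_ratio: "strict_mono_on {0<..} (\<lambda>t. f t / t ^ 3)"
begin

definition Pot :: "(real^3 \<Rightarrow> real) \<Rightarrow> real" where "Pot u = (LINT x|\<mu>. F (u x))"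
definition dPot :: "(real^3 \<Rightarrow> real) \<Rightarrow> (real^3 \<Rightarrow> real) \<Rightarrow> real" where "dPot u v = (LINT x|\<mu>. f (u x) * v x)"

abbreviation J :: "(real^3 \<Rightarrow> real) \<Rightarrow> real" where "J \<equiv> kirchhoff_energy \<Omega> M f"

definition J' :: "(real^3 \<Rightarrow> real) \<Rightarrow> (real^3 \<Rightarrow> real) \<Rightarrow> real" where
  "J' u v = M ((N u)\<^sup>2) * ip u v - dPot u v"

lemma J_eq: "J u = primitive M ((N u)\<^sup>2) / 2 - Pot u"
  by (simp add: kirchhoff_energy_def Pot_def)

lemma measurable_f [measurable]: "f \<in> borel_measurable borel"
  by (rule borel_measurable_continuous_onI[OF f_cont])

lemma measurable_F [measurable]: "F \<in> borel_measurable borel"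
  using F_derivative DERIV_isCont
  by (intro borel_measurable_continuous_onI continuous_at_imp_continuous_on) blast

lemma \<alpha>_range: "0 < \<alpha>" "2 \<le> \<alpha>" "0 < p" "p + 1 = \<alpha>"
  using \<alpha> by auto

lemma embedding:
  obtains C where "C \<ge> 1" "\<And>u. u \<in> H \<Longrightarrow> integrable \<mu> (\<lambda>x. \<bar>u x\<bar> powr \<alpha>)" "\<And>u. u \<in> H \<Longrightarrow> integrable \<mu> (\<lambda>x. (u x)\<^sup>2)"
    "\<And>u a. u \<in> H \<Longrightarrow> a > 0 \<Longrightarrow> N u \<le> a \<Longrightarrow> (LINT x|\<mu>. \<bar>u x\<bar> powr \<alpha>) \<le> C * a powr \<alpha>"
    "\<And>u a. u \<in> H \<Longrightarrow> a > 0 \<Longrightarrow> N u \<le> a \<Longrightarrow> (LINT x|\<mu>. (u x)\<^sup>2) \<le> C * a\<^sup>2"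
proof -
  obtain C where C: "C \<ge> 0" "\<And>u a. u \<in> H \<Longrightarrow> a > 0 \<Longrightarrow> N u \<le> a \<Longrightarrow> integrable \<mu> (\<lambda>x. \<bar>u x\<bar> powr \<alpha>)"
    "\<And>u a. u \<in> H \<Longrightarrow> a > 0 \<Longrightarrow> N u \<le> a \<Longrightarrow> (LINT x|\<mu>. \<bar>u x\<bar> powr \<alpha>) \<le> C * a powr \<alpha>"
    by (rule sobolev_H[OF \<alpha>_range(1) \<alpha>(2)]) (rule that)
  define C' where "C' = 1 + C + (2 * radius + 1)\<^sup>2"
  have C': "C' \<ge> 1" "C \<le> C'" "(2 * radius + 1)\<^sup>2 \<le> C'" using C(1) by (simp_all add: C'_def)
  show ?thesis
  proof (rule that[OF C'(1)])
    show "integrable \<mu> (\<lambda>x. \<bar>u x\<bar> powr \<alpha>)" if "u \<in> H" for u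
      using C(2)[OF that, of "N u + 1"] N_nonneg[of u] by simp
    show "integrable \<mu> (\<lambda>x. (u x)\<^sup>2)" if "u \<in> H" for u
      using sq_int_integrable[OF H_sq_int(1)[OF that]] by simp
    fix u a assume u: "u \<in> H" "a > 0" "N u \<le> a"
    show "(LINT x|\<mu>. \<bar>u x\<bar> powr \<alpha>) \<le> C' * a powr \<alpha>"
      using C(3)[OF u] mult_right_mono[OF C'(2), of "a powr \<alpha>"] by simp
    have "(LINT x|\<mu>. (u x)\<^sup>2) = (l2 \<mu> u)\<^sup>2" by (simp add: l2_power2)
    also have "\<dots> \<le> ((2 * radius + 1) * N u)\<^sup>2" using poincare_H[OF u(1)] by (intro power_mono l2_nonneg)
    also have "\<dots> = (2 * radius + 1)\<^sup>2 * (N u)\<^sup>2" by (simp add: power_mult_distrib)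
    also have "\<dots> \<le> C' * a\<^sup>2" using C' u N_nonneg[of u] by (intro mult_mono power_mono) auto
    finally show "(LINT x|\<mu>. (u x)\<^sup>2) \<le> C' * a\<^sup>2" .
  qed
qed

lemma integrable_powr: "u \<in> H \<Longrightarrow> integrable \<mu> (\<lambda>x. \<bar>u x\<bar> powr \<alpha>)" and integrable_square: "u \<in> H \<Longrightarrow> integrable \<mu> (\<lambda>x. (u x)\<^sup>2)"
  by (metis embedding)+

lemma integrable_f:
  assumes "u \<in> H" "v \<in> H"
  shows "integrable \<mu> (\<lambda>x. f (u x) * v x)"
proof -
  obtain K where K: "K \<ge> 0" "\<And>t. \<bar>f t\<bar> \<le> 1 * \<bar>t\<bar> powr p + K" by (rule f_growth[of 1]) (auto intro: that)
  note [measurable] = H_measurable[OF assms(1)] H_measurable[OF assms(2)]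
  show ?thesis
  proof (rule Bochner_Integration.integrable_bound)
    show "integrable \<mu> (\<lambda>x. \<bar>v x\<bar> powr \<alpha> + \<bar>u x\<bar> powr \<alpha> + K * (1 + (v x)\<^sup>2))"
      using assms integrable_powr integrable_square by auto
    show "AE x in \<mu>. norm (f (u x) * v x) \<le> norm (\<bar>v x\<bar> powr \<alpha> + \<bar>u x\<bar> powr \<alpha> + K * (1 + (v x)\<^sup>2))"
    proof (intro AE_I2)
      fix x
      have "\<bar>v x\<bar> \<le> 1 + (v x)\<^sup>2" using sum_squares_bound[of "\<bar>v x\<bar>" 1] by (simp add: power2_eq_square)
      then have 1: "K * \<bar>v x\<bar> \<le> K * (1 + (v x)\<^sup>2)" using K(1) by (rule mult_left_mono)
      have 2: "\<bar>v x\<bar> * \<bar>u x\<bar> powr p \<le> \<bar>v x\<bar> powr \<alpha> + \<bar>u x\<bar> powr \<alpha>"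
        using mult_powr_le[of "\<bar>v x\<bar>" "\<bar>u x\<bar>" p] \<alpha>_range by simp
      have "\<bar>f (u x) * v x\<bar> \<le> (\<bar>u x\<bar> powr p + K) * \<bar>v x\<bar>"
        unfolding abs_mult using K(2)[of "u x"] by (intro mult_right_mono) auto
      also have "\<dots> = \<bar>v x\<bar> * \<bar>u x\<bar> powr p + K * \<bar>v x\<bar>" by (simp add: algebra_simps)
      finally show "norm (f (u x) * v x) \<le> norm (\<bar>v x\<bar> powr \<alpha> + \<bar>u x\<bar> powr \<alpha> + K * (1 + (v x)\<^sup>2))"
        unfolding real_norm_def
        using 1 2 abs_ge_self[of "\<bar>v x\<bar> powr \<alpha> + \<bar>u x\<bar> powr \<alpha> + K * (1 + (v x)\<^sup>2)"] by linarith
    qed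
  qed measurable
qed

lemma integrable_F:
  assumes "u \<in> H"
  shows "integrable \<mu> (\<lambda>x. F (u x))"
proof -
  obtain C where C: "C \<ge> 0" "\<And>t. F t \<le> 1 * t\<^sup>2 + C * \<bar>t\<bar> powr \<alpha>" by (rule F_small[of 1]) (auto intro: that)
  note [measurable] = H_measurable[OF assms]
  show ?thesis
  proof (rule Bochner_Integration.integrable_bound)
    show "integrable \<mu> (\<lambda>x. (u x)\<^sup>2 + C * \<bar>u x\<bar> powr \<alpha>)"
      using assms integrable_powr integrable_square by auto
    show "AE x in \<mu>. norm (F (u x)) \<le> norm ((u x)\<^sup>2 + C * \<bar>u x\<bar> powr \<alpha>)"
    proof (intro AE_I2)
      fix x show "norm (F (u x)) \<le> norm ((u x)\<^sup>2 + C * \<bar>u x\<bar> powr \<alpha>)"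
        using C(2)[of "u x"] F_nonneg[of "u x"] by simp
    qed
  qed measurable
qed

lemma dPot_lincomb: "u \<in> H \<Longrightarrow> v \<in> H \<Longrightarrow> w \<in> H \<Longrightarrow> dPot u (\<lambda>x. v x + c * w x) = dPot u v + c * dPot u w"
  unfolding dPot_def using integrable_f[of u v] integrable_f[of u w]
  by (simp add: distrib_left mult.left_commute[of _ c])

lemma J'_lincomb:
  assumes "u \<in> H" "v \<in> H" "w \<in> H"
  shows "J' u (\<lambda>x. v x + c * w x) = J' u v + c * J' u w"
  unfolding J'_def dPot_lincomb[OF assms] ip_commute[of u] ip_lincomb[OF assms(2,3,1)] by (simp add: algebra_simps)

lemma J'_cmult: "u \<in> H \<Longrightarrow> v \<in> H \<Longrightarrow> J' u (\<lambda>x. c * v x) = c * J' u v"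
proof -
  assume uv: "u \<in> H" "v \<in> H"
  have "J' u (\<lambda>x. 0) = 0"
    using J'_lincomb[OF uv(1) H_zero H_zero, of "-1"] by simp
  then show ?thesis using J'_lincomb[OF uv(1) H_zero uv(2), of c] by simp
qed

text \<open>Each product in \<open>F_taylor\<close> is split by \<open>mult_powr_le_scaled\<close> with the scales \<open>a\<close> for \<open>v\<close> and \<open>d\<close> for
  \<open>w\<close>, so that every term carries a factor \<open>a\<close>. Bounds \<open>a\<close>, \<open>d\<close> for the norms, in place of the norms,
  keep the scales positive.\<close>

lemma Pot_taylor_bound:
  assumes u: "u \<in> H" and e: "e > 0"
  obtains B where "B \<ge> 0" "\<And>v w a d. v \<in> H \<Longrightarrow> w \<in> H \<Longrightarrow> 0 < a \<Longrightarrow> a \<le> d \<Longrightarrow> N v \<le> a \<Longrightarrow> N w \<le> d \<Longrightarrow>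
    \<bar>Pot (\<lambda>x. u x + w x + v x) - Pot (\<lambda>x. u x + w x) - dPot u v\<bar> \<le> a * (e + B * (d + d powr p))"
proof -
  obtain K where K: "K \<ge> 1"
    "\<And>u a. u \<in> H \<Longrightarrow> a > 0 \<Longrightarrow> N u \<le> a \<Longrightarrow> (LINT x|\<mu>. \<bar>u x\<bar> powr \<alpha>) \<le> K * a powr \<alpha>"
    "\<And>u a. u \<in> H \<Longrightarrow> a > 0 \<Longrightarrow> N u \<le> a \<Longrightarrow> (LINT x|\<mu>. (u x)\<^sup>2) \<le> K * a\<^sup>2"
    by (rule embedding) (rule that)
  define U where "U = (LINT x|\<mu>. \<bar>u x\<bar> powr \<alpha>)"
  have U: "U \<ge> 0" by (simp add: U_def)
  define V where "V = measure \<mu> \<Omega>"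
  have V: "V \<ge> 0" by (simp add: V_def)
  define A where "A = V + 2 * K + U"
  have A: "A > 0" using V K(1) U by (simp add: A_def)
  define e' where "e' = e / A"
  have e': "e' > 0" "e' * A = e" using e A by (simp_all add: e'_def)
  obtain C where C: "C \<ge> 0" "\<And>a c b. \<bar>F (a + c + b) - F (a + c) - f a * b\<bar>
    \<le> \<bar>b\<bar> * (e' * (1 + \<bar>a\<bar> powr p) + C * (\<bar>c\<bar> + \<bar>b\<bar> + \<bar>c\<bar> powr p + \<bar>b\<bar> powr p))"
    by (rule F_taylor[OF e'(1)]) (rule that)
  define B where "B = C * (3 * K)"
  have B: "B \<ge> 0" using C(1) K(1) by (simp add: B_def)
  show ?thesis
  proof (rule that[OF B])
    fix v w a d assume v: "v \<in> H" and w: "w \<in> H" and a: "0 < a" "a \<le> d" and Nv: "N v \<le> a" and Nw: "N w \<le> d"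
    have d: "d > 0" using a by simp
    let ?X = "\<lambda>x. F (u x + w x + v x) - F (u x + w x) - f (u x) * v x"
    define G where "G x = e' * (a * (1 + (v x)\<^sup>2 / a\<^sup>2) + a * (\<bar>v x\<bar> powr \<alpha> / a powr \<alpha> + \<bar>u x\<bar> powr \<alpha>))
      + C * (a * d * ((v x)\<^sup>2 / a\<^sup>2 + (w x)\<^sup>2 / d\<^sup>2) + (v x)\<^sup>2
        + a * d powr p * (\<bar>v x\<bar> powr \<alpha> / a powr \<alpha> + \<bar>w x\<bar> powr \<alpha> / d powr \<alpha>) + \<bar>v x\<bar> powr \<alpha>)" for x
    have iX: "integrable \<mu> ?X"
      using integrable_F[OF H_add[OF H_add[OF u w] v]] integrable_F[OF H_add[OF u w]] integrable_f[OF u v] by simp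
    note int = integrable_powr[OF v] integrable_powr[OF w] integrable_powr[OF u] integrable_square[OF v] integrable_square[OF w]
    have iG: "integrable \<mu> G" unfolding G_def using int by simp
    have XG: "\<bar>?X x\<bar> \<le> G x" for x
    proof -
      have 1: "\<bar>v x\<bar> \<le> a * (1 + (v x)\<^sup>2 / a\<^sup>2)"
      proof -
        define y where "y = \<bar>v x / a\<bar>"
        have "y \<ge> 0" "2 * y * 1 \<le> y\<^sup>2 + 1\<^sup>2" by (simp add: y_def) (rule sum_squares_bound)
        then have "y \<le> 1 + y\<^sup>2" by simp
        then have "\<bar>v x / a\<bar> \<le> 1 + (v x)\<^sup>2 / a\<^sup>2" by (simp add: y_def power_divide)
        then have "a * \<bar>v x / a\<bar> \<le> a * (1 + (v x)\<^sup>2 / a\<^sup>2)" using a by (intro mult_left_mono) auto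
        then show ?thesis using a by (simp add: abs_divide)
      qed
      have 2: "\<bar>v x\<bar> * \<bar>u x\<bar> powr p \<le> a * (\<bar>v x\<bar> powr \<alpha> / a powr \<alpha> + \<bar>u x\<bar> powr \<alpha>)"
        using mult_powr_le_scaled[of "\<bar>v x\<bar>" "\<bar>u x\<bar>" p a 1] a \<alpha>_range by simp
      have 3: "\<bar>v x\<bar> * \<bar>w x\<bar> \<le> a * d * ((v x)\<^sup>2 / a\<^sup>2 + (w x)\<^sup>2 / d\<^sup>2)"
        using mult_powr_le_scaled[of "\<bar>v x\<bar>" "\<bar>w x\<bar>" 1 a d] a d by simp
      have 4: "\<bar>v x\<bar> * \<bar>w x\<bar> powr p \<le> a * d powr p * (\<bar>v x\<bar> powr \<alpha> / a powr \<alpha> + \<bar>w x\<bar> powr \<alpha> / d powr \<alpha>)"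
        using mult_powr_le_scaled[of "\<bar>v x\<bar>" "\<bar>w x\<bar>" p a d] a d \<alpha>_range by simp
      have 5: "\<bar>v x\<bar> * \<bar>v x\<bar> powr p = \<bar>v x\<bar> powr \<alpha>"
        by (cases "v x = 0") (auto simp: powr_mult_base)
      have "\<bar>?X x\<bar> \<le> \<bar>v x\<bar> * (e' * (1 + \<bar>u x\<bar> powr p) + C * (\<bar>w x\<bar> + \<bar>v x\<bar> + \<bar>w x\<bar> powr p + \<bar>v x\<bar> powr p))"
        by (rule C(2))
      also have "\<dots> = e' * (\<bar>v x\<bar> + \<bar>v x\<bar> * \<bar>u x\<bar> powr p)
         + C * (\<bar>v x\<bar> * \<bar>w x\<bar> + (v x)\<^sup>2 + \<bar>v x\<bar> * \<bar>w x\<bar> powr p + \<bar>v x\<bar> * \<bar>v x\<bar> powr p)"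
        by (simp add: algebra_simps power2_eq_square)
      also have "\<dots> \<le> G x"
        unfolding G_def 5 using e' C(1) 1 2 3 4 by (intro add_mono mult_left_mono) auto
      finally show ?thesis .
    qed
    have pv: "(LINT x|\<mu>. \<bar>v x\<bar> powr \<alpha>) / a powr \<alpha> \<le> K" "(LINT x|\<mu>. (v x)\<^sup>2) / a\<^sup>2 \<le> K"
      using K(2)[OF v a(1) Nv] K(3)[OF v a(1) Nv] a by (simp_all add: divide_le_eq)
    have pw: "(LINT x|\<mu>. \<bar>w x\<bar> powr \<alpha>) / d powr \<alpha> \<le> K" "(LINT x|\<mu>. (w x)\<^sup>2) / d\<^sup>2 \<le> K"
      using K(2)[OF w d Nw] K(3)[OF w d Nw] d by (simp_all add: divide_le_eq)
    have v2: "(LINT x|\<mu>. (v x)\<^sup>2) \<le> a * d * K"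
    proof -
      have "K * a\<^sup>2 \<le> K * (a * d)" using a K(1) by (simp add: power2_eq_square)
      then show ?thesis using K(3)[OF v a(1) Nv] by (simp add: mult.commute)
    qed
    have v\<alpha>: "(LINT x|\<mu>. \<bar>v x\<bar> powr \<alpha>) \<le> a * d powr p * K"
    proof -
      have "a powr \<alpha> = a * a powr p" using a by (simp add: powr_mult_base)
      also have "\<dots> \<le> a * d powr p" using a \<alpha> by (intro mult_left_mono powr_mono2) auto
      finally have "K * a powr \<alpha> \<le> K * (a * d powr p)" using K(1) by (intro mult_left_mono) auto
      then show ?thesis using K(2)[OF v a(1) Nv] by (simp add: mult.commute)
    qed
    have "\<bar>LINT x|\<mu>. ?X x\<bar> \<le> (LINT x|\<mu>. \<bar>?X x\<bar>)" by (rule integral_abs_bound)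
    also have "\<dots> \<le> (LINT x|\<mu>. G x)" using iX iG XG by (intro integral_mono) auto
    also have "\<dots> = e' * (a * (V + (LINT x|\<mu>. (v x)\<^sup>2) / a\<^sup>2) + a * ((LINT x|\<mu>. \<bar>v x\<bar> powr \<alpha>) / a powr \<alpha> + U))
      + C * (a * d * ((LINT x|\<mu>. (v x)\<^sup>2) / a\<^sup>2 + (LINT x|\<mu>. (w x)\<^sup>2) / d\<^sup>2) + (LINT x|\<mu>. (v x)\<^sup>2)
        + a * d powr p * ((LINT x|\<mu>. \<bar>v x\<bar> powr \<alpha>) / a powr \<alpha> + (LINT x|\<mu>. \<bar>w x\<bar> powr \<alpha>) / d powr \<alpha>) + (LINT x|\<mu>. \<bar>v x\<bar> powr \<alpha>))"
      unfolding G_def U_def V_def using int by (simp add: space_\<mu>)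
    also have "\<dots> \<le> e' * (a * (V + K) + a * (K + U)) + C * (a * d * (K + K) + a * d * K + a * d powr p * (K + K) + a * d powr p * K)"
      using e' a d C(1) pv pw v2 v\<alpha> by (intro add_mono mult_left_mono add_left_mono) auto
    also have "\<dots> = a * (e' * A + B * (d + d powr p))" by (simp add: A_def B_def algebra_simps)
    finally have "\<bar>LINT x|\<mu>. ?X x\<bar> \<le> a * (e + B * (d + d powr p))" unfolding e'(2) .
    moreover have "(LINT x|\<mu>. ?X x) = Pot (\<lambda>x. u x + w x + v x) - Pot (\<lambda>x. u x + w x) - dPot u v"
      unfolding Pot_def dPot_def
      using integrable_F[OF H_add[OF H_add[OF u w] v]] integrable_F[OF H_add[OF u w]] integrable_f[OF u v] by simp
    ultimately show "\<bar>Pot (\<lambda>x. u x + w x + v x) - Pot (\<lambda>x. u x + w x) - dPot u v\<bar> \<le> a * (e + B * (d + d powr p))" by simp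
  qed
qed

text \<open>With \<open>w = 0\<close> this is Frechet differentiability. The moving base point \<open>u + w\<close> is needed in
  \<open>minimax_critical\<close>.\<close>

lemma Pot_strict_derivative:
  assumes u: "u \<in> H" and e: "e > 0"
  obtains d where "d > 0" "\<And>v w. v \<in> H \<Longrightarrow> w \<in> H \<Longrightarrow> N v \<le> d \<Longrightarrow> N w \<le> d \<Longrightarrow>
    \<bar>Pot (\<lambda>x. u x + w x + v x) - Pot (\<lambda>x. u x + w x) - dPot u v\<bar> \<le> e * N v"
proof -
  have e2: "e / 2 > 0" using e by simp
  obtain B where B: "B \<ge> 0" "\<And>v w a d. v \<in> H \<Longrightarrow> w \<in> H \<Longrightarrow> 0 < a \<Longrightarrow> a \<le> d \<Longrightarrow> N v \<le> a \<Longrightarrow> N w \<le> d \<Longrightarrow>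
    \<bar>Pot (\<lambda>x. u x + w x + v x) - Pot (\<lambda>x. u x + w x) - dPot u v\<bar> \<le> a * (e / 2 + B * (d + d powr p))"
    by (rule Pot_taylor_bound[OF u e2]) (rule that)
  define d where "d = min 1 (e / (4 * (B + 1)))"
  have d: "d > 0" "d \<le> 1" using e B(1) by (auto simp: d_def)
  have "d powr p \<le> d powr 1" using d \<alpha> by (intro powr_mono') auto
  then have "B * (d + d powr p) \<le> B * (2 * d)" using B(1) d by (intro mult_left_mono) auto
  also have "\<dots> \<le> (B + 1) * (2 * d)" using d by simp
  also have "\<dots> \<le> (B + 1) * (2 * (e / (4 * (B + 1))))" using B(1) by (intro mult_left_mono) (auto simp: d_def)
  also have "\<dots> = e / 2" using B(1) by (simp add: field_simps)
  finally have dB: "e / 2 + B * (d + d powr p) \<le> e" by simp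
  show ?thesis
  proof (rule that[OF d(1)])
    fix v w assume vw: "v \<in> H" "w \<in> H" "N v \<le> d" "N w \<le> d"
    let ?X = "\<bar>Pot (\<lambda>x. u x + w x + v x) - Pot (\<lambda>x. u x + w x) - dPot u v\<bar>"
    have X: "?X \<le> a * e" if a: "0 < a" "a \<le> d" "N v \<le> a" for a
      by (rule order_trans[OF B(2)[OF vw(1,2) a vw(4)] mult_left_mono[OF dB less_imp_le[OF a(1)]]])
    show "?X \<le> e * N v"
    proof (cases "N v > 0")
      case True
      then show ?thesis using X[OF True vw(3)] by (simp add: mult.commute)
    next
      case False
      then have 0: "N v = 0" using N_nonneg[of v] by simp
      \<comment> \<open>The bound \<open>a e\<close> holds for every small \<open>a > 0\<close>, and \<open>a\<close> tends to \<open>0\<close>.\<close>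
      have "?X \<le> 0 + y" if y: "y > 0" for y
      proof -
        have "?X \<le> min d (y / e) * e" using d y e 0 by (intro X) auto
        also have "\<dots> \<le> y / e * e" using e by (intro mult_right_mono) auto
        finally show ?thesis using e by simp
      qed
      then have "?X \<le> 0" by (rule field_le_epsilon)
      then show ?thesis using 0 by simp
    qed
  qed
qed

lemma M_positive: "t \<ge> 0 \<Longrightarrow> M t > 0"
  using M_mono M_pos strict_mono_onD[OF M_mono, of 0 t] by (cases "t = 0") auto

lemma M_mono_le: "0 \<le> s \<Longrightarrow> s \<le> t \<Longrightarrow> M s \<le> M t"
  using strict_mono_onD[OF M_mono, of s t] by (cases "s = t") auto

lemma M_hat_derivative: "0 \<le> t \<Longrightarrow> t \<le> T \<Longrightarrow> (primitive M has_real_derivative M t) (at t within {0..T})"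
  by (rule primitive_has_derivative) (auto intro: continuous_on_subset[OF M_cont])

lemma M_hat_mvt:
  assumes "0 \<le> a" "0 \<le> b"
  obtains x where "\<bar>x - a\<bar> \<le> \<bar>b - a\<bar>" "0 \<le> x" "primitive M b - primitive M a = M x * (b - a)"
proof -
  have *: "\<exists>x\<in>{a..b}. primitive M b - primitive M a = M x * (b - a)" if "0 \<le> a" "a \<le> b" for a b
  proof (rule mvt_very_simple[OF that(2)])
    show "(primitive M has_derivative (*) (M x)) (at x within {a..b})" if "a \<le> x" "x \<le> b" for x
      using has_field_derivative_subset[OF M_hat_derivative[of x b], of "{a..b}"] that \<open>0 \<le> a\<close>
      by (simp add: has_field_derivative_def)
  qed
  show ?thesis
  proof (cases "a \<le> b")
    case True
    then obtain x where "x \<in> {a..b}" "primitive M b - primitive M a = M x * (b - a)" using *[OF assms(1), of b] by auto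
    then show ?thesis using assms by (intro that[of x]) auto
  next
    case False
    then obtain x where "x \<in> {b..a}" "primitive M a - primitive M b = M x * (a - b)" using *[OF assms(2), of a] by auto
    then show ?thesis using assms by (intro that[of x]) (auto simp: algebra_simps)
  qed
qed

text \<open>The mean value theorem for the primitive of \<open>M\<close>, the expansion of the square of the norm, and the
  continuity of \<open>M\<close> at \<open>\<parallel>u\<parallel>\<^sup>2\<close>.\<close>

lemma M_hat_strict_derivative:
  assumes u: "u \<in> H" and e: "e > 0"
  obtains d where "d > 0" "\<And>v w. v \<in> H \<Longrightarrow> w \<in> H \<Longrightarrow> N v \<le> d \<Longrightarrow> N w \<le> d \<Longrightarrow>
    \<bar>primitive M ((N (\<lambda>x. u x + w x + v x))\<^sup>2) - primitive M ((N (\<lambda>x. u x + w x))\<^sup>2) - 2 * M ((N u)\<^sup>2) * ip u v\<bar> \<le> e * N v"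
proof -
  define n where "n = N u"
  have n: "n \<ge> 0" by (simp add: n_def N_nonneg)
  define m where "m = M (n\<^sup>2)"
  have m: "m > 0" unfolding m_def by (rule M_positive) simp
  define e' where "e' = e / (2 * (2 * n + 3))"
  have e': "e' > 0" "e' * (2 * n + 3) = e / 2" using e n by (simp_all add: e'_def field_simps add_nonneg_pos)
  have "continuous (at (n\<^sup>2) within {0..}) M" using M_cont by (simp add: continuous_on_eq_continuous_within)
  then obtain \<delta> where \<delta>: "\<delta> > 0" "\<And>x. x \<ge> 0 \<Longrightarrow> \<bar>x - n\<^sup>2\<bar> < \<delta> \<Longrightarrow> \<bar>M x - m\<bar> < e'"
    using e'(1) unfolding continuous_within_eps_delta m_def by (auto simp: dist_real_def)
  define d where "d = min 1 (min (\<delta> / (2 * (4 * n + 6))) (e / (6 * m)))"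
  have d: "d > 0" "d \<le> 1" "d \<le> \<delta> / (2 * (4 * n + 6))" "d \<le> e / (6 * m)"
    using \<delta>(1) n e m by (auto simp: d_def)
  have d1: "(4 * n + 6) * d < \<delta>"
  proof -
    have "(4 * n + 6) * d \<le> (4 * n + 6) * (\<delta> / (2 * (4 * n + 6)))" using d(3) n by (intro mult_left_mono) auto
    also have "\<dots> = \<delta> / 2" using n by (simp add: field_simps add_nonneg_pos)
    finally show ?thesis using \<delta>(1) by simp
  qed
  have d2: "m * (3 * d) \<le> e / 2" using d(4) m by (simp add: field_simps)
  show ?thesis
  proof (rule that[OF d(1)])
    fix v w assume v: "v \<in> H" and w: "w \<in> H" and Nv: "N v \<le> d" and Nw: "N w \<le> d"
    have uw: "(\<lambda>x. u x + w x) \<in> H" by (rule H_add[OF u w])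
    define s t where "s = (N (\<lambda>x. u x + w x))\<^sup>2" and "t = (N (\<lambda>x. u x + w x + v x))\<^sup>2"
    have st0: "s \<ge> 0" "t \<ge> 0" by (simp_all add: s_def t_def)
    have s: "s = n\<^sup>2 + 2 * ip u w + (N w)\<^sup>2" using N_lincomb[OF u w, of 1] by (simp add: s_def n_def)
    have t: "t = s + 2 * ip (\<lambda>x. u x + w x) v + (N v)\<^sup>2" using N_lincomb[OF uw v, of 1] by (simp add: s_def t_def)
    have ipw: "ip (\<lambda>x. u x + w x) v = ip u v + ip w v" using ip_lincomb[OF u w v, of 1] by simp
    have ts_eq: "t - s = 2 * ip u v + 2 * ip w v + (N v)\<^sup>2" using t ipw by simp
    have b1: "\<bar>ip u w\<bar> \<le> n * d" using ip_bound[OF u w] mult_left_mono[OF Nw n] by (simp add: n_def)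
    have b2: "\<bar>ip u v\<bar> \<le> n * N v" using ip_bound[OF u v] by (simp add: n_def)
    have b3: "\<bar>ip w v\<bar> \<le> d * N v" using ip_bound[OF w v] mult_right_mono[OF Nw N_nonneg[of v]] by simp
    have b4: "(N w)\<^sup>2 \<le> d" "(N v)\<^sup>2 \<le> d * N v"
    proof -
      have "(N w)\<^sup>2 \<le> d\<^sup>2" by (intro power_mono Nw N_nonneg)
      also have "\<dots> \<le> d" using d by (simp add: power2_eq_square mult_left_le)
      finally show "(N w)\<^sup>2 \<le> d" .
      show "(N v)\<^sup>2 \<le> d * N v" using mult_right_mono[OF Nv N_nonneg[of v]] by (simp add: power2_eq_square)
    qed
    have sn: "\<bar>s - n\<^sup>2\<bar> \<le> (2 * n + 1) * d"
    proof -
      have "\<bar>s - n\<^sup>2\<bar> \<le> 2 * (n * d) + d" unfolding s using b1 b4(1) zero_le_power2[of "N w"] by linarith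
      then show ?thesis by (simp add: algebra_simps)
    qed
    have dN: "d * N v \<le> N v" using d(2) N_nonneg[of v] by (simp add: mult_left_le_one_le d(1) less_imp_le)
    have ts: "\<bar>t - s\<bar> \<le> (2 * n + 3) * N v"
    proof -
      have *: "\<bar>A\<bar> \<le> n' \<Longrightarrow> \<bar>B\<bar> \<le> d' \<Longrightarrow> Q \<le> d' \<Longrightarrow> d' \<le> y \<Longrightarrow> 0 \<le> Q \<Longrightarrow> \<bar>2 * A + 2 * B + Q\<bar> \<le> 2 * n' + 3 * y"
        for A B Q n' d' y :: real by (simp add: abs_le_iff)
      have "\<bar>t - s\<bar> \<le> 2 * (n * N v) + 3 * N v"
        unfolding ts_eq by (rule *[OF b2 b3 b4(2) dN zero_le_power2])
      then show ?thesis by (simp add: algebra_simps)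
    qed
    obtain \<xi> where \<xi>: "\<bar>\<xi> - s\<bar> \<le> \<bar>t - s\<bar>" "\<xi> \<ge> 0" "primitive M t - primitive M s = M \<xi> * (t - s)"
      by (rule M_hat_mvt[OF st0]) (rule that)
    have "(2 * n + 3) * N v \<le> (2 * n + 3) * d" using Nv n by (intro mult_left_mono) auto
    then have "\<bar>\<xi> - n\<^sup>2\<bar> \<le> (2 * n + 3) * d + (2 * n + 1) * d" using \<xi>(1) ts sn by linarith
    also have "\<dots> \<le> (4 * n + 6) * d" using d(1) by (simp add: algebra_simps)
    also have "\<dots> < \<delta>" by (rule d1)
    finally have M\<xi>: "\<bar>M \<xi> - m\<bar> \<le> e'" using \<delta>(2)[OF \<xi>(2)] by simp
    have "primitive M t - primitive M s - 2 * m * ip u v = (M \<xi> - m) * (t - s) + (m * (t - s) - 2 * m * ip u v)"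
      unfolding \<xi>(3) by (simp add: algebra_simps)
    also have "m * (t - s) - 2 * m * ip u v = m * (2 * ip w v + (N v)\<^sup>2)"
      unfolding ts_eq by (simp add: algebra_simps)
    finally have eq: "primitive M t - primitive M s - 2 * m * ip u v = (M \<xi> - m) * (t - s) + m * (2 * ip w v + (N v)\<^sup>2)" .
    have "\<bar>primitive M t - primitive M s - 2 * m * ip u v\<bar> = \<bar>(M \<xi> - m) * (t - s) + m * (2 * ip w v + (N v)\<^sup>2)\<bar>"
      by (simp only: eq)
    also have "\<dots> \<le> e' * ((2 * n + 3) * N v) + m * (3 * d * N v)"
    proof -
      have "\<bar>(M \<xi> - m) * (t - s)\<bar> \<le> e' * ((2 * n + 3) * N v)"
        unfolding abs_mult using M\<xi> ts e' by (intro mult_mono) auto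
      moreover have "\<bar>m * (2 * ip w v + (N v)\<^sup>2)\<bar> \<le> m * (3 * d * N v)"
      proof -
        have *: "\<bar>B\<bar> \<le> d' \<Longrightarrow> Q \<le> d' \<Longrightarrow> 0 \<le> Q \<Longrightarrow> \<bar>2 * B + Q\<bar> \<le> 3 * d'" for B Q d' :: real
          by (simp add: abs_le_iff)
        have "\<bar>2 * ip w v + (N v)\<^sup>2\<bar> \<le> 3 * d * N v"
          using *[OF b3 b4(2) zero_le_power2] by (simp only: mult.assoc)
        then show ?thesis unfolding abs_mult using m by (intro mult_mono) auto
      qed
      ultimately show ?thesis by linarith
    qed
    also have "\<dots> = (e' * (2 * n + 3) + m * (3 * d)) * N v" by (simp add: algebra_simps)
    also have "\<dots> \<le> e * N v" using d2 e'(2) N_nonneg[of v] by (intro mult_right_mono) auto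
    finally show "\<bar>primitive M ((N (\<lambda>x. u x + w x + v x))\<^sup>2) - primitive M ((N (\<lambda>x. u x + w x))\<^sup>2) - 2 * M ((N u)\<^sup>2) * ip u v\<bar> \<le> e * N v"
      by (simp add: s_def t_def m_def n_def)
  qed
qed

lemma J_strict_derivative:
  assumes u: "u \<in> H" and e: "e > 0"
  obtains d where "d > 0" "\<And>v w. v \<in> H \<Longrightarrow> w \<in> H \<Longrightarrow> N v \<le> d \<Longrightarrow> N w \<le> d \<Longrightarrow>
    \<bar>J (\<lambda>x. u x + w x + v x) - J (\<lambda>x. u x + w x) - J' u v\<bar> \<le> e * N v"
proof -
  have e2: "e / 2 > 0" using e by simp
  obtain d1 where d1: "d1 > 0" "\<And>v w. v \<in> H \<Longrightarrow> w \<in> H \<Longrightarrow> N v \<le> d1 \<Longrightarrow> N w \<le> d1 \<Longrightarrow>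
    \<bar>Pot (\<lambda>x. u x + w x + v x) - Pot (\<lambda>x. u x + w x) - dPot u v\<bar> \<le> e / 2 * N v"
    by (rule Pot_strict_derivative[OF u e2]) (rule that)
  obtain d2 where d2: "d2 > 0" "\<And>v w. v \<in> H \<Longrightarrow> w \<in> H \<Longrightarrow> N v \<le> d2 \<Longrightarrow> N w \<le> d2 \<Longrightarrow>
    \<bar>primitive M ((N (\<lambda>x. u x + w x + v x))\<^sup>2) - primitive M ((N (\<lambda>x. u x + w x))\<^sup>2) - 2 * M ((N u)\<^sup>2) * ip u v\<bar> \<le> e * N v"
    by (rule M_hat_strict_derivative[OF u e]) (rule that)
  show ?thesis
  proof (rule that[of "min d1 d2"])
    fix v w assume vw: "v \<in> H" "w \<in> H" "N v \<le> min d1 d2" "N w \<le> min d1 d2"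
    define a b where "a = Pot (\<lambda>x. u x + w x + v x) - Pot (\<lambda>x. u x + w x) - dPot u v"
      and "b = primitive M ((N (\<lambda>x. u x + w x + v x))\<^sup>2) - primitive M ((N (\<lambda>x. u x + w x))\<^sup>2) - 2 * M ((N u)\<^sup>2) * ip u v"
    have "\<bar>a\<bar> \<le> e / 2 * N v" "\<bar>b\<bar> \<le> e * N v" using d1(2)[OF vw(1,2)] d2(2)[OF vw(1,2)] vw(3,4) by (auto simp: a_def b_def)
    moreover have "J (\<lambda>x. u x + w x + v x) - J (\<lambda>x. u x + w x) - J' u v = b / 2 - a"
      by (simp add: a_def b_def J_eq J'_def field_simps)
    ultimately show "\<bar>J (\<lambda>x. u x + w x + v x) - J (\<lambda>x. u x + w x) - J' u v\<bar> \<le> e * N v" by linarith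
  qed (use d1(1) d2(1) in simp)
qed

lemma critical_pointI:
  assumes u: "u \<in> H" and J': "\<And>v. v \<in> H \<Longrightarrow> J' u v = 0"
  shows "critical_point \<Omega> J u"
  unfolding critical_point_def has_H01_derivative_def
proof (intro conjI u allI impI ballI)
  show "\<exists>C. \<forall>v\<in>H. \<bar>0\<bar> \<le> C * N v" by (intro exI[of _ 0]) simp
  fix e :: real assume e: "e > 0"
  obtain d where d: "d > 0" "\<And>v w. v \<in> H \<Longrightarrow> w \<in> H \<Longrightarrow> N v \<le> d \<Longrightarrow> N w \<le> d \<Longrightarrow>
    \<bar>J (\<lambda>x. u x + w x + v x) - J (\<lambda>x. u x + w x) - J' u v\<bar> \<le> e * N v"
    by (rule J_strict_derivative[OF u e]) (rule that)
  show "\<exists>d>0. \<forall>v\<in>H. N v < d \<longrightarrow> \<bar>J (\<lambda>x. u x + v x) - J u - 0\<bar> \<le> e * N v"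
    using d(1) d(2)[OF _ H_zero] J' by (intro exI[of _ d]) (auto simp: N_zero)
qed simp_all

lemma line_derivative:
  assumes u: "u \<in> H" and v: "v \<in> H"
  shows "((\<lambda>h. J (\<lambda>x. u x + h * v x)) has_real_derivative J' u v) (at 0)"
  unfolding DERIV_def
proof (rule LIM_I)
  fix r :: real assume r: "r > 0"
  define Q where "Q = N v + 1"
  define e where "e = r / (2 * Q)"
  have Q: "Q > 0" unfolding Q_def using N_nonneg[of v] by simp
  have e: "e > 0" using r Q by (simp add: e_def)
  then have "e * N v \<le> e * Q" by (simp add: Q_def)
  also have "\<dots> = r / 2" using Q by (simp add: e_def)
  finally have er: "e * N v < r" using r by simp
  obtain d where d: "d > 0" "\<And>v w. v \<in> H \<Longrightarrow> w \<in> H \<Longrightarrow> N v \<le> d \<Longrightarrow> N w \<le> d \<Longrightarrow>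
    \<bar>J (\<lambda>x. u x + w x + v x) - J (\<lambda>x. u x + w x) - J' u v\<bar> \<le> e * N v"
    by (rule J_strict_derivative[OF u e]) (rule that)
  show "\<exists>s>0. \<forall>h. h \<noteq> 0 \<and> norm (h - 0) < s \<longrightarrow> norm ((J (\<lambda>x. u x + (0 + h) * v x) - J (\<lambda>x. u x + 0 * v x)) / h - J' u v) < r"
  proof (intro exI[of _ "d / Q"] conjI allI impI)
    show "d / Q > 0" using d(1) Q by simp
    fix h :: real assume h: "h \<noteq> 0 \<and> norm (h - 0) < d / Q"
    have "\<bar>h\<bar> * N v \<le> d / Q * Q" using h N_nonneg[of v] d(1) Q by (intro mult_mono) (auto simp: Q_def)
    then have "N (\<lambda>x. h * v x) \<le> d" using Q by (simp add: N_cmult[OF v])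
    from d(2)[OF H_cmult[OF v] H_zero this]
    have "\<bar>J (\<lambda>x. u x + h * v x) - J u - h * J' u v\<bar> \<le> e * (\<bar>h\<bar> * N v)"
      using d(1) by (simp add: N_zero N_cmult[OF v] J'_cmult[OF u v])
    moreover have "((J (\<lambda>x. u x + h * v x) - J u) / h - J' u v) * h = J (\<lambda>x. u x + h * v x) - J u - h * J' u v"
      unfolding left_diff_distrib using h by simp
    ultimately have "\<bar>(J (\<lambda>x. u x + h * v x) - J u) / h - J' u v\<bar> * \<bar>h\<bar> \<le> e * N v * \<bar>h\<bar>"
      unfolding abs_mult[symmetric] by (simp only: mult_ac)
    then have "\<bar>(J (\<lambda>x. u x + h * v x) - J u) / h - J' u v\<bar> \<le> e * N v" using h by simp
    then show "norm ((J (\<lambda>x. u x + (0 + h) * v x) - J (\<lambda>x. u x + 0 * v x)) / h - J' u v) < r"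
      using er by simp
  qed
qed

lemma ray_derivative:
  assumes u: "u \<in> H"
  shows "((\<lambda>t. J (\<lambda>x. t * u x)) has_real_derivative J' (\<lambda>x. t * u x) u) (at t)"
proof -
  have "((\<lambda>h. J (\<lambda>x. (h + t) * u x)) has_real_derivative J' (\<lambda>x. t * u x) u) (at 0)"
    using line_derivative[OF H_cmult[OF u] u, of t] by (simp add: distrib_right add.commute)
  then show ?thesis using DERIV_shift[of "\<lambda>t. J (\<lambda>x. t * u x)" _ 0 t] by simp
qed

lemma critical_point_ray:
  assumes "critical_point \<Omega> J u"
  shows "u \<in> H" "J' u u = 0"
proof -
  show u: "u \<in> H" using assms by (simp add: critical_point_def)
  have D: "\<And>e. e > 0 \<Longrightarrow> \<exists>d>0. \<forall>v\<in>H. N v < d \<longrightarrow> \<bar>J (\<lambda>x. u x + v x) - J u - 0\<bar> \<le> e * N v"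
    using assms by (simp add: critical_point_def has_H01_derivative_def)
  have "((\<lambda>t. J (\<lambda>x. t * u x)) has_real_derivative 0) (at 1)"
    unfolding DERIV_def
  proof (rule LIM_I)
    fix r :: real assume r: "r > 0"
    define Q where "Q = N u + 1"
    have n: "N u + 1 > 0" "Q > 0" using N_nonneg[of u] by (simp_all add: Q_def)
    define e where "e = r / (2 * Q)"
    have e: "e > 0" using r n by (simp add: e_def)
    then have "e * N u \<le> e * Q" by (simp add: Q_def)
    also have "\<dots> = r / 2" using n by (simp add: e_def)
    finally have er: "e * N u < r" using r by simp
    obtain d where d: "d > 0" "\<And>v. v \<in> H \<Longrightarrow> N v < d \<Longrightarrow> \<bar>J (\<lambda>x. u x + v x) - J u - 0\<bar> \<le> e * N v"
      using D[OF e] by blast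
    show "\<exists>s>0. \<forall>h. h \<noteq> 0 \<and> norm (h - 0) < s \<longrightarrow> norm ((J (\<lambda>x. (1 + h) * u x) - J (\<lambda>x. 1 * u x)) / h - 0) < r"
    proof (intro exI[of _ "d / (N u + 1)"] conjI allI impI)
      show "d / (N u + 1) > 0" using d(1) n by simp
      fix h :: real assume h: "h \<noteq> 0 \<and> norm (h - 0) < d / (N u + 1)"
      have "\<bar>h\<bar> * N u \<le> \<bar>h\<bar> * (N u + 1)" by (intro mult_left_mono) auto
      also have "\<dots> < d / (N u + 1) * (N u + 1)" using h n by (intro mult_strict_right_mono) auto
      finally have "N (\<lambda>x. h * u x) < d" using n by (simp add: N_cmult[OF u])
      note d(2)[OF H_cmult[OF u] this]
      moreover have "(\<lambda>x. (1 + h) * u x) = (\<lambda>x. u x + h * u x)" by (simp add: distrib_right)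
      ultimately have "\<bar>J (\<lambda>x. (1 + h) * u x) - J u\<bar> \<le> e * N u * \<bar>h\<bar>" by (simp add: N_cmult[OF u] mult_ac)
      then have "\<bar>(J (\<lambda>x. (1 + h) * u x) - J u) / h\<bar> \<le> e * N u"
        using h by (simp add: abs_divide divide_le_eq)
      then show "norm ((J (\<lambda>x. (1 + h) * u x) - J (\<lambda>x. 1 * u x)) / h - 0) < r" using er by simp
    qed
  qed
  from DERIV_unique[OF this ray_derivative[OF u]] show "J' u u = 0" by simp
qed

text \<open>For every \<open>s > 0\<close> the difference of the integrands is at most \<open>s\<close> times a fixed integrable function
  plus a multiple of \<open>\<bar>u\<^sub>n - v\<bar>\<^sup>2 + \<bar>u\<^sub>n - v\<bar>\<^sup>\<alpha>\<close>; the factor of the latter grows as \<open>s\<close> decreases.\<close>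

lemma Pot_tendsto:
  assumes u: "\<And>n::nat. u n \<in> H" "v \<in> H"
    and l2: "(\<lambda>n. LINT x|\<mu>. (u n x - v x)\<^sup>2) \<longlonglongrightarrow> 0" and l\<alpha>: "(\<lambda>n. LINT x|\<mu>. \<bar>u n x - v x\<bar> powr \<alpha>) \<longlonglongrightarrow> 0"
  shows "(\<lambda>n. Pot (u n)) \<longlonglongrightarrow> Pot v"
proof -
  obtain C where C: "C \<ge> 0" "\<And>a c b. \<bar>F (a + c + b) - F (a + c) - f a * b\<bar>
    \<le> \<bar>b\<bar> * (1 * (1 + \<bar>a\<bar> powr p) + C * (\<bar>c\<bar> + \<bar>b\<bar> + \<bar>c\<bar> powr p + \<bar>b\<bar> powr p))"
    by (rule F_taylor[of 1]) (auto intro: that)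
  obtain K where K: "K \<ge> 0" "\<And>t. \<bar>f t\<bar> \<le> 1 * \<bar>t\<bar> powr p + K" by (rule f_growth[of 1]) (auto intro: that)
  define S where "S = (K + 1) * measure \<mu> \<Omega> + 2 * (LINT x|\<mu>. \<bar>v x\<bar> powr \<alpha>)"
  have S: "S \<ge> 0" using K(1) by (simp add: S_def)
  have wH: "(\<lambda>x. u n x - v x) \<in> H" for n by (rule H_diff[OF u])
  have est: "\<exists>L. \<forall>n. \<bar>Pot (u n) - Pot v\<bar> \<le> s * S + L * (LINT x|\<mu>. (u n x - v x)\<^sup>2) + L * (LINT x|\<mu>. \<bar>u n x - v x\<bar> powr \<alpha>)"
    if s: "0 < s" for s
  proof -
    define L where "L = (K + 1) / s + 2 * s / s powr \<alpha> + C + 2"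
    have mix: "y * z powr p \<le> s * z powr \<alpha> + s / s powr \<alpha> * y powr \<alpha>" if "y \<ge> 0" "z \<ge> 0" for y z :: real
      using mult_powr_le_scaled[of y z p s 1] that s \<alpha>_range by (simp add: algebra_simps)
    have lin: "y \<le> s + y\<^sup>2 / s" if "y \<ge> 0" for y :: real
    proof (cases "y \<le> s")
      case False
      then have "y * s \<le> y * y" using that by (intro mult_left_mono) auto
      then have "y \<le> y\<^sup>2 / s" using s by (simp add: pos_le_divide_eq power2_eq_square)
      then show ?thesis using s by simp
    qed (use s in \<open>simp add: add_increasing2\<close>)
    have pw: "\<bar>F (a + b) - F a\<bar> \<le> s * (K + 1) + 2 * s * \<bar>a\<bar> powr \<alpha> + L * b\<^sup>2 + L * \<bar>b\<bar> powr \<alpha>" for a b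
    proof -
      have b1: "\<bar>b\<bar> * \<bar>b\<bar> powr p = \<bar>b\<bar> powr \<alpha>" by (cases "b = 0") (auto simp: powr_mult_base)
      have "\<bar>F (a + b) - F a - f a * b\<bar> \<le> \<bar>b\<bar> * (1 * (1 + \<bar>a\<bar> powr p) + C * (\<bar>b\<bar> + \<bar>b\<bar> powr p))"
        using C(2)[of a 0 b] \<alpha> by simp
      moreover have "\<bar>f a * b\<bar> \<le> \<bar>b\<bar> * (\<bar>a\<bar> powr p + K)"
        unfolding abs_mult using K(2)[of a] by (simp add: mult.commute mult_left_mono)
      ultimately have "\<bar>F (a + b) - F a\<bar> \<le> \<bar>b\<bar> * (1 * (1 + \<bar>a\<bar> powr p) + C * (\<bar>b\<bar> + \<bar>b\<bar> powr p)) + \<bar>b\<bar> * (\<bar>a\<bar> powr p + K)"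
        by linarith
      also have "\<dots> = (K + 1) * \<bar>b\<bar> + 2 * (\<bar>b\<bar> * \<bar>a\<bar> powr p) + C * b\<^sup>2 + C * (\<bar>b\<bar> * \<bar>b\<bar> powr p)"
        by (simp add: algebra_simps power2_eq_square)
      also have "\<dots> \<le> (K + 1) * (s + \<bar>b\<bar>\<^sup>2 / s) + 2 * (s * \<bar>a\<bar> powr \<alpha> + s / s powr \<alpha> * \<bar>b\<bar> powr \<alpha>) + C * b\<^sup>2 + C * \<bar>b\<bar> powr \<alpha>"
        unfolding b1 using K(1) C(1) by (intro add_mono mult_left_mono lin mix) auto
      also have "\<dots> = s * (K + 1) + 2 * s * \<bar>a\<bar> powr \<alpha> + ((K + 1) / s + C) * b\<^sup>2 + (2 * s / s powr \<alpha> + C) * \<bar>b\<bar> powr \<alpha>"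
        using s by (simp add: field_simps)
      also have "\<dots> \<le> s * (K + 1) + 2 * s * \<bar>a\<bar> powr \<alpha> + L * b\<^sup>2 + L * \<bar>b\<bar> powr \<alpha>"
      proof -
        have "(K + 1) / s + C \<le> L" "2 * s / s powr \<alpha> + C \<le> L" using K(1) C(1) s by (simp_all add: L_def)
        then show ?thesis by (intro add_mono mult_right_mono order_refl) auto
      qed
      finally show ?thesis .
    qed
    have "\<bar>Pot (u n) - Pot v\<bar> \<le> s * S + L * (LINT x|\<mu>. (u n x - v x)\<^sup>2) + L * (LINT x|\<mu>. \<bar>u n x - v x\<bar> powr \<alpha>)" for n
    proof -
      note int = integrable_powr[OF u(2)] integrable_powr[OF wH[of n]] integrable_square[OF wH[of n]]
      have "Pot (u n) - Pot v = (LINT x|\<mu>. F (v x + (u n x - v x)) - F (v x))"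
        using integrable_F[OF u(1)[of n]] integrable_F[OF u(2)] by (simp add: Pot_def)
      also have "\<bar>\<dots>\<bar> \<le> (LINT x|\<mu>. \<bar>F (v x + (u n x - v x)) - F (v x)\<bar>)" by (rule integral_abs_bound)
      also have "\<dots> \<le> (LINT x|\<mu>. s * (K + 1) + 2 * s * \<bar>v x\<bar> powr \<alpha> + L * (u n x - v x)\<^sup>2 + L * \<bar>u n x - v x\<bar> powr \<alpha>)"
      proof (rule integral_mono)
        show "integrable \<mu> (\<lambda>x. \<bar>F (v x + (u n x - v x)) - F (v x)\<bar>)"
          using integrable_F[OF u(1)[of n]] integrable_F[OF u(2)] by simp
        show "integrable \<mu> (\<lambda>x. s * (K + 1) + 2 * s * \<bar>v x\<bar> powr \<alpha> + L * (u n x - v x)\<^sup>2 + L * \<bar>u n x - v x\<bar> powr \<alpha>)"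
          using int by simp
      qed (rule pw)
      also have "\<dots> = s * S + L * (LINT x|\<mu>. (u n x - v x)\<^sup>2) + L * (LINT x|\<mu>. \<bar>u n x - v x\<bar> powr \<alpha>)"
        using int by (simp add: S_def space_\<mu> algebra_simps)
      finally show ?thesis .
    qed
    then show ?thesis by blast
  qed
  show ?thesis
  proof (rule LIMSEQ_I)
    fix e :: real assume e: "e > 0"
    define Q where "Q = S + 1"
    define s where "s = e / (2 * Q)"
    have Q: "Q > 0" using S by (simp add: Q_def)
    have s: "s > 0" using e Q by (simp add: s_def)
    have "s * S \<le> s * Q" using s by (simp add: Q_def)
    also have "\<dots> = e / 2" using Q by (simp add: s_def)
    finally have sS: "s * S \<le> e / 2" .
    obtain L where L: "\<And>n. \<bar>Pot (u n) - Pot v\<bar> \<le> s * S + L * (LINT x|\<mu>. (u n x - v x)\<^sup>2) + L * (LINT x|\<mu>. \<bar>u n x - v x\<bar> powr \<alpha>)"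
      using est[OF s] by blast
    have "(\<lambda>n. L * (LINT x|\<mu>. (u n x - v x)\<^sup>2) + L * (LINT x|\<mu>. \<bar>u n x - v x\<bar> powr \<alpha>)) \<longlonglongrightarrow> L * 0 + L * 0"
      by (intro tendsto_intros l2 l\<alpha>)
    then have "\<forall>\<^sub>F n in sequentially. L * (LINT x|\<mu>. (u n x - v x)\<^sup>2) + L * (LINT x|\<mu>. \<bar>u n x - v x\<bar> powr \<alpha>) < e / 2"
      using e by (intro order_tendstoD(2)) auto
    then obtain n0 where n0: "\<And>n. n \<ge> n0 \<Longrightarrow> L * (LINT x|\<mu>. (u n x - v x)\<^sup>2) + L * (LINT x|\<mu>. \<bar>u n x - v x\<bar> powr \<alpha>) < e / 2"
      by (auto simp: eventually_sequentially)
    show "\<exists>n0. \<forall>n\<ge>n0. norm (Pot (u n) - Pot v) < e"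
    proof (intro exI[of _ n0] allI impI)
      fix n assume "n \<ge> n0"
      then show "norm (Pot (u n) - Pot v) < e" using L[of n] n0[of n] sS by simp
    qed
  qed
qed

end

section \<open>Maximisation along rays\<close>

context kirchhoff begin

lemma J_zero: "J (\<lambda>x. 0) = 0"
  by (simp add: J_eq N_zero primitive_zero Pot_def)

lemma N_ray: "u \<in> H \<Longrightarrow> (N (\<lambda>x. t * u x))\<^sup>2 = t\<^sup>2 * (N u)\<^sup>2"
  by (simp add: N_cmult power_mult_distrib)

lemma ip_ray: "u \<in> H \<Longrightarrow> ip (\<lambda>x. t * u x) u = t * (N u)\<^sup>2"
proof -
  assume u: "u \<in> H"
  have "ip (\<lambda>x. 0) u = 0" using ip_bound[OF H_zero u] by (simp add: N_zero)
  then show ?thesis using ip_lincomb[OF H_zero u u, of t] by (simp add: ip_self[OF u])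
qed

lemma f_ray_mono:
  assumes "0 < s" "s < t"
  shows "f (s * y) * y / s ^ 3 \<le> f (t * y) * y / t ^ 3"
proof -
  have abs: "f (s * y) * y = f (s * \<bar>y\<bar>) * \<bar>y\<bar>" for s
    using f_odd[of "s * y"] by (cases "y \<ge> 0") auto
  show ?thesis
  proof (cases "y = 0")
    case False
    define a where "a = \<bar>y\<bar>"
    have a: "a > 0" using False by (simp add: a_def)
    have "f (s * a) / (s * a) ^ 3 < f (t * a) / (t * a) ^ 3"
      using assms a by (intro strict_mono_onD[OF f_ratio]) auto
    then have "f (s * a) / (s * a) ^ 3 * a ^ 4 \<le> f (t * a) / (t * a) ^ 3 * a ^ 4"
      using a by (intro mult_right_mono) auto
    moreover have "X / (s * a) ^ 3 * a ^ 4 = X * a / s ^ 3" if "s > 0" for X s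
      using that a by (simp add: power_mult_distrib eval_nat_numeral)
    ultimately have "f (s * a) * a / s ^ 3 \<le> f (t * a) * a / t ^ 3" using assms by simp
    then show ?thesis unfolding abs a_def .
  qed simp
qed

text \<open>With \<open>n = \<parallel>u\<parallel>\<^sup>2\<close>, the quotient is \<open>n\<^sup>2 M(t\<^sup>2 n) / (t\<^sup>2 n) - \<integral> f(t u) u / t\<^sup>3\<close>: the first term decreases
  strictly in \<open>t\<close>, and the integrand increases.\<close>

lemma ray_slope_decreasing:
  assumes u: "u \<in> H" "N u > 0" and st: "0 < s" "s < t"
  shows "J' (\<lambda>x. t * u x) u / t ^ 3 < J' (\<lambda>x. s * u x) u / s ^ 3"
proof -
  define n where "n = (N u)\<^sup>2"
  have n: "n > 0" using u(2) by (simp add: n_def)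
  have slope: "J' (\<lambda>x. t * u x) u / t ^ 3 = n\<^sup>2 * (M (t\<^sup>2 * n) / (t\<^sup>2 * n)) - (LINT x|\<mu>. f (t * u x) * u x / t ^ 3)"
    if t: "t > 0" for t
  proof -
    have "J' (\<lambda>x. t * u x) u / t ^ 3 = M (t\<^sup>2 * n) * (t * n) / t ^ 3 - dPot (\<lambda>x. t * u x) u / t ^ 3"
      by (simp add: J'_def N_ray[OF u(1)] ip_ray[OF u(1)] n_def diff_divide_distrib)
    also have "M (t\<^sup>2 * n) * (t * n) / t ^ 3 = n\<^sup>2 * (M (t\<^sup>2 * n) / (t\<^sup>2 * n))"
      using t n by (simp add: eval_nat_numeral)
    finally show ?thesis by (simp add: dPot_def)
  qed
  have "s\<^sup>2 < t\<^sup>2" using st by (intro power_strict_mono) auto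
  then have "M (t\<^sup>2 * n) / (t\<^sup>2 * n) < M (s\<^sup>2 * n) / (s\<^sup>2 * n)"
    using st n by (intro monotone_onD[OF M_ratio, of "s\<^sup>2 * n" "t\<^sup>2 * n"]) auto
  then have "n\<^sup>2 * (M (t\<^sup>2 * n) / (t\<^sup>2 * n)) < n\<^sup>2 * (M (s\<^sup>2 * n) / (s\<^sup>2 * n))"
    using n by (intro mult_strict_left_mono) auto
  moreover have "(LINT x|\<mu>. f (s * u x) * u x / s ^ 3) \<le> (LINT x|\<mu>. f (t * u x) * u x / t ^ 3)"
    using integrable_f[OF H_cmult[OF u(1)] u(1)] by (intro integral_mono f_ray_mono[OF st]) auto
  ultimately show ?thesis using st by (simp add: slope)
qed

lemma ray_increasing:
  assumes u: "u \<in> H" "N u > 0" and T: "J' (\<lambda>x. T * u x) u = 0" and st: "0 \<le> s" "s < t" "t \<le> T"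
  shows "J (\<lambda>x. s * u x) < J (\<lambda>x. t * u x)"
proof (rule DERIV_pos_imp_increasing_open[OF st(2)])
  fix x assume x: "s < x" "x < t"
  have "J' (\<lambda>y. T * u y) u / T ^ 3 < J' (\<lambda>y. x * u y) u / x ^ 3"
    using x st by (intro ray_slope_decreasing[OF u]) auto
  then have "J' (\<lambda>y. x * u y) u > 0" using x st T by (simp add: zero_less_divide_iff)
  then show "\<exists>y. ((\<lambda>t. J (\<lambda>x. t * u x)) has_real_derivative y) (at x) \<and> 0 < y"
    using ray_derivative[OF u(1)] by blast
qed (use ray_derivative[OF u(1)] DERIV_isCont in \<open>blast intro: continuous_at_imp_continuous_on\<close>)

lemma ray_decreasing:
  assumes u: "u \<in> H" "N u > 0" and T: "J' (\<lambda>x. T * u x) u = 0" "T > 0" and st: "T \<le> s" "s < t"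
  shows "J (\<lambda>x. t * u x) < J (\<lambda>x. s * u x)"
proof (rule DERIV_neg_imp_decreasing_open[OF st(2)])
  fix x assume x: "s < x" "x < t"
  have "J' (\<lambda>y. x * u y) u / x ^ 3 < J' (\<lambda>y. T * u y) u / T ^ 3"
    using x st T by (intro ray_slope_decreasing[OF u]) auto
  then have "J' (\<lambda>y. x * u y) u < 0" using x st T by (simp add: divide_less_0_iff)
  then show "\<exists>y. ((\<lambda>t. J (\<lambda>x. t * u x)) has_real_derivative y) (at x) \<and> y < 0"
    using ray_derivative[OF u(1)] by blast
qed (use ray_derivative[OF u(1)] DERIV_isCont in \<open>blast intro: continuous_at_imp_continuous_on\<close>)

lemma ray_le_critical:
  assumes u: "u \<in> H" "N u > 0" and T: "J' (\<lambda>x. T * u x) u = 0" "T > 0" and t: "t \<ge> 0"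
  shows "J (\<lambda>x. t * u x) \<le> J (\<lambda>x. T * u x)"
  using ray_increasing[OF u T(1) t, of T] ray_decreasing[OF u T order_refl, of t]
  by (cases t T rule: linorder_cases) auto

lemma M_hat_lower: "s \<ge> 0 \<Longrightarrow> primitive M s \<ge> M 0 * s"
proof -
  assume s: "s \<ge> 0"
  obtain x where "\<bar>x - 0\<bar> \<le> \<bar>s - 0\<bar>" "0 \<le> x" "primitive M s - primitive M 0 = M x * (s - 0)"
    by (rule M_hat_mvt[OF order_refl s]) (rule that)
  then show ?thesis using M_mono_le[of 0 x] s by (simp add: primitive_zero mult_right_mono)
qed

lemma M_hat_upper: "s \<ge> 0 \<Longrightarrow> primitive M s \<le> M 1 * (s + s\<^sup>2)"
proof -
  assume s: "s \<ge> 0"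
  obtain x where x: "\<bar>x - 0\<bar> \<le> \<bar>s - 0\<bar>" "0 \<le> x" "primitive M s - primitive M 0 = M x * (s - 0)"
    by (rule M_hat_mvt[OF order_refl s]) (rule that)
  have M1: "M 1 > 0" by (rule M_positive) simp
  have "M x \<le> M 1 * (1 + s)"
  proof (cases "x \<le> 1")
    case True
    then have "M x \<le> M 1" using x(2) by (intro M_mono_le) auto
    also have "\<dots> \<le> M 1 * (1 + s)" using M1 s by simp
    finally show ?thesis .
  next
    case False
    then have "M x / x < M 1 / 1" by (intro monotone_onD[OF M_ratio]) auto
    then have "M x \<le> M 1 * x" using False by (simp add: divide_less_eq)
    also have "\<dots> \<le> M 1 * (1 + s)" using M1 x(1) s by (intro mult_left_mono) auto
    finally show ?thesis .
  qed
  then have "M x * s \<le> M 1 * (1 + s) * s" using s by (rule mult_right_mono)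
  then show ?thesis using x(3) by (simp add: primitive_zero algebra_simps power2_eq_square)
qed

lemma M_hat_mono: "0 \<le> s \<Longrightarrow> s \<le> t \<Longrightarrow> primitive M s \<le> primitive M t"
proof -
  assume st: "0 \<le> s" "s \<le> t"
  then have "0 \<le> t" by simp
  obtain x where x: "\<bar>x - s\<bar> \<le> \<bar>t - s\<bar>" "0 \<le> x" "primitive M t - primitive M s = M x * (t - s)"
    by (rule M_hat_mvt[OF st(1) \<open>0 \<le> t\<close>]) (rule that)
  have "M x * (t - s) \<ge> 0" using M_positive[OF x(2)] st by simp
  then show ?thesis using x(3) by linarith
qed

text \<open>Near \<open>0\<close> the quadratic part of the energy dominates: \<open>F\<close> contributes a small multiple of \<open>t\<^sup>2\<close> and
  a term of order \<open>t\<^sup>\<alpha>\<close> with \<open>\<alpha> > 2\<close>.\<close>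

lemma ray_positive:
  assumes u: "u \<in> H" "N u > 0"
  obtains t where "t > 0" "J (\<lambda>x. t * u x) > 0"
proof -
  \<comment> \<open>The quadratic part of the energy is at least \<open>4 m t\<^sup>2\<close>, and \<open>F\<close> takes away at most \<open>2 m t\<^sup>2\<close>.\<close>
  define m where "m = M 0 * (N u)\<^sup>2 / 8"
  have m: "m > 0" using M_pos u(2) by (simp add: m_def)
  define I where "I = (LINT x|\<mu>. (u x)\<^sup>2)"
  define U where "U = (LINT x|\<mu>. \<bar>u x\<bar> powr \<alpha>)"
  have IU: "I \<ge> 0" "U \<ge> 0" by (simp_all add: I_def U_def)
  define e where "e = m / (I + 1)"
  have e: "e > 0" "e * I \<le> m" using m IU(1) by (simp_all add: e_def divide_le_eq)
  obtain C where C: "C \<ge> 0" "\<And>t. F t \<le> e * t\<^sup>2 + C * \<bar>t\<bar> powr \<alpha>" by (rule F_small[OF e(1)]) (rule that)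
  define t where "t = (m / (C * U + 1)) powr (1 / (\<alpha> - 2))"
  have CU: "C * U \<ge> 0" using C(1) IU(2) by simp
  have t: "t > 0" unfolding t_def using m CU by simp
  have "t powr (\<alpha> - 2) = m / (C * U + 1)" unfolding t_def using \<alpha> m CU by (simp add: powr_powr)
  then have tC: "C * U * t powr (\<alpha> - 2) \<le> m" using m CU by (simp add: divide_le_eq)
  have t\<alpha>: "t powr \<alpha> = t\<^sup>2 * t powr (\<alpha> - 2)"
    using t powr_add[of t 2 "\<alpha> - 2"] by simp
  have "Pot (\<lambda>x. t * u x) \<le> (LINT x|\<mu>. e * t\<^sup>2 * (u x)\<^sup>2 + C * t powr \<alpha> * \<bar>u x\<bar> powr \<alpha>)"
    unfolding Pot_def
  proof (rule integral_mono)
    show "integrable \<mu> (\<lambda>x. F (t * u x))" by (rule integrable_F[OF H_cmult[OF u(1)]])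
    show "integrable \<mu> (\<lambda>x. e * t\<^sup>2 * (u x)\<^sup>2 + C * t powr \<alpha> * \<bar>u x\<bar> powr \<alpha>)"
      using integrable_powr[OF u(1)] integrable_square[OF u(1)] by simp
    show "F (t * u x) \<le> e * t\<^sup>2 * (u x)\<^sup>2 + C * t powr \<alpha> * \<bar>u x\<bar> powr \<alpha>" for x
      using C(2)[of "t * u x"] t by (simp add: power_mult_distrib abs_mult powr_mult mult.assoc)
  qed
  also have "\<dots> = t\<^sup>2 * (e * I + C * U * t powr (\<alpha> - 2))"
    using integrable_powr[OF u(1)] integrable_square[OF u(1)] by (simp add: I_def U_def t\<alpha> algebra_simps)
  also have "\<dots> \<le> t\<^sup>2 * (m + m)" using e(2) tC by (intro mult_left_mono add_mono) auto
  finally have "Pot (\<lambda>x. t * u x) \<le> 2 * m * t\<^sup>2" by (simp add: algebra_simps)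
  moreover have "primitive M ((N (\<lambda>x. t * u x))\<^sup>2) \<ge> 8 * m * t\<^sup>2"
    using M_hat_lower[of "t\<^sup>2 * (N u)\<^sup>2"] by (simp add: N_ray[OF u(1)] m_def algebra_simps)
  ultimately have "J (\<lambda>x. t * u x) \<ge> 2 * m * t\<^sup>2" unfolding J_eq by linarith
  moreover have "2 * m * t\<^sup>2 > 0" using m t by simp
  ultimately show ?thesis using t by (intro that[of t]) auto
qed

text \<open>The primitive of \<open>M\<close> grows at most quadratically, so the nonlocal part is of order \<open>t\<^sup>4\<close>. Since
  \<open>F(s) \<ge> A s\<^sup>4 - A R\<^sup>4\<close> for all \<open>s\<close> with \<open>A\<close> as large as desired, the integral of \<open>F(t u)\<close> wins.\<close>

lemma ray_negative:
  assumes u: "u \<in> H" "N u > 0"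
  obtains T where "T > 0" "\<And>t. t \<ge> T \<Longrightarrow> J (\<lambda>x. t * u x) < 0"
proof -
  define n where "n = (N u)\<^sup>2"
  have four: "(0::real) < 4" "(4::real) < 6" by simp_all
  obtain K where K: "\<And>u a. u \<in> H \<Longrightarrow> a > 0 \<Longrightarrow> N u \<le> a \<Longrightarrow> integrable \<mu> (\<lambda>x. \<bar>u x\<bar> powr 4)"
    by (rule sobolev_H[OF four]) (rule that)
  have int4: "integrable \<mu> (\<lambda>x. (u x) ^ 4)"
    using K[OF u(1,2) order_refl] by (simp add: powr_numeral)
  define I where "I = (LINT x|\<mu>. (u x) ^ 4)"
  have I: "I > 0"
  proof -
    have "I \<noteq> 0"
    proof
      assume "I = 0"
      then have "AE x in \<mu>. (u x) ^ 4 = 0" unfolding I_def using integral_nonneg_eq_0_iff_AE[OF int4] by simp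
      then have "AE x in \<mu>. u x = 0" by simp
      then show False using N_eq_0_iff[OF u(1)] u(2) by simp
    qed
    moreover have "I \<ge> 0" unfolding I_def by simp
    ultimately show ?thesis by simp
  qed
  define k where "k = M 1 * (n + n\<^sup>2)"
  have k: "k \<ge> 0" using M_positive[of 1] by (simp add: k_def n_def)
  \<comment> \<open>Chosen such that the quartic part of \<open>F\<close> exceeds the nonlocal part by at least \<open>t\<^sup>4\<close>.\<close>
  define A where "A = (k + 1) / I"
  have A: "A > 0" "A * I = k + 1" using I k by (simp_all add: A_def)
  obtain R where R: "R > 0" "\<And>t. \<bar>t\<bar> \<ge> R \<Longrightarrow> F t \<ge> A * t ^ 4" by (rule F_superquartic) (rule that)
  have low: "F t \<ge> A * t ^ 4 - A * R ^ 4" for t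
  proof (cases "\<bar>t\<bar> \<ge> R")
    case True
    have "A * R ^ 4 \<ge> 0" using A by simp
    then show ?thesis using R(2)[OF True] by linarith
  next
    case False
    then have "\<bar>t\<bar> ^ 4 \<le> R ^ 4" by (intro power_mono) auto
    then have "A * t ^ 4 \<le> A * R ^ 4" using A by simp
    then show ?thesis using F_nonneg[of t] by linarith
  qed
  define B where "B = A * R ^ 4 * measure \<mu> \<Omega>"
  have B: "B \<ge> 0" using A by (simp add: B_def)
  have up: "J (\<lambda>x. t * u x) \<le> B - t ^ 4" if t: "t \<ge> 1" for t
  proof -
    have "(LINT x|\<mu>. A * t ^ 4 * (u x) ^ 4 - A * R ^ 4) \<le> Pot (\<lambda>x. t * u x)"
      unfolding Pot_def
    proof (rule integral_mono)
      show "integrable \<mu> (\<lambda>x. F (t * u x))" by (rule integrable_F[OF H_cmult[OF u(1)]])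
      show "integrable \<mu> (\<lambda>x. A * t ^ 4 * (u x) ^ 4 - A * R ^ 4)" using int4 by simp
      show "A * t ^ 4 * (u x) ^ 4 - A * R ^ 4 \<le> F (t * u x)" for x
        using low[of "t * u x"] by (simp add: power_mult_distrib mult.assoc)
    qed
    moreover have "(LINT x|\<mu>. A * t ^ 4 * (u x) ^ 4 - A * R ^ 4) = t ^ 4 * (A * I) - B"
      using int4 by (simp add: I_def B_def space_\<mu>)
    ultimately have 1: "Pot (\<lambda>x. t * u x) \<ge> t ^ 4 * (k + 1) - B" unfolding A(2) by simp
    have "primitive M (t\<^sup>2 * n) \<le> M 1 * (t\<^sup>2 * n + (t\<^sup>2 * n)\<^sup>2)" by (rule M_hat_upper) (simp add: n_def)
    also have "\<dots> \<le> M 1 * (t ^ 4 * n + t ^ 4 * n\<^sup>2)"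
    proof (intro mult_left_mono add_mono)
      show "t\<^sup>2 * n \<le> t ^ 4 * n" using power_increasing[of 2 4 t] t by (intro mult_right_mono) (auto simp: n_def)
      show "(t\<^sup>2 * n)\<^sup>2 \<le> t ^ 4 * n\<^sup>2" by (simp add: power_mult_distrib)
    qed (use M_positive[of 1] in simp)
    also have "\<dots> = t ^ 4 * k" by (simp add: k_def algebra_simps)
    finally have "primitive M ((N (\<lambda>x. t * u x))\<^sup>2) \<le> t ^ 4 * k" by (simp add: N_ray[OF u(1)] n_def)
    moreover have "t ^ 4 * k \<ge> 0" "t ^ 4 * (k + 1) = t ^ 4 * k + t ^ 4" using k by (simp_all add: algebra_simps)
    ultimately show ?thesis using 1 unfolding J_eq by linarith
  qed
  show ?thesis
  proof (rule that[of "B + 2"])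
    fix t assume t: "B + 2 \<le> t"
    have "t ^ 1 \<le> t ^ 4" using t B by (intro power_increasing) auto
    then show "J (\<lambda>x. t * u x) < 0" using up[of t] t B by simp
  qed (use B in simp)
qed

lemma ray_maximum:
  assumes u: "u \<in> H" "N u > 0"
  obtains T where "T > 0" "J' (\<lambda>x. T * u x) u = 0" "\<And>t. t \<ge> 0 \<Longrightarrow> J (\<lambda>x. t * u x) \<le> J (\<lambda>x. T * u x)"
proof -
  obtain t0 where t0: "t0 > 0" "J (\<lambda>x. t0 * u x) > 0" by (rule ray_positive[OF u]) (rule that)
  obtain T1 where T1: "T1 > 0" "\<And>t. t \<ge> T1 \<Longrightarrow> J (\<lambda>x. t * u x) < 0" by (rule ray_negative[OF u]) (rule that)
  have cont: "continuous_on {0..T1} (\<lambda>t. J (\<lambda>x. t * u x))"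
    using ray_derivative[OF u(1)] DERIV_isCont by (blast intro: continuous_at_imp_continuous_on)
  obtain T where T: "T \<in> {0..T1}" "\<And>t. t \<in> {0..T1} \<Longrightarrow> J (\<lambda>x. t * u x) \<le> J (\<lambda>x. T * u x)"
    using continuous_attains_sup[OF _ _ cont] T1(1) by auto
  have t0T1: "t0 < T1" using t0(2) T1(2)[of t0] by (cases "t0 < T1") auto
  then have pos: "J (\<lambda>x. T * u x) > 0" using T(2)[of t0] t0 by simp
  then have Tpos: "T > 0" using T(1) J_zero by (cases "T = 0") auto
  have T_lt: "T < T1" using pos T1(2)[of T] by (cases "T < T1") auto
  have le: "J (\<lambda>x. t * u x) \<le> J (\<lambda>x. T * u x)" if "t \<ge> 0" for t
    using T(2)[of t] T1(2)[of t] pos that by (cases "t \<le> T1") auto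
  have "J' (\<lambda>x. T * u x) u = 0"
  proof (rule DERIV_local_max[OF ray_derivative[OF u(1)]])
    show "0 < T" by (rule Tpos)
    show "\<forall>y. \<bar>T - y\<bar> < T \<longrightarrow> J (\<lambda>x. y * u x) \<le> J (\<lambda>x. T * u x)" using le by auto
  qed
  with Tpos show ?thesis using le by (rule that)
qed

section \<open>The ground state\<close>

text \<open>Upper bounds of \<open>J\<close> on a ray. Each ray is represented by its unit vector, so that a sequence of
  almost optimal rays is bounded in \<open>H\<^sub>0\<^sup>1\<close>.\<close>

definition levels :: "real set" where
  "levels = {a. \<exists>v\<in>H. N v = 1 \<and> (\<forall>t\<ge>0. J (\<lambda>x. t * v x) \<le> a)}"

definition ground_level :: real where "ground_level = Inf levels"

lemma levels_bdd_below: "bdd_below levels"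
proof (rule bdd_belowI[of _ 0])
  fix a assume "a \<in> levels"
  then obtain v where "\<forall>t\<ge>0. J (\<lambda>x. t * v x) \<le> a" by (auto simp: levels_def)
  from this[rule_format, of 0] show "0 \<le> a" by (simp add: J_zero)
qed

lemma ground_level_le:
  assumes u: "u \<in> H" "N u > 0" and a: "\<And>t. t \<ge> 0 \<Longrightarrow> J (\<lambda>x. t * u x) \<le> a"
  shows "a \<in> levels" "ground_level \<le> a"
proof -
  define v where "v = (\<lambda>x. 1 / N u * u x)"
  have "v \<in> H" unfolding v_def by (rule H_cmult[OF u(1)])
  moreover have "N v = 1" unfolding v_def using u by (subst N_cmult) auto
  moreover have "J (\<lambda>x. t * v x) \<le> a" if "t \<ge> 0" for t
    using a[of "t / N u"] that u(2) by (simp add: v_def)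
  ultimately show "a \<in> levels" by (auto simp: levels_def)
  then show "ground_level \<le> a" unfolding ground_level_def by (rule cInf_lower[OF _ levels_bdd_below])
qed

text \<open>A critical point maximises \<open>J\<close> on its ray, so its energy is one of the \<open>levels\<close>.\<close>

lemma critical_point_energy_ge:
  assumes "critical_point \<Omega> J u" "nontrivial_on \<Omega> u"
  shows "ground_level \<le> J u"
proof -
  note u = critical_point_ray[OF assms(1)]
  have N: "N u > 0" using nontrivial_iff[OF u(1)] assms(2) by simp
  have "J (\<lambda>x. t * u x) \<le> J u" if "t \<ge> 0" for t
    using ray_le_critical[OF u(1) N, of 1 t] u(2) that by simp
  then show ?thesis by (rule ground_level_le(2)[OF u(1) N])
qed

text \<open>The limit \<open>w\<close> of almost optimal unit vectors has norm at most \<open>1\<close>, possibly smaller. The energy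
  bound survives in the form \<open>lim\<close>, with the norm of \<open>w\<close> still replaced by \<open>1\<close>. It excludes \<open>w = 0\<close>,
  and by monotonicity of the primitive of \<open>M\<close> it is stronger than the bound for \<open>w\<close> itself.\<close>

lemma optimal_ray:
  assumes "\<Omega> \<noteq> {}"
  obtains v where "v \<in> H" "N v > 0" "\<And>t. t \<ge> 0 \<Longrightarrow> J (\<lambda>x. t * v x) \<le> ground_level"
proof -
  obtain u where u: "u \<in> H" "N u = 1" by (rule nontrivial_exists[OF assms]) (rule that)
  have "N u > 0" using u(2) by simp
  then obtain T where "\<And>t. t \<ge> 0 \<Longrightarrow> J (\<lambda>x. t * u x) \<le> J (\<lambda>x. T * u x)"
    using ray_maximum[OF u(1)] by blast
  then have "levels \<noteq> {}" using u by (auto simp: levels_def)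
  then have "\<exists>a\<in>levels. a < ground_level + 1 / real (Suc n)" for n
    unfolding ground_level_def by (intro cInf_lessD) auto
  then have ex: "\<exists>v. v \<in> H \<and> N v = 1 \<and> (\<forall>t\<ge>0. J (\<lambda>x. t * v x) \<le> ground_level + 1 / real (Suc n))" for n
    unfolding levels_def by (smt (verit) mem_Collect_eq)
  obtain v where "\<forall>n. v n \<in> H \<and> N (v n) = 1 \<and> (\<forall>t\<ge>0. J (\<lambda>x. t * v n x) \<le> ground_level + 1 / real (Suc n))"
    using choice[OF allI[OF ex]] ..
  then have v: "\<And>n. v n \<in> H" "\<And>n. N (v n) = 1" "\<And>n t. t \<ge> 0 \<Longrightarrow> J (\<lambda>x. t * v n x) \<le> ground_level + 1 / real (Suc n)"
    by blast+
  have v1: "N (v n) \<le> 1" for n using v(2) by simp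
  obtain r :: "nat \<Rightarrow> nat" and w where r: "strict_mono r" and w: "w \<in> H" "N w \<le> 1"
    "\<And>q. 2 \<le> q \<Longrightarrow> q < 6 \<Longrightarrow> (\<lambda>n. LINT x|\<mu>. \<bar>v (r n) x - w x\<bar> powr q) \<longlonglongrightarrow> 0"
    by (rule compact_embedding[OF v(1) v1]) (rule that)
  have lim: "primitive M (t\<^sup>2) / 2 - Pot (\<lambda>x. t * w x) \<le> ground_level" if t: "t \<ge> 0" for t
  proof -
    have "(\<lambda>n. Pot (\<lambda>x. t * v (r n) x)) \<longlonglongrightarrow> Pot (\<lambda>x. t * w x)"
    proof (rule Pot_tendsto[OF H_cmult[OF v(1)] H_cmult[OF w(1)]])
      have d: "t * v (r n) x - t * w x = t * (v (r n) x - w x)" for n x by (simp add: algebra_simps)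
      have "(\<lambda>n. LINT x|\<mu>. (v (r n) x - w x)\<^sup>2) \<longlonglongrightarrow> 0"
        using w(3)[of 2] by (simp add: powr_numeral)
      from tendsto_mult_left[OF this, of "t\<^sup>2"]
      show "(\<lambda>n. LINT x|\<mu>. (t * v (r n) x - t * w x)\<^sup>2) \<longlonglongrightarrow> 0"
        unfolding d by (simp add: power_mult_distrib)
      from tendsto_mult_left[OF w(3)[OF \<alpha>_range(2) \<alpha>(2)], of "t powr \<alpha>"]
      show "(\<lambda>n. LINT x|\<mu>. \<bar>t * v (r n) x - t * w x\<bar> powr \<alpha>) \<longlonglongrightarrow> 0"
        unfolding d using t by (simp add: abs_mult powr_mult)
    qed
    then have "(\<lambda>n. primitive M (t\<^sup>2) / 2 - Pot (\<lambda>x. t * v (r n) x)) \<longlonglongrightarrow> primitive M (t\<^sup>2) / 2 - Pot (\<lambda>x. t * w x)"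
      by (intro tendsto_intros)
    moreover have "(\<lambda>n. ground_level + 1 / real (Suc (r n))) \<longlonglongrightarrow> ground_level + 0"
      by (intro tendsto_add tendsto_const LIMSEQ_subseq_LIMSEQ[OF LIMSEQ_Suc[OF lim_1_over_n] r, unfolded o_def])
    moreover have "primitive M (t\<^sup>2) / 2 - Pot (\<lambda>x. t * v (r n) x) \<le> ground_level + 1 / real (Suc (r n))" for n
      using v(3)[OF t, of "r n"] by (simp add: J_eq N_ray[OF v(1)] v(2))
    ultimately show ?thesis using LIMSEQ_le[of _ _ _ "ground_level + 0"] by auto
  qed
  have "N w \<noteq> 0"
  proof
    assume "N w = 0"
    then have w0: "AE x in \<mu>. w x = 0" using N_eq_0_iff[OF w(1)] by simp
    have Pot0: "Pot (\<lambda>x. t * w x) = 0" for t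
    proof -
      note [measurable] = H_measurable[OF w(1)]
      have "Pot (\<lambda>x. t * w x) = (LINT x|\<mu>. 0)"
        unfolding Pot_def using w0 by (intro integral_cong_AE) (auto elim!: eventually_mono simp: primitive_zero)
      then show ?thesis by simp
    qed
    have g0: "ground_level \<ge> 0" using lim[of 0] Pot0[of 0] by (simp add: primitive_zero)
    \<comment> \<open>At this \<open>t\<close> the nonlocal part alone is at least \<open>ground_level + 1\<close>.\<close>
    define t where "t = sqrt (2 * (ground_level + 1) / M 0)"
    have t2: "t\<^sup>2 = 2 * (ground_level + 1) / M 0" unfolding t_def using M_pos g0 by simp
    have "M 0 * t\<^sup>2 \<le> primitive M (t\<^sup>2)" by (rule M_hat_lower) simp
    then have "primitive M (t\<^sup>2) / 2 \<ge> ground_level + 1" unfolding t2 using M_pos by simp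
    moreover have "t \<ge> 0" unfolding t_def using M_pos g0 by simp
    ultimately show False using lim[of t] by (simp add: Pot0)
  qed
  then have Nw: "N w > 0" using N_nonneg[of w] by simp
  show ?thesis
  proof (rule that[OF w(1) Nw])
    fix t :: real assume t: "t \<ge> 0"
    have "(N w)\<^sup>2 \<le> 1" using w(2) N_nonneg[of w] by (simp add: power_le_one)
    then have "primitive M (t\<^sup>2 * (N w)\<^sup>2) \<le> primitive M (t\<^sup>2)"
      by (intro M_hat_mono) (auto simp: mult_left_le)
    then show "J (\<lambda>x. t * w x) \<le> ground_level" using lim[OF t] by (simp add: J_eq N_ray[OF w(1)])
  qed
qed

text \<open>If \<open>J\<close> decreased at \<open>u\<close> in direction \<open>v\<close>, consider the ray of \<open>z = u + h v\<close> for small \<open>h > 0\<close>. By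
  continuity \<open>J\<close> is larger at \<open>z\<close> than at \<open>(1 - \<delta>) z\<close> and \<open>(1 + \<delta>) z\<close>, so the maximum of this ray is
  attained at some \<open>T z\<close> with \<open>T\<close> between \<open>1 - \<delta>\<close> and \<open>1 + \<delta>\<close>. Strict differentiability compares \<open>T z\<close>
  with \<open>T u\<close> and gives \<open>J(T z) < J(T u) \<le> J(u)\<close>, below the minimax level.\<close>

lemma minimax_critical:
  assumes u: "u \<in> H" "N u > 0" and u_crit: "J' u u = 0" and u_level: "J u \<le> ground_level"
  shows "critical_point \<Omega> J u"
proof (rule critical_pointI[OF u(1)])
  have no_descent: "\<not> J' u v < 0" if v: "v \<in> H" for v
  proof
    assume neg: "J' u v < 0"
    define Q where "Q = 2 * (N v + 1)"
    define e where "e = - J' u v / Q"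
    have Q: "Q > 0" using N_nonneg[of v] by (simp add: Q_def)
    have e: "e > 0" using divide_neg_pos[OF neg Q] by (simp add: e_def)
    have eN: "e * N v < - J' u v"
    proof -
      have "e * N v < e * Q" using e N_nonneg[of v] by (intro mult_strict_left_mono) (auto simp: Q_def)
      then show ?thesis using Q by (simp add: e_def)
    qed
    obtain d where d: "d > 0" "\<And>v w. v \<in> H \<Longrightarrow> w \<in> H \<Longrightarrow> N v \<le> d \<Longrightarrow> N w \<le> d \<Longrightarrow>
      \<bar>J (\<lambda>x. u x + w x + v x) - J (\<lambda>x. u x + w x) - J' u v\<bar> \<le> e * N v"
      by (rule J_strict_derivative[OF u(1) e]) (rule that)
    define \<delta> where "\<delta> = min (1 / 2) (d / N u)"
    have \<delta>: "0 < \<delta>" "\<delta> \<le> 1 / 2" "\<delta> * N u \<le> d" using d(1) u(2) by (auto simp: \<delta>_def min_def field_simps)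
    have one: "J' (\<lambda>x. 1 * u x) u = 0" using u_crit by simp
    have strict: "J (\<lambda>x. (1 - \<delta>) * u x) < J u" "J (\<lambda>x. (1 + \<delta>) * u x) < J u"
      using ray_increasing[OF u one, of "1 - \<delta>" 1] ray_decreasing[OF u one, of 1 "1 + \<delta>"] \<delta> by auto
    have cont: "((\<lambda>h. J (\<lambda>x. a * (u x + h * v x))) \<longlongrightarrow> J (\<lambda>x. a * u x)) (at_right 0)" for a
    proof -
      have "isCont (\<lambda>h. J (\<lambda>x. a * u x + h * (a * v x))) 0"
        using line_derivative[OF H_cmult[OF u(1), of a] H_cmult[OF v, of a]] by (rule DERIV_isCont)
      then have "((\<lambda>h. J (\<lambda>x. a * u x + h * (a * v x))) \<longlongrightarrow> J (\<lambda>x. a * u x)) (at 0)"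
        by (simp add: isCont_def)
      moreover have "(\<lambda>x. a * u x + h * (a * v x)) = (\<lambda>x. a * (u x + h * v x))" for h
        by (simp add: algebra_simps)
      ultimately have "((\<lambda>h. J (\<lambda>x. a * (u x + h * v x))) \<longlongrightarrow> J (\<lambda>x. a * u x)) (at 0)" by simp
      then show ?thesis by (rule tendsto_mono[rotated]) (simp add: at_le)
    qed
    have cont1: "((\<lambda>h. J (\<lambda>x. u x + h * v x)) \<longlongrightarrow> J u) (at_right 0)" using cont[of 1] by simp
    have gap: "\<forall>\<^sub>F h in at_right 0. J (\<lambda>x. a * (u x + h * v x)) < J (\<lambda>x. u x + h * v x)"
      if "J (\<lambda>x. a * u x) < J u" for a
    proof -
      define m where "m = (J (\<lambda>x. a * u x) + J u) / 2"
      have "\<forall>\<^sub>F h in at_right 0. J (\<lambda>x. a * (u x + h * v x)) < m"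
        using that by (intro order_tendstoD(2)[OF cont]) (simp add: m_def)
      moreover have "\<forall>\<^sub>F h in at_right 0. m < J (\<lambda>x. u x + h * v x)"
        using that by (intro order_tendstoD(1)[OF cont1]) (simp add: m_def)
      ultimately show ?thesis by eventually_elim simp
    qed
    \<comment> \<open>For \<open>h < b\<close> the vector \<open>h v\<close> is shorter than \<open>u\<close>, so \<open>z \<noteq> 0\<close>, and twice \<open>h v\<close> is within the range of \<open>d\<close>.\<close>
    define b where "b = min (N u) d / Q"
    have b: "b > 0" using u(2) d(1) Q by (simp add: b_def)
    have "\<forall>\<^sub>F h in at_right 0. h \<in> {0<..<b}" using b by (rule eventually_at_right_real)
    then have "\<forall>\<^sub>F h in at_right 0. h \<in> {0<..<b} \<and> J (\<lambda>x. (1 - \<delta>) * (u x + h * v x)) < J (\<lambda>x. u x + h * v x)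
      \<and> J (\<lambda>x. (1 + \<delta>) * (u x + h * v x)) < J (\<lambda>x. u x + h * v x)"
      using gap[OF strict(1)] gap[OF strict(2)] by eventually_elim auto
    then obtain h where h: "0 < h" "h < b" "J (\<lambda>x. (1 - \<delta>) * (u x + h * v x)) < J (\<lambda>x. u x + h * v x)"
      "J (\<lambda>x. (1 + \<delta>) * (u x + h * v x)) < J (\<lambda>x. u x + h * v x)"
      using eventually_happens'[of "at_right (0::real)"] by (auto simp: trivial_limit_at_right_real)
    define z where "z = (\<lambda>x. u x + h * v x)"
    have hv: "(\<lambda>x. h * v x) \<in> H" by (rule H_cmult[OF v])
    have z: "z \<in> H" unfolding z_def by (rule H_add[OF u(1) hv])
    have "h * Q \<le> b * Q" using h Q by (intro mult_right_mono) auto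
    then have hQ: "h * Q \<le> min (N u) d" using Q by (simp add: b_def)
    have hN: "2 * (h * N v) < min (N u) d"
    proof -
      have "2 * (h * N v) < h * Q" using h(1) by (simp add: Q_def algebra_simps)
      then show ?thesis using hQ by linarith
    qed
    have Nz: "N z > 0"
    proof -
      have "(\<lambda>x. z x - h * v x) = u" by (simp add: z_def)
      then have "N u \<le> N z + h * N v" using N_diff_triangle[OF z hv] h(1) by (simp add: N_cmult[OF v])
      moreover have "h * N v \<ge> 0" using h(1) N_nonneg[of v] by simp
      ultimately show ?thesis using hN by linarith
    qed
    obtain T where T: "T > 0" "J' (\<lambda>x. T * z x) z = 0" "\<And>t. t \<ge> 0 \<Longrightarrow> J (\<lambda>x. t * z x) \<le> J (\<lambda>x. T * z x)"
      by (rule ray_maximum[OF z Nz]) (rule that)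
    have T_less: "T < 1 + \<delta>"
    proof (rule ccontr)
      assume "\<not> T < 1 + \<delta>"
      then have "J (\<lambda>x. 1 * z x) < J (\<lambda>x. (1 + \<delta>) * z x)"
        using \<delta> by (intro ray_increasing[OF z Nz T(2)]) auto
      then show False using h(4) by (simp add: z_def)
    qed
    have T_greater: "1 - \<delta> < T"
    proof (rule ccontr)
      assume "\<not> 1 - \<delta> < T"
      then have "J (\<lambda>x. 1 * z x) < J (\<lambda>x. (1 - \<delta>) * z x)"
        using \<delta> by (intro ray_decreasing[OF z Nz T(2,1)]) auto
      then show False using h(3) by (simp add: z_def)
    qed
    define c where "c = T * h"
    have c: "c > 0" using T(1) h(1) by (simp add: c_def)
    have "T \<le> 2" using T_less \<delta> by simp
    then have "T * (h * N v) \<le> 2 * (h * N v)" using h(1) N_nonneg[of v] by (intro mult_right_mono) auto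
    then have Nc: "N (\<lambda>x. c * v x) \<le> d" using hN c N_cmult[OF v, of c] by (simp add: c_def mult.assoc)
    have NT: "N (\<lambda>x. (T - 1) * u x) \<le> d"
    proof -
      have "\<bar>T - 1\<bar> * N u \<le> \<delta> * N u" using T_less T_greater u(2) by (intro mult_right_mono) auto
      then show ?thesis using \<delta>(3) by (simp add: N_cmult[OF u(1)])
    qed
    have eqs: "(\<lambda>x. u x + (T - 1) * u x + c * v x) = (\<lambda>x. T * z x)" "(\<lambda>x. u x + (T - 1) * u x) = (\<lambda>x. T * u x)"
      by (simp_all add: z_def c_def algebra_simps)
    have "\<bar>J (\<lambda>x. T * z x) - J (\<lambda>x. T * u x) - c * J' u v\<bar> \<le> e * (c * N v)"
      using d(2)[OF H_cmult[OF v] H_cmult[OF u(1)] Nc NT] c by (simp add: eqs J'_cmult[OF u(1) v] N_cmult[OF v])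
    moreover have "e * (c * N v) < - (c * J' u v)"
      using mult_strict_left_mono[OF eN c] by (simp add: mult_ac)
    ultimately have "J (\<lambda>x. T * z x) < J (\<lambda>x. T * u x)" by linarith
    also have "\<dots> \<le> J u" using ray_le_critical[OF u one, of T] T(1) by simp
    also have "\<dots> \<le> ground_level" by (rule u_level)
    also have "\<dots> \<le> J (\<lambda>x. T * z x)" using T(3) by (rule ground_level_le(2)[OF z Nz])
    finally show False by simp
  qed
  fix v assume v: "v \<in> H"
  have "J' u (\<lambda>x. -1 * v x) = -1 * J' u v" by (rule J'_cmult[OF u(1) v])
  then show "J' u v = 0" using no_descent[OF v] no_descent[OF H_cmult[OF v, of "-1"]] by simp
qed

lemma ground_state_exists:
  assumes "\<Omega> \<noteq> {}"
  shows "\<exists>u. nontrivial_ground_state \<Omega> J u \<and> (AE x in \<mu>. u x \<ge> 0)"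
proof -
  obtain v where v: "v \<in> H" "N v > 0" "\<And>t. t \<ge> 0 \<Longrightarrow> J (\<lambda>x. t * v x) \<le> ground_level"
    by (rule optimal_ray[OF assms]) (rule that)
  define w where "w = (\<lambda>x. \<bar>v x\<bar>)"
  have w: "w \<in> H" "N w \<le> N v" unfolding w_def by (rule H_abs[OF v(1)])+
  have "N w \<noteq> 0" using N_eq_0_iff[OF w(1)] N_eq_0_iff[OF v(1)] v(2) by (simp add: w_def)
  then have Nw: "N w > 0" using N_nonneg[of w] by simp
  have w_level: "J (\<lambda>x. t * w x) \<le> ground_level" if t: "t \<ge> 0" for t
  proof -
    have "F (t * \<bar>y\<bar>) = F (t * y)" for y using F_abs[of "t * y"] t by (simp add: abs_mult)
    then have "Pot (\<lambda>x. t * w x) = Pot (\<lambda>x. t * v x)" by (simp add: Pot_def w_def)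
    moreover have "primitive M (t\<^sup>2 * (N w)\<^sup>2) \<le> primitive M (t\<^sup>2 * (N v)\<^sup>2)"
      using w(2) N_nonneg[of w] by (intro M_hat_mono mult_left_mono power_mono) auto
    ultimately show ?thesis using v(3)[OF t] by (simp add: J_eq N_ray[OF w(1)] N_ray[OF v(1)])
  qed
  obtain T where T: "T > 0" "J' (\<lambda>x. T * w x) w = 0" by (rule ray_maximum[OF w(1) Nw]) (rule that)
  define u where "u = (\<lambda>x. T * w x)"
  have u: "u \<in> H" "N u > 0" unfolding u_def using H_cmult[OF w(1)] N_cmult[OF w(1)] T(1) Nw by auto
  have "J' u u = T * J' u w" unfolding u_def by (rule J'_cmult[OF H_cmult[OF w(1)] w(1)])
  then have "J' u u = 0" using T(2) by (simp add: u_def)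
  moreover have Ju: "J u \<le> ground_level" unfolding u_def using w_level T(1) by simp
  ultimately have "critical_point \<Omega> J u" by (rule minimax_critical[OF u])
  moreover have "nontrivial_on \<Omega> u" using nontrivial_iff[OF u(1)] u(2) by simp
  moreover have "J u \<le> J z" if "critical_point \<Omega> J z \<and> nontrivial_on \<Omega> z" for z
    using critical_point_energy_ge[of z] that Ju by auto
  ultimately have "nontrivial_ground_state \<Omega> J u" by (auto simp: nontrivial_ground_state_def)
  moreover have "AE x in \<mu>. u x \<ge> 0" using T(1) by (intro AE_I2) (simp add: u_def w_def)
  ultimately show ?thesis by blast
qed

end

theorem corollary2p3:
  fixes \<Omega> :: "(real^3) set" and f M :: "real \<Rightarrow> real"
  assumes domain: "open \<Omega>" "connected \<Omega>" "\<Omega> \<noteq> {}" "bounded \<Omega>"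
    and f_odd: "\<forall>t. f (- t) = - f t"
    and f_C1: "f C1_differentiable_on UNIV"
    and f_nonneg: "\<forall>t\<ge>0. f t \<ge> 0"
    and M_nonneg: "\<forall>t\<ge>0. M t \<ge> 0"
    and M_C1: "C1_on_nonneg M"
    and h1: "strict_mono_on {0..} M" "M 0 > 0"
    and h2: "strict_antimono_on {0<..} (\<lambda>t. M t / t)"
    and h3: "((\<lambda>t. f t / t) \<longlongrightarrow> 0) (at 0)"
    and h4: "filterlim (\<lambda>t. primitive f t / t ^ 4) at_top at_top"
    and h5: "\<exists>\<alpha>::real. 4 < \<alpha> \<and> \<alpha> < 6 \<and> ((\<lambda>t. f t / t powr (\<alpha> - 1)) \<longlongrightarrow> 0) at_top"
    and h6: "strict_mono_on {0<..} (\<lambda>t. f t / t ^ 3)"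
  shows "\<exists>u. nontrivial_ground_state \<Omega> (kirchhoff_energy \<Omega> M f) u \<and>
             (AE x in lebesgue_on \<Omega>. u x \<ge> 0)"
proof -
  obtain \<alpha> :: real where \<alpha>: "4 < \<alpha>" "\<alpha> < 6" "((\<lambda>t. f t / t powr (\<alpha> - 1)) \<longlongrightarrow> 0) at_top"
    using h5 by blast
  obtain M' where "\<forall>t\<ge>0. (M has_real_derivative M' t) (at t within {0..})"
    using M_C1 by (auto simp: C1_on_nonneg_def)
  then have "continuous (at t within {0..}) M" if "t \<ge> 0" for t
    using DERIV_continuous that by blast
  then have M_cont: "continuous_on {0..} M"
    by (simp add: continuous_on_eq_continuous_within)
  interpret kirchhoff \<Omega> f \<alpha> M
    by unfold_locales (use domain f_odd f_C1 f_nonneg h1 h2 h3 h4 h6 \<alpha> M_cont in auto)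
  show ?thesis by (rule ground_state_exists[OF domain(3)])
qed

end
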